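(* Let $M \subset \mathbb{R}^d$ be a compact domain with piecewise $C^1$ boundary, and let $N \subset \mathbb{R}^d$ be a nonempty bounded set. Then the limits defining $D_N(M)$ and $D_{\operatorname{conv}(N)}(M)$ exist and $$D_N(M)=D_{\operatorname{conv}(N)}(M),$$ and $$D_N(M)=\int_{\operatorname{bd} M} h_N(u_M(x)) \, d\mathcal{H}^{d-1}(x).$$
   Context: For $S\subset\mathbb{R}^d$, $|S|$ denotes its $d$-dimensional volume (Lebesgue measure), $\operatorname{conv}(S)$ its convex hull, and $M+\epsilon N=\{m+\epsilon n : m\in M,\ n\in N\}$ is the Minkowski sum. For $M,N\subset\mathbb{R}^d$ define $$D_N(M)=\lim_{\epsilon\downarrow 0}\frac{|M+\epsilon N|-|M|}{\epsilon}$$ whenever the limit exists. The set $N$ is not assumed convex or closed. The support function of a nonempty bounded set $N$ is $h_N(u)=\sup_{x\in N} x\cdot u$. $\mathcal{H}^{d-1}$ is $(d-1)$-dimensional Hausdorff measure. A compact domain with piecewise $C^1$ boundary is a nonempty compact set $M$ equal to the closure of its interior, whose boundary $\operatorname{bd}M$ is a piecewise $C^1$ hypersurface: it is a finite union of compact pieces of $C^1$ hypersurfaces ($C^1$ up to the edges of the pieces), and the set $\operatorname{Sing}(\operatorname{bd}M)$ of singular (non-smooth) boundary points has zero $(d-1)$-dimensional Minkowski content, i.e. $|\operatorname{Sing}(\operatorname{bd}M)+\epsilon B|/\epsilon\to 0$ as $\epsilon\downarrow 0$, with $B$ the closed unit ball. A boundary point is smooth if near it $\operatorname{bd}M$ is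 a $C^1$ hypersurface with $M$ lying locally on one side of it. For a smooth point $x\in\operatorname{bd}M$, $u_M(x)$ is the unit outer normal vector of $M$ at $x$; it is thus defined $\mathcal{H}^{d-1}$-almost everywhere on $\operatorname{bd}M$. *)

theory Defs
  imports "HOL-Analysis.Analysis"
begin

section \<open>Volume and the derivative of volume\<close>

text \<open>For an arbitrary bounded set \<open>N\<close> the sum \<open>M + \<epsilon>N\<close> need not obviously be measurable, whereas
  \<^const>\<open>measure\<close> is \<open>0\<close> by convention on non-measurable sets. The volume is therefore taken to be the
  outer Lebesgue measure, which is Lebesgue measure on every measurable set.\<close>

definition volume :: "'a::euclidean_space set \<Rightarrow> real" where
  "volume S = enn2real (outer_measure_of lebesgue S)"

lemma volume_eq_measure: "S \<in> sets lebesgue \<Longrightarrow> volume S = measure lebesgue S"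
  by (simp add: volume_def measure_def)

definition volume_quotient :: "'a::euclidean_space set \<Rightarrow> 'a set \<Rightarrow> real \<Rightarrow> real" where
  "volume_quotient N M \<epsilon> = (volume (M + (*\<^sub>R) \<epsilon> ` N) - volume M) / \<epsilon>"

definition D_exists :: "'a::euclidean_space set \<Rightarrow> 'a set \<Rightarrow> bool" where
  "D_exists N M \<longleftrightarrow> (\<exists>L. (volume_quotient N M \<longlongrightarrow> L) (at_right 0))"

definition D :: "'a::euclidean_space set \<Rightarrow> 'a set \<Rightarrow> real" where
  "D N M = Lim (at_right 0) (volume_quotient N M)"

lemma D_eqI: "(volume_quotient N M \<longlongrightarrow> L) (at_right 0) \<Longrightarrow> D N M = L"
  unfolding D_def by (intro tendsto_Lim) auto

definition support_function :: "'a::euclidean_space set \<Rightarrow> 'a \<Rightarrow> real" where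
  "support_function N u = (SUP x\<in>N. x \<bullet> u)"


section \<open>Hausdorff measure\<close>

text \<open>The normalisation makes the \<open>k\<close>-dimensional measure agree with \<open>k\<close>-dimensional Lebesgue measure
  on \<open>k\<close>-planes. The outer measure is a metric outer measure, hence countably additive on Borel sets,
  and \<^const>\<open>measure_of\<close> returns it there. Nonempty sets have weight \<open>1\<close> for \<open>k = 0\<close> (since \<open>0 ^ 0 = 1\<close>), so the
  \<open>0\<close>-dimensional measure is counting measure.\<close>

definition hausdorff_weight :: "nat \<Rightarrow> 'a::metric_space set \<Rightarrow> ennreal" where
  "hausdorff_weight k C =
     (if C = {} then 0 else ennreal (unit_ball_vol (real k) * (diameter C / 2) ^ k))"

definition hausdorff_pre :: "nat \<Rightarrow> real \<Rightarrow> 'a::metric_space set \<Rightarrow> ennreal" where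
  "hausdorff_pre k \<delta> A =
     (INF C \<in> {C :: nat \<Rightarrow> 'a set. A \<subseteq> (\<Union>i. C i) \<and> (\<forall>i. bounded (C i) \<and> diameter (C i) \<le> \<delta>)}.
        \<Sum>i. hausdorff_weight k (C i))"

definition hausdorff_outer :: "nat \<Rightarrow> 'a::metric_space set \<Rightarrow> ennreal" where
  "hausdorff_outer k A = (SUP \<delta>\<in>{0<..}. hausdorff_pre k \<delta> A)"

definition hausdorff_measure :: "nat \<Rightarrow> 'a::metric_space measure" where
  "hausdorff_measure k = measure_of UNIV (sets borel) (hausdorff_outer k)"


section \<open>Domains with piecewise $C^1$ boundary\<close>

definition C1_regular_on :: "'a::euclidean_space set \<Rightarrow> ('a \<Rightarrow> real) \<Rightarrow> ('a \<Rightarrow> 'a) \<Rightarrow> bool" where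
  "C1_regular_on U f g \<longleftrightarrow>
     (\<forall>y\<in>U. GDERIV f y :> g y) \<and> continuous_on U g \<and> (\<forall>y\<in>U. g y \<noteq> 0)"

definition C1_hypersurface :: "'a::euclidean_space set \<Rightarrow> bool" where
  "C1_hypersurface S \<longleftrightarrow>
     (\<forall>x\<in>S. \<exists>U f g. open U \<and> x \<in> U \<and> C1_regular_on U f g \<and> S \<inter> U = {y\<in>U. f y = 0})"

definition smooth_boundary_chart ::
    "'a::euclidean_space set \<Rightarrow> 'a \<Rightarrow> 'a set \<Rightarrow> ('a \<Rightarrow> real) \<Rightarrow> ('a \<Rightarrow> 'a) \<Rightarrow> bool" where
  "smooth_boundary_chart M x U f g \<longleftrightarrow>
     open U \<and> x \<in> U \<and> C1_regular_on U f g \<and>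
     frontier M \<inter> U = {y\<in>U. f y = 0} \<and> M \<inter> U = {y\<in>U. f y \<le> 0}"

definition smooth_boundary_point :: "'a::euclidean_space set \<Rightarrow> 'a \<Rightarrow> bool" where
  "smooth_boundary_point M x \<longleftrightarrow> x \<in> frontier M \<and> (\<exists>U f g. smooth_boundary_chart M x U f g)"

definition Sing :: "'a::euclidean_space set \<Rightarrow> 'a set" where
  "Sing M = {x \<in> frontier M. \<not> smooth_boundary_point M x}"

text \<open>At a smooth boundary point \<open>M\<close> is locally a sublevel set, so the outer normal is the normalised
  gradient. It does not depend on the chart. At other points the value is unspecified.\<close>

definition outer_unit_normal :: "'a::euclidean_space set \<Rightarrow> 'a \<Rightarrow> 'a" where
  "outer_unit_normal M x = (THE u. \<exists>U f g. smooth_boundary_chart M x U f g \<and> u = sgn (g x))"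

lemma sublevel_gradient_halfspace:
  assumes 1: "smooth_boundary_chart M x U1 f1 g1" and 2: "smooth_boundary_chart M x U2 f2 g2"
    and x: "x \<in> frontier M" and h: "h \<bullet> g1 x < 0"
  shows "h \<bullet> g2 x \<le> 0"
proof (rule ccontr)
  assume "\<not> h \<bullet> g2 x \<le> 0"
  then have h2: "h \<bullet> g2 x > 0" by simp
  have f0: "f1 x = 0" "f2 x = 0" and U: "open U1" "x \<in> U1" "open U2" "x \<in> U2"
    using 1 2 x unfolding smooth_boundary_chart_def by blast+
  have line: "((\<lambda>t. x + t *\<^sub>R h) has_derivative (\<lambda>t. t *\<^sub>R h)) (at (0::real))"
    by (auto intro!: derivative_eq_intros)
  have der: "DERIV (\<lambda>t. f (x + t *\<^sub>R h)) 0 :> h \<bullet> g x" if "GDERIV f x :> g x" for f g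
  proof -
    have "(f has_derivative (\<lambda>h. h \<bullet> g x)) (at (x + 0 *\<^sub>R h))"
      using that by (simp add: gderiv_def)
    from has_derivative_compose[OF line this]
    have "((\<lambda>t. f (x + t *\<^sub>R h)) has_derivative (\<lambda>t. t * (h \<bullet> g x))) (at 0)" by simp
    moreover have "(\<lambda>t. t * (h \<bullet> g x)) = (*) (h \<bullet> g x)" by (simp add: fun_eq_iff)
    ultimately show ?thesis by (simp only: has_field_derivative_def)
  qed
  have d1: "DERIV (\<lambda>t. f1 (x + t *\<^sub>R h)) 0 :> h \<bullet> g1 x"
    and d2: "DERIV (\<lambda>t. f2 (x + t *\<^sub>R h)) 0 :> h \<bullet> g2 x"
    using 1 2 der unfolding smooth_boundary_chart_def C1_regular_on_def by blast+
  obtain a where a: "a > 0" "\<And>t. 0 < t \<Longrightarrow> t < a \<Longrightarrow> f1 (x + t *\<^sub>R h) < 0"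
    using DERIV_neg_dec_right[OF d1 h] f0 by auto
  obtain b where b: "b > 0" "\<And>t. 0 < t \<Longrightarrow> t < b \<Longrightarrow> f2 (x + t *\<^sub>R h) > 0"
    using DERIV_pos_inc_right[OF d2 h2] f0 by auto
  have "((\<lambda>t::real. x + t *\<^sub>R h) \<longlongrightarrow> x + 0 *\<^sub>R h) (at_right 0)"
    by (intro tendsto_intros)
  then have lim: "((\<lambda>t::real. x + t *\<^sub>R h) \<longlongrightarrow> x) (at_right 0)" by simp
  have "eventually (\<lambda>t. t \<in> {0<..<min a b}) (at_right 0)"
    using a(1) b(1) by (intro eventually_at_rightI[of _ "min a b"]) auto
  moreover have "eventually (\<lambda>t. x + t *\<^sub>R h \<in> U1) (at_right 0)"
    "eventually (\<lambda>t. x + t *\<^sub>R h \<in> U2) (at_right 0)"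
    using topological_tendstoD[OF lim] U by auto
  ultimately have "eventually (\<lambda>t::real. False) (at_right 0)"
  proof eventually_elim
    case (elim t)
    then have "x + t *\<^sub>R h \<in> M" "x + t *\<^sub>R h \<notin> M"
      using 1 2 a(2)[of t] b(2)[of t] unfolding smooth_boundary_chart_def by force+
    then show False by simp
  qed
  then show False by simp
qed

lemma outer_unit_normal_eq:
  assumes x: "x \<in> frontier M" and c: "smooth_boundary_chart M x U f g"
  shows "outer_unit_normal M x = sgn (g x)"
proof -
  have *: "sgn (g2 x) = sgn (g1 x)"
    if 1: "smooth_boundary_chart M x U1 f1 g1" and 2: "smooth_boundary_chart M x U2 f2 g2"
    for U1 f1 g1 U2 f2 g2
  proof -
    define p q where "p = sgn (g1 x)" and "q = sgn (g2 x)"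
    have nz: "g1 x \<noteq> 0" "g2 x \<noteq> 0"
      using 1 2 unfolding smooth_boundary_chart_def C1_regular_on_def by blast+
    then have n: "norm p = 1" "norm q = 1" by (simp_all add: p_def q_def norm_sgn)
    have hs: "h \<bullet> q \<le> 0" if "h \<bullet> p < 0" for h
    proof -
      have "h \<bullet> g1 x < 0" using that nz by (simp add: p_def sgn_div_norm mult_less_0_iff)
      then have "h \<bullet> g2 x \<le> 0" using sublevel_gradient_halfspace[OF 1 2 x] by simp
      then show ?thesis by (simp add: q_def sgn_div_norm mult_le_0_iff)
    qed
    have "p \<bullet> q \<ge> 1"
    proof (rule field_le_epsilon)
      fix e :: real assume e: "e > 0"
      define s where "s = p \<bullet> q"
      have s: "\<bar>s\<bar> \<le> 1" using Cauchy_Schwarz_ineq2[of p q] n by (simp add: s_def)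
      have pp: "p \<bullet> p = 1" "q \<bullet> q = 1" using n by (simp_all add: norm_eq_1)
      define h where "h = q - (s + e) *\<^sub>R p"
      have "h \<bullet> p = s - (s + e)"
        by (simp add: h_def inner_diff_left pp s_def inner_commute[of q p])
      then have "h \<bullet> p < 0" using e by simp
      then have "h \<bullet> q \<le> 0" by (rule hs)
      then have A: "1 \<le> (s + e) * s" by (simp add: h_def inner_diff_left pp s_def)
      have "(- p) \<bullet> q \<le> 0" by (rule hs) (simp add: pp)
      then have s0: "0 \<le> s" by (simp add: s_def)
      have "(s + e) * s \<le> (s + e) * 1" using s s0 e by (intro mult_left_mono) auto
      then show "1 \<le> p \<bullet> q + e" using A by (simp add: s_def)
    qed
    moreover have "(norm (p - q))\<^sup>2 = 2 - 2 * (p \<bullet> q)"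
      using n by (simp add: power2_norm_eq_inner inner_diff inner_commute[of q p] norm_eq_1)
    ultimately have "(norm (p - q))\<^sup>2 \<le> 0" by linarith
    then show ?thesis by (simp add: p_def q_def)
  qed
  show ?thesis unfolding outer_unit_normal_def
    using c * by (intro the_equality) blast+
qed

text \<open>A compact piece that is $C^1$ up to its edge is rendered as a compact subset of a $C^1$
  hypersurface, which may extend beyond the edge. The last conjunct says that the singular set has
  zero Minkowski content of codimension one.\<close>

definition piecewise_C1_domain :: "'a::euclidean_space set \<Rightarrow> bool" where
  "piecewise_C1_domain M \<longleftrightarrow>
     M \<noteq> {} \<and> compact M \<and> M = closure (interior M) \<and>
     (\<exists>\<P>. finite \<P> \<and> frontier M = \<Union>\<P> \<and>
        (\<forall>P\<in>\<P>. compact P \<and> (\<exists>S. C1_hypersurface S \<and> P \<subseteq> S))) \<and>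
     ((\<lambda>\<epsilon>. volume (Sing M + (*\<^sub>R) \<epsilon> ` cball 0 1) / \<epsilon>) \<longlongrightarrow> 0) (at_right 0)"

end

theory Submission
  imports Defs
begin

text \<open>
  Near a smooth boundary point \<open>M\<close> lies below the graph of a function with small Lipschitz constant \<open>\<delta>\<close> over the
  tangent hyperplane with normal \<open>n\<close>. Shifting the graph by \<open>\<epsilon> p\<close> changes its height by about \<open>\<epsilon> (p \<bullet> n)\<close>. So \<open>M + \<epsilon>N\<close>
  contains, with \<open>h\<close> the support function and \<open>C\<close> a norm bound of \<open>N\<close>, the part below height
  \<open>\<epsilon> (h n - \<eta> - \<delta>C)\<close> for a nearly optimal \<open>p\<close> in \<open>N\<close>, and \<open>M + \<epsilon>K\<close>, with \<open>K\<close> the closed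
  convex hull of \<open>N\<close>, stays below height \<open>\<epsilon> (h n + \<delta>C)\<close>. Both bounds have the same limit. They apply to all sets
  between \<open>interior M + \<epsilon>N\<close>, which is open, and \<open>M + \<epsilon>K\<close>, which is compact, hence to \<open>N\<close> and to its convex hull, and
  no measurability of \<open>M + \<epsilon>N\<close> is needed.

  The local bounds are summed over finitely many disjoint compact pieces of the smooth boundary. What is left over is
  compact of small Hausdorff measure, and by the piecewise structure its \<open>\<epsilon>\<close>-neighbourhood has volume at most a
  constant times \<open>\<epsilon>\<close> times that measure.

  The volume of a layer over a piece of a graph is its height times the projected area. That this area is the Hausdorff
  measure up to the factor \<open>(1 + \<delta>\<^sup>2) ^ ((d - 1) / 2)\<close> follows in one direction from the isodiametric inequality (here
  from the Brunn-Minkowski inequality for \<open>U\<close> and \<open>-U\<close>) and in the other from Vitali's covering lemma.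
\<close>

section \<open>The Brunn-Minkowski inequality\<close>

text \<open>The formula is an equality, so Hausdorff measure and projected area must agree up to a
  factor tending to 1 with \<delta>. Hausdorff weights are those of a ball of the same diameter, and
  a set of diameter s need not fit into such a ball; hence the isodiametric inequality. It is needed
  in dimension d - 1, but the work stays in the ambient space: a set over the hyperplane becomes a
  column of height h, the vertical error is a constant, and dividing by h and letting h tend to
  infinity removes it. In the other direction a Vitali cover must be enlarged five times, which
  costs a fixed factor and is cured by iteration.

  Charts occur at two scales. Those of slope \<delta> carry the main terms, but they exist at smooth
  points only and cover the boundary up to a set of small measure. The given hypersurface pieces
  yield finitely many charts of slope 1 that also cover the singular points. These are too coarse
  for the integral, yet they turn zero content of the singular set into zero measure, and small
  measure of a compact remainder into small content.\<close>

abbreviation vol :: "'a::euclidean_space set \<Rightarrow> real" where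
  "vol \<equiv> measure lborel"

abbreviation scaled_sum :: "'a::euclidean_space set \<Rightarrow> real \<Rightarrow> 'a set \<Rightarrow> 'a set" where
  "scaled_sum M \<epsilon> K \<equiv> {x + \<epsilon> *\<^sub>R p | x p. x \<in> M \<and> p \<in> K}"

text \<open>The Minkowski mean with equal weights. Its Brunn-Minkowski inequality is used in
  multiplicative form, with the geometric mean of the volumes, which contains no exponent depending
  on the dimension.\<close>

definition midset :: "'a::euclidean_space set \<Rightarrow> 'a set \<Rightarrow> 'a set" where
  "midset X Y = {(1/2) *\<^sub>R (x + y) | x y. x \<in> X \<and> y \<in> Y}"

lemma midset_commute: "midset X Y = midset Y X"
  unfolding midset_def by (force simp: add.commute)

lemma midset_mono: "X \<subseteq> X' \<Longrightarrow> Y \<subseteq> Y' \<Longrightarrow> midset X Y \<subseteq> midset X' Y'"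
  unfolding midset_def by blast

lemma midset_altdef: "midset X Y = (\<Union>y\<in>Y. (\<lambda>x. (1/2) *\<^sub>R y + x) ` ((*\<^sub>R) (1/2)) ` X)"
  unfolding midset_def by (force simp: algebra_simps)

lemma open_midset: "open X \<Longrightarrow> open (midset X Y)"
  unfolding midset_altdef by (intro open_UN ballI open_translation open_scaling) auto

lemma bounded_midset:
  assumes "bounded X" "bounded Y" shows "bounded (midset X Y)"
proof -
  obtain a b where ab: "\<And>x. x \<in> X \<Longrightarrow> norm x \<le> a" "\<And>x. x \<in> Y \<Longrightarrow> norm x \<le> b"
    using assms unfolding bounded_iff by blast
  have "norm ((1/2) *\<^sub>R (x + y)) \<le> a + b" if "x \<in> X" "y \<in> Y" for x y
    using ab(1)[OF that(1)] ab(2)[OF that(2)] norm_triangle_ineq[of x y] norm_ge_zero[of x] norm_ge_zero[of y]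
    unfolding norm_scaleR by linarith
  then show ?thesis unfolding bounded_iff midset_def by blast
qed

text \<open>Members are nonempty so that the number of boxes can serve as induction measure: a box
  that vanishes in a cut no longer counts.\<close>

definition disjoint_boxes :: "'a::euclidean_space set set \<Rightarrow> bool" where
  "disjoint_boxes \<A> \<longleftrightarrow> finite \<A> \<and> disjoint \<A> \<and> (\<forall>B\<in>\<A>. B \<noteq> {} \<and> (\<exists>a b. B = box a b))"

lemma box_Int_halfspace:
  fixes i :: "'a::euclidean_space" assumes "i \<in> Basis"
  shows "\<exists>a' b'. box a b \<inter> {x. x \<bullet> i < c} = box a' b'" "\<exists>a' b'. box a b \<inter> {x. x \<bullet> i > c} = box a' b'"
proof -
  have "box a b \<inter> {x. x \<bullet> i < c} = box a (\<Sum>j\<in>Basis. (if j = i then min (b \<bullet> j) c else b \<bullet> j) *\<^sub>R j)"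
    using assms by (auto simp: mem_box inner_sum_left_Basis split: if_splits)
  then show "\<exists>a' b'. box a b \<inter> {x. x \<bullet> i < c} = box a' b'" by blast
  have "box a b \<inter> {x. x \<bullet> i > c} = box (\<Sum>j\<in>Basis. (if j = i then max (a \<bullet> j) c else a \<bullet> j) *\<^sub>R j) b"
    using assms by (auto simp: mem_box inner_sum_left_Basis split: if_splits)
  then show "\<exists>a' b'. box a b \<inter> {x. x \<bullet> i > c} = box a' b'" by blast
qed

text \<open>\<open>H\<close> is any set that cuts boxes to boxes, so that one statement covers both
  sides of a coordinate hyperplane. The last claim provides the strict decrease for the
  induction.\<close>

lemma disjoint_boxes_cut:
  assumes \<A>: "disjoint_boxes \<A>" and H: "\<And>a b. \<exists>a' b'. box a b \<inter> H = box a' b'"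
  defines "\<B> \<equiv> (\<lambda>B. B \<inter> H) ` \<A> - {{}}"
  shows "disjoint_boxes \<B>" "\<Union>\<B> = \<Union>\<A> \<inter> H" "card \<B> \<le> card \<A>"
    "A \<in> \<A> \<Longrightarrow> A \<inter> H = {} \<Longrightarrow> card \<B> < card \<A>"
proof -
  have fin: "finite \<A>" and disj: "disjoint \<A>" using \<A> by (auto simp: disjoint_boxes_def)
  have "disjoint \<B>" using disj unfolding \<B>_def disjoint_def by blast
  moreover have "B \<noteq> {} \<and> (\<exists>a b. B = box a b)" if "B \<in> \<B>" for B
  proof -
    obtain C where C: "C \<in> \<A>" "B = C \<inter> H" "B \<noteq> {}" using \<open>B \<in> \<B>\<close> unfolding \<B>_def by blast
    obtain a b where "C = box a b" using C(1) \<A> unfolding disjoint_boxes_def by blast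
    then show ?thesis using H[of a b] C by auto
  qed
  ultimately show "disjoint_boxes \<B>" using fin by (auto simp: disjoint_boxes_def \<B>_def)
  show "\<Union>\<B> = \<Union>\<A> \<inter> H" unfolding \<B>_def by auto
  have "card \<B> \<le> card ((\<lambda>B. B \<inter> H) ` \<A>)" unfolding \<B>_def using fin by (intro card_mono) auto
  also have "\<dots> \<le> card \<A>" by (rule card_image_le[OF fin])
  finally show "card \<B> \<le> card \<A>" .
  assume A: "A \<in> \<A>" "A \<inter> H = {}"
  then have "\<B> \<subseteq> (\<lambda>B. B \<inter> H) ` (\<A> - {A})" unfolding \<B>_def by auto
  then have "card \<B> \<le> card ((\<lambda>B. B \<inter> H) ` (\<A> - {A}))" using fin by (intro card_mono) auto
  also have "\<dots> \<le> card (\<A> - {A})" using fin by (intro card_image_le) auto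
  also have "\<dots> < card \<A>" using A fin by (intro psubset_card_mono) auto
  finally show "card \<B> < card \<A>" .
qed

text \<open>Disjoint boxes have disjoint projections to some coordinate axis. \<open>C\<close> and
  \<open>D\<close> are \<open>A\<close> and \<open>B\<close> in the order in which they lie along
  that axis; each half-space then misses one box entirely.\<close>

lemma disjoint_boxes_separate:
  assumes \<A>: "disjoint_boxes \<A>" "A \<in> \<A>" "B \<in> \<A>" "A \<noteq> B"
  obtains i c C D where "i \<in> Basis" "C \<in> \<A>" "D \<in> \<A>" "C \<inter> {x. x \<bullet> i > c} = {}" "D \<inter> {x. x \<bullet> i < c} = {}"
proof -
  obtain a b c d where ab: "A = box a b" "B = box c d" "A \<noteq> {}" "B \<noteq> {}" using \<A> unfolding disjoint_boxes_def by meson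
  have "box a b \<inter> box c d = {}" using \<A> ab by (auto simp: disjoint_boxes_def disjoint_def)
  then have "\<exists>i\<in>Basis. b \<bullet> i \<le> c \<bullet> i \<or> d \<bullet> i \<le> a \<bullet> i"
    proof -
    have "\<exists>i\<in>Basis. min (b \<bullet> i) (d \<bullet> i) \<le> max (a \<bullet> i) (c \<bullet> i)"
      using \<open>box a b \<inter> box c d = {}\<close> by (auto simp: box_Int_box box_eq_empty inner_sum_left_Basis)
    moreover have "a \<bullet> i < b \<bullet> i" "c \<bullet> i < d \<bullet> i" if "i \<in> Basis" for i
      using ab that by (auto simp: box_ne_empty)
    ultimately show ?thesis by (force simp: min_le_iff_disj le_max_iff_disj)
  qed
  then obtain i where i: "i \<in> Basis" "b \<bullet> i \<le> c \<bullet> i \<or> d \<bullet> i \<le> a \<bullet> i" by blast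
  have box: "x \<bullet> i < b \<bullet> i" "a \<bullet> i < x \<bullet> i" if "x \<in> A" for x
    using that i(1) unfolding ab mem_box by blast+
  have box': "x \<bullet> i < d \<bullet> i" "c \<bullet> i < x \<bullet> i" if "x \<in> B" for x
    using that i(1) unfolding ab mem_box by blast+
  from i(2) show thesis
  proof
    assume le: "b \<bullet> i \<le> c \<bullet> i"
    have "A \<inter> {x. x \<bullet> i > b \<bullet> i} = {}" "B \<inter> {x. x \<bullet> i < b \<bullet> i} = {}"
      using box(1) box'(2) le by (auto simp: disjoint_iff not_less intro: less_imp_le le_less_trans)
    then show thesis by (rule that[OF i(1) \<A>(2,3)])
  next
    assume le: "d \<bullet> i \<le> a \<bullet> i"
    have "B \<inter> {x. x \<bullet> i > d \<bullet> i} = {}" "A \<inter> {x. x \<bullet> i < d \<bullet> i} = {}"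
      using box(2) box'(1) le by (auto simp: disjoint_iff not_less intro: less_imp_le le_less_trans)
    then show thesis by (rule that[OF i(1) \<A>(3,2)])
  qed
qed

lemma disjoint_boxes_open_bounded:
  assumes "disjoint_boxes \<A>" shows "open (\<Union>\<A>)" "bounded (\<Union>\<A>)"
proof -
  have "open A \<and> bounded A" if "A \<in> \<A>" for A
    using assms that unfolding disjoint_boxes_def by (metis open_box bounded_box)
  then show "open (\<Union>\<A>)" "bounded (\<Union>\<A>)"
    using assms unfolding disjoint_boxes_def by (auto intro: bounded_Union)
qed

lemma bounded_open_fmeasurable:
  fixes X :: "'a::euclidean_space set"
  assumes "open X" "bounded X" shows "X \<in> fmeasurable lborel"
proof -
  obtain a where "X \<subseteq> cbox (-a) a" using assms bounded_subset_cbox_symmetric by blast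
  then show ?thesis by (rule fmeasurableI2[OF fmeasurable_cbox]) (use assms in simp)
qed

lemma measure_open_pos:
  fixes X :: "'a::euclidean_space set"
  assumes "open X" "bounded X" "X \<noteq> {}" shows "vol X > 0"
proof -
  obtain x where "x \<in> X" using assms by blast
  then obtain a b where ab: "x \<in> box a b" "box a b \<subseteq> X" using open_contains_box[of X] assms by (metis box_subset_cbox subset_trans)
  then have "0 < vol (box a b)"
    by (subst measure_lborel_box) (force simp: mem_box inner_diff_left intro!: prod_pos)+
  also have "\<dots> \<le> vol X"
    using ab assms bounded_open_fmeasurable[of X] by (intro measure_mono_fmeasurable) auto
  finally show ?thesis .
qed

text \<open>Moving the hyperplane from \<open>c\<close> to \<open>c'\<close> adds at most the part
  of a slab inside a bounding box, so the volume is Lipschitz in \<open>c\<close>. Continuity lets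
  the intermediate value theorem find a cut of prescribed proportion.\<close>

lemma continuous_measure_halfspace:
  fixes Y :: "'a::euclidean_space set" and i :: 'a
  assumes Y: "Y \<in> sets borel" "bounded Y" and i: "i \<in> Basis"
  shows "continuous_on UNIV (\<lambda>c. vol (Y \<inter> {y. y \<bullet> i < c}))"
proof -
  obtain a where a: "Y \<subseteq> cbox (-a) a" using Y bounded_subset_cbox_symmetric by blast
  \<comment> \<open>The area of the face of the bounding box orthogonal to \<open>i\<close>.\<close>
  define K where "K = (\<Prod>j\<in>Basis - {i}. \<bar>2 * (a \<bullet> j)\<bar>)"
  have K: "K \<ge> 0" unfolding K_def by (intro prod_nonneg) auto
  have fm: "Y \<in> fmeasurable lborel" using a Y by (intro fmeasurableI2[OF fmeasurable_cbox a]) auto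
  have fmc: "Y \<inter> {y. y \<bullet> i < c} \<in> fmeasurable lborel" for c
    by (intro fmeasurableI2[OF fm]) (use Y in \<open>auto intro!: sets.Int borel_open open_halfspace_component_lt\<close>)
  have le: "vol (Y \<inter> {y. y \<bullet> i < c'}) - vol (Y \<inter> {y. y \<bullet> i < c}) \<le> K * (c' - c)" if "c \<le> c'" for c c'
  proof -
    define l u where "l = (\<Sum>j\<in>Basis. (if j = i then c else - \<bar>a \<bullet> j\<bar>) *\<^sub>R j)"
      and "u = (\<Sum>j\<in>Basis. (if j = i then c' else \<bar>a \<bullet> j\<bar>) *\<^sub>R j)"
    have sub: "Y \<inter> {y. y \<bullet> i < c'} \<subseteq> Y \<inter> {y. y \<bullet> i < c} \<union> cbox l u"
    proof
      fix x assume x: "x \<in> Y \<inter> {y. y \<bullet> i < c'}"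
      then have "x \<in> cbox (-a) a" using a by auto
      then have "\<And>j. j \<in> Basis \<Longrightarrow> - (a \<bullet> j) \<le> x \<bullet> j \<and> x \<bullet> j \<le> a \<bullet> j" by (simp add: mem_box)
      then have "\<And>j. j \<in> Basis \<Longrightarrow> - \<bar>a \<bullet> j\<bar> \<le> x \<bullet> j \<and> x \<bullet> j \<le> \<bar>a \<bullet> j\<bar>" by force
      then show "x \<in> Y \<inter> {y. y \<bullet> i < c} \<union> cbox l u"
        using x by (auto simp: mem_box l_def u_def inner_sum_left_Basis)
    qed
    have "vol (Y \<inter> {y. y \<bullet> i < c'}) \<le> vol (Y \<inter> {y. y \<bullet> i < c} \<union> cbox l u)"
      by (intro measure_mono_fmeasurable fmeasurable.Un fmc fmeasurable_cbox fmeasurableD[OF fmc] sub)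
    also have "\<dots> \<le> vol (Y \<inter> {y. y \<bullet> i < c}) + vol (cbox l u)"
      by (intro measure_Un_le fmeasurableD[OF fmc]) auto
    also have "vol (cbox l u) = (\<Prod>j\<in>Basis. (u - l) \<bullet> j)"
      using that by (intro measure_lborel_cbox) (auto simp: l_def u_def inner_sum_left_Basis)
    also have "\<dots> = (\<Prod>j\<in>Basis. if j = i then c' - c else \<bar>2 * (a \<bullet> j)\<bar>)"
      by (intro prod.cong) (auto simp: l_def u_def inner_sum_left_Basis inner_diff_left)
    also have "\<dots> = (c' - c) * K"
      unfolding K_def by (subst prod.remove[OF _ i]) (auto intro!: prod.cong)
    finally show ?thesis by (simp add: mult.commute)
  qed
  have mono: "vol (Y \<inter> {y. y \<bullet> i < c}) \<le> vol (Y \<inter> {y. y \<bullet> i < c'})" if "c \<le> c'" for c c'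
    by (intro measure_mono_fmeasurable fmc fmeasurableD[OF fmc]) (use that in auto)
  have "K-lipschitz_on UNIV (\<lambda>c. vol (Y \<inter> {y. y \<bullet> i < c}))"
  proof (rule lipschitz_onI[OF _ K])
    fix c c' :: real
    show "dist (vol (Y \<inter> {y. y \<bullet> i < c})) (vol (Y \<inter> {y. y \<bullet> i < c'})) \<le> K * dist c c'"
      using le[of c c'] le[of c' c] mono[of c c'] mono[of c' c] unfolding dist_real_def by (cases "c \<le> c'") (auto simp: abs_real_def)
  qed
  then show ?thesis by (rule lipschitz_on_continuous_on)
qed

lemma borel_negligible_null_sets: "S \<in> sets borel \<Longrightarrow> negligible S \<Longrightarrow> S \<in> null_sets lborel"
  by (simp add: negligible_iff_null_sets null_sets_completion_iff)

lemma measure_cut: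
  fixes Y :: "'a::euclidean_space set" and i :: 'a
  assumes Y: "open Y" "bounded Y" and i: "i \<in> Basis"
  shows "vol Y = vol (Y \<inter> {y. y \<bullet> i < c}) + vol (Y \<inter> {y. y \<bullet> i > c})"
proof -
  have o: "open (Y \<inter> {y. y \<bullet> i < c})" "open (Y \<inter> {y. y \<bullet> i > c})"
    using Y by (auto intro!: open_Int open_halfspace_component_lt open_halfspace_component_gt)
  have "{x. x \<bullet> i = c} \<in> sets borel" by measurable
  then have "{x. x \<bullet> i = c} \<in> null_sets lborel"
    using negligible_standard_hyperplane[OF i] by (rule borel_negligible_null_sets)
  then have ae: "AE x in lborel. x \<bullet> i \<noteq> c" using AE_not_in by fastforce
  have "vol Y = vol ((Y \<inter> {y. y \<bullet> i < c}) \<union> (Y \<inter> {y. y \<bullet> i > c}))"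
    proof (rule measure_eq_AE)
    show "AE x in lborel. (x \<in> Y) = (x \<in> (Y \<inter> {y. y \<bullet> i < c}) \<union> (Y \<inter> {y. y \<bullet> i > c}))"
      using ae by eventually_elim auto
  qed (use o Y in auto)
  also have "\<dots> = vol (Y \<inter> {y. y \<bullet> i < c}) + vol (Y \<inter> {y. y \<bullet> i > c})"
    by (intro measure_Un_AE bounded_open_fmeasurable o bounded_Int AE_I2) (use Y in auto)
  finally show ?thesis .
qed

section \<open>The Brunn-Minkowski inequality for finite unions of boxes\<close>

lemma sqrt_prod: "sqrt (\<Prod>i\<in>A. f i) = (\<Prod>i\<in>A. sqrt (f i))"
  by (induction A rule: infinite_finite_induct) (auto simp: real_sqrt_mult)

text \<open>The box spanned by the midpoints of the corners lies in the midset, and its side lengths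
  are arithmetic means. The inequality is that of arithmetic and geometric mean, applied to each
  side.\<close>

lemma midset_boxes:
  fixes a b c d :: "'a::euclidean_space"
  assumes "box a b \<noteq> {}" "box c d \<noteq> {}"
  shows "sqrt (vol (box a b) * vol (box c d)) \<le> vol (midset (box a b) (box c d))"
proof -
  have lt: "a \<bullet> i < b \<bullet> i" "c \<bullet> i < d \<bullet> i" if "i \<in> Basis" for i using assms that by (auto simp: box_ne_empty)
  define l u where "l = (1/2) *\<^sub>R (a + c)" and "u = (1/2) *\<^sub>R (b + d)"
  have sub: "box l u \<subseteq> midset (box a b) (box c d)"
  proof
    fix z assume z: "z \<in> box l u"
    \<comment> \<open>The relative position of \<open>z\<close> in each coordinate; \<open>x\<close>
      and \<open>y\<close> take the same relative position in their own boxes.\<close>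
    define t where "t i = ((z - l) \<bullet> i) / ((u - l) \<bullet> i)" for i
    have t: "0 < t i" "t i < 1" "z \<bullet> i = l \<bullet> i + t i * ((u - l) \<bullet> i)" if "i \<in> Basis" for i
      using z that by (auto simp: t_def mem_box inner_diff_left field_simps)
    define x where "x = (\<Sum>i\<in>Basis. (a \<bullet> i + t i * ((b - a) \<bullet> i)) *\<^sub>R i)"
    define y where "y = (\<Sum>i\<in>Basis. (c \<bullet> i + t i * ((d - c) \<bullet> i)) *\<^sub>R i)"
    have bnd: "p < p + s * (q - p) \<and> p + s * (q - p) < q" if "p < q" "0 < s" "s < 1" for p q s :: real
    proof -
      have "0 < (1 - s) * (q - p)" "0 < s * (q - p)" using that by simp_all
      then show ?thesis by (simp add: algebra_simps)
    qed
    have "x \<in> box a b" "y \<in> box c d"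
      using t bnd lt by (auto simp: mem_box x_def y_def inner_sum_left_Basis inner_diff_left)
    moreover have "z = (1/2) *\<^sub>R (x + y)"
      proof (rule euclidean_eqI)
      fix i :: 'a assume i: "i \<in> Basis"
      have "x \<bullet> i = a \<bullet> i + t i * ((b - a) \<bullet> i)" "y \<bullet> i = c \<bullet> i + t i * ((d - c) \<bullet> i)"
        using i by (simp_all add: x_def y_def inner_sum_left_Basis)
      then show "z \<bullet> i = ((1/2) *\<^sub>R (x + y)) \<bullet> i"
        using t(3)[OF i] by (simp add: inner_simps l_def u_def field_simps)
    qed
    ultimately show "z \<in> midset (box a b) (box c d)" unfolding midset_def by blast
  qed
  have "sqrt (vol (box a b) * vol (box c d))
     = (\<Prod>i\<in>Basis. sqrt (((b - a) \<bullet> i) * ((d - c) \<bullet> i)))"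
    using lt by (subst (1 2) measure_lborel_box) (auto simp: less_imp_le prod.distrib[symmetric] sqrt_prod)
  also have "\<dots> \<le> (\<Prod>i\<in>Basis. (u - l) \<bullet> i)"
  proof (intro prod_mono conjI)
    fix i :: 'a assume i: "i \<in> Basis"
    show "0 \<le> sqrt ((b - a) \<bullet> i * ((d - c) \<bullet> i))" using lt[OF i] by (simp add: inner_diff_left)
    have "sqrt ((b - a) \<bullet> i * ((d - c) \<bullet> i)) \<le> ((b - a) \<bullet> i + (d - c) \<bullet> i) / 2"
      using lt[OF i] by (intro arith_geo_mean_sqrt) (auto simp: inner_diff_left)
    then show "sqrt ((b - a) \<bullet> i * ((d - c) \<bullet> i)) \<le> (u - l) \<bullet> i" by (simp add: l_def u_def inner_simps field_simps)
  qed
  also have "\<dots> = vol (box l u)"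
  proof -
    have "l \<bullet> i \<le> u \<bullet> i" if "i \<in> Basis" for i
      using lt[OF that] by (simp add: l_def u_def inner_simps)
    then show ?thesis by (subst measure_lborel_box) auto
  qed
  also have "\<dots> \<le> vol (midset (box a b) (box c d))"
    using sub by (intro measure_mono_fmeasurable bounded_open_fmeasurable open_midset bounded_midset) auto
  finally show ?thesis .
qed

text \<open>The cutting argument of Hadwiger and Ohmann: a coordinate hyperplane between two boxes of \<open>\<A>\<close> and a parallel
  one cutting \<open>\<B>\<close> in the same proportion reduce the number of boxes; with equal proportions the multiplicative
  inequalities for the two halves add up.\<close>

lemma midset_measure_step:
  fixes \<A> \<B> :: "'a::euclidean_space set set"
  assumes \<A>: "disjoint_boxes \<A>" "A \<in> \<A>" "A' \<in> \<A>" "A \<noteq> A'" and \<B>: "disjoint_boxes \<B>" "\<B> \<noteq> {}"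
    and IH: "\<And>\<A>' \<B>' :: 'a set set. disjoint_boxes \<A>' \<Longrightarrow> disjoint_boxes \<B>' \<Longrightarrow> \<A>' \<noteq> {} \<Longrightarrow> \<B>' \<noteq> {} \<Longrightarrow>
      card \<A>' < card \<A> \<Longrightarrow> card \<B>' \<le> card \<B> \<Longrightarrow>
      sqrt (vol (\<Union>\<A>') * vol (\<Union>\<B>')) \<le> vol (midset (\<Union>\<A>') (\<Union>\<B>'))"
  shows "sqrt (vol (\<Union>\<A>) * vol (\<Union>\<B>)) \<le> vol (midset (\<Union>\<A>) (\<Union>\<B>))"
proof -
  define X Y where "X = \<Union>\<A>" and "Y = \<Union>\<B>"
  have ob: "open X" "bounded X" "open Y" "bounded Y"
    using disjoint_boxes_open_bounded \<A> \<B> unfolding X_def Y_def by blast+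
  obtain i c C D where i: "i \<in> Basis" and CD: "C \<in> \<A>" "D \<in> \<A>"
    "C \<inter> {x. x \<bullet> i > c} = {}" "D \<inter> {x. x \<bullet> i < c} = {}"
    by (rule disjoint_boxes_separate[OF \<A>])
  \<comment> \<open>A nonempty open box is not contained in the null hyperplane. Hence
    \<open>C\<close> meets the lower and \<open>D\<close> the upper open half-space, and both halves
    of \<open>X\<close> have positive volume.\<close>
  have thick: "Z \<noteq> {} \<and> \<not> Z \<subseteq> {x. x \<bullet> i = c}" if "Z \<in> \<A>" for Z
  proof -
    have "Z \<noteq> {}" "open Z" using that \<A> unfolding disjoint_boxes_def by (metis open_box)+
    then show ?thesis using negligible_standard_hyperplane[OF i] negligible_subset open_not_negligible by blast
  qed
  define L G where "L S t = (S::'a set) \<inter> {x. x \<bullet> i < t}" and "G S t = (S::'a set) \<inter> {x. x \<bullet> i > t}" for S t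
  have LG: "open (L S t)" "bounded (L S t)" "open (G S t)" "bounded (G S t)"
      "vol S = vol (L S t) + vol (G S t)" if "open S" "bounded S" for S t
    using that measure_cut[OF that i] unfolding L_def G_def
    by (auto intro!: open_Int open_halfspace_component_lt open_halfspace_component_gt bounded_Int)
  have cut_pos: "0 < vol (L X c)" "0 < vol (G X c)"
  proof -
    obtain x y where "x \<in> C" "x \<bullet> i \<noteq> c" "y \<in> D" "y \<bullet> i \<noteq> c" using thick CD(1,2) by blast
    then have "L X c \<noteq> {}" "G X c \<noteq> {}" using CD unfolding L_def G_def X_def by force+
    then show "0 < vol (L X c)" "0 < vol (G X c)" using LG(1-4) ob by (auto intro!: measure_open_pos)
  qed
  define s where "s = vol (L X c) / vol X"
  have Xpos: "vol X > 0" using cut_pos LG(5)[OF ob(1,2), of c] by linarith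
  have s: "0 < s" "s < 1" "vol (L X c) = s * vol X" "vol (G X c) = (1 - s) * vol X"
    using cut_pos Xpos LG(5)[OF ob(1,2), of c] by (auto simp: s_def field_simps)
  have Yne: "Y \<noteq> {}" using \<B> unfolding disjoint_boxes_def Y_def by auto
  have Ypos: "vol Y > 0" by (rule measure_open_pos[OF ob(3,4) Yne])
  obtain t where t: "vol (L Y t) = s * vol Y"
  proof -
    obtain R where R: "\<And>y. y \<in> Y \<Longrightarrow> norm y \<le> R" "R > 0" using ob(4) bounded_pos by metis
    have yi: "\<bar>y \<bullet> i\<bar> \<le> R" if "y \<in> Y" for y
      using Basis_le_norm[OF i, of y] R(1)[OF that] by linarith
    have e: "L Y (-R) = {}" "L Y (R+1) = Y" unfolding L_def using yi by force+
    have "continuous_on UNIV (\<lambda>t. vol (L Y t))"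
      unfolding L_def by (rule continuous_measure_halfspace) (use ob i in auto)
    then have "continuous_on {-R..R+1} (\<lambda>t. vol (L Y t))" using continuous_on_subset by blast
    moreover have "vol (L Y (-R)) \<le> s * vol Y" "s * vol Y \<le> vol (L Y (R+1))"
      using e s Ypos by auto
    moreover have "-R \<le> R + 1" using R by simp
    ultimately show thesis using IVT'[of "\<lambda>t. vol (L Y t)" "-R" "s * vol Y" "R+1"] that by blast
  qed
  then have t': "vol (G Y t) = (1 - s) * vol Y"
    using LG(5)[OF ob(3,4), of t] by (simp add: algebra_simps)
  have part: "sqrt (vol (X \<inter> H) * vol (Y \<inter> H')) \<le> vol (midset (X \<inter> H) (Y \<inter> H'))"
    if H: "\<And>a b. \<exists>a' b'. box a b \<inter> H = box a' b'" "\<And>a b. \<exists>a' b'. box a b \<inter> H' = box a' b'"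
      and Z: "Z \<in> \<A>" "Z \<inter> H = {}" and pos: "0 < vol (X \<inter> H)" "0 < vol (Y \<inter> H')" for H H' Z
  proof -
    note cX = disjoint_boxes_cut[OF \<A>(1) H(1)] and cY = disjoint_boxes_cut[OF \<B>(1) H(2)]
    have U: "\<Union>((\<lambda>B. B \<inter> H) ` \<A> - {{}}) = X \<inter> H" "\<Union>((\<lambda>B. B \<inter> H') ` \<B> - {{}}) = Y \<inter> H'"
      unfolding cX(2) cY(2) X_def Y_def by simp_all
    then have "((\<lambda>B. B \<inter> H) ` \<A> - {{}}) \<noteq> {}" "((\<lambda>B. B \<inter> H') ` \<B> - {{}}) \<noteq> {}"
      using pos by (metis Union_empty less_irrefl measure_empty)+
    from IH[OF cX(1) cY(1) this cX(4)[OF Z] cY(3)] show ?thesis unfolding U .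
  qed
  note H = box_Int_halfspace[OF i]
  have "0 < vol (L Y t)" "0 < vol (G Y t)" using t t' s Ypos by simp_all
  then have lower: "sqrt (vol (L X c) * vol (L Y t)) \<le> vol (midset (L X c) (L Y t))"
    and upper: "sqrt (vol (G X c) * vol (G Y t)) \<le> vol (midset (G X c) (G Y t))"
    using part[OF H(1) H(1) CD(2,4)] part[OF H(2) H(2) CD(1,3)] cut_pos unfolding L_def G_def by blast+
  have "sqrt (vol X * vol Y) = s * sqrt (vol X * vol Y) + (1 - s) * sqrt (vol X * vol Y)"
    by (simp add: algebra_simps)
  also have "\<dots> = sqrt (vol (L X c) * vol (L Y t)) + sqrt (vol (G X c) * vol (G Y t))"
  proof -
    have "sqrt ((r * a) * (r * b)) = r * sqrt (a * b)" if "r \<ge> 0" for r a b :: real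
    proof -
      have "sqrt ((r * a) * (r * b)) = sqrt (r\<^sup>2 * (a * b))" by (simp add: power2_eq_square algebra_simps)
      then show ?thesis using that by (simp add: real_sqrt_mult)
    qed
    then show ?thesis unfolding t t' s(3,4) using s(1,2) by simp
  qed
  also have "\<dots> \<le> vol (midset (L X c) (L Y t)) + vol (midset (G X c) (G Y t))"
    using lower upper by linarith
  also have "\<dots> = vol (midset (L X c) (L Y t) \<union> midset (G X c) (G Y t))"
  proof (rule measure_Un_AE[symmetric])
    show "midset (L X c) (L Y t) \<in> fmeasurable lborel" "midset (G X c) (G Y t) \<in> fmeasurable lborel"
      using LG ob by (auto intro!: bounded_open_fmeasurable open_midset bounded_midset)
    \<comment> \<open>The hyperplane at the mean of the two cutting levels separates the two
      midsets, so their volumes add.\<close>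
    have "z \<bullet> i < (c + t) / 2" if "z \<in> midset (L X c) (L Y t)" for z
      using that by (auto simp: midset_def L_def inner_simps)
    moreover have "z \<bullet> i > (c + t) / 2" if "z \<in> midset (G X c) (G Y t)" for z
      using that by (auto simp: midset_def G_def inner_simps)
    ultimately show "AE x in lborel. x \<notin> midset (L X c) (L Y t) \<or> x \<notin> midset (G X c) (G Y t)" by (intro AE_I2) force
  qed
  also have "\<dots> \<le> vol (midset X Y)"
  proof (rule measure_mono_fmeasurable)
    show "midset (L X c) (L Y t) \<union> midset (G X c) (G Y t) \<subseteq> midset X Y"
      unfolding L_def G_def by (intro Un_least midset_mono) auto
    show "midset (L X c) (L Y t) \<union> midset (G X c) (G Y t) \<in> sets lborel"
      unfolding sets_lborel using LG(1,3) ob by (intro borel_open open_Un open_midset) auto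
    show "midset X Y \<in> fmeasurable lborel" using ob by (intro bounded_open_fmeasurable open_midset bounded_midset)
  qed
  finally show ?thesis unfolding X_def Y_def .
qed

text \<open>Strong induction on the total number of boxes. The cutting step needs two boxes in its
  first family; if only \<open>\<B>\<close> has two, the roles are exchanged by symmetry of the
  midset.\<close>

lemma midset_measure_boxes:
  fixes \<A> \<B> :: "'a::euclidean_space set set"
  assumes "disjoint_boxes \<A>" "disjoint_boxes \<B>" "\<A> \<noteq> {}" "\<B> \<noteq> {}"
  shows "sqrt (vol (\<Union>\<A>) * vol (\<Union>\<B>)) \<le> vol (midset (\<Union>\<A>) (\<Union>\<B>))"
  using assms
proof (induction "card \<A> + card \<B>" arbitrary: \<A> \<B> rule: less_induct)
  case less
  have one: "\<C> = {C}" if "C \<in> \<C>" "\<not> (\<exists>A\<in>\<C>. \<exists>A'\<in>\<C>. A \<noteq> A')" for C and \<C> :: "'a set set"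
    using that by blast
  consider (a) "\<exists>A\<in>\<A>. \<exists>A'\<in>\<A>. A \<noteq> A'" | (b) "\<exists>A\<in>\<B>. \<exists>A'\<in>\<B>. A \<noteq> A'"
    | (c) "\<not> (\<exists>A\<in>\<A>. \<exists>A'\<in>\<A>. A \<noteq> A')" "\<not> (\<exists>A\<in>\<B>. \<exists>A'\<in>\<B>. A \<noteq> A')"
    by argo
  then show ?case
  proof cases
    case a
    then obtain A A' where A: "A \<in> \<A>" "A' \<in> \<A>" "A \<noteq> A'" by blast
    show ?thesis
      by (rule midset_measure_step[OF less.prems(1) A less.prems(2,4)]) (intro less.hyps, auto)
  next
    case b
    then obtain A A' where A: "A \<in> \<B>" "A' \<in> \<B>" "A \<noteq> A'" by blast
    have "sqrt (vol (\<Union>\<B>) * vol (\<Union>\<A>)) \<le> vol (midset (\<Union>\<B>) (\<Union>\<A>))"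
    proof (rule midset_measure_step[OF less.prems(2) A less.prems(1,3)])
      fix \<A>' \<B>' :: "'a set set"
      assume *: "disjoint_boxes \<A>'" "disjoint_boxes \<B>'" "\<A>' \<noteq> {}" "\<B>' \<noteq> {}" "card \<A>' < card \<B>" "card \<B>' \<le> card \<A>"
      show "sqrt (vol (\<Union>\<A>') * vol (\<Union>\<B>')) \<le> vol (midset (\<Union>\<A>') (\<Union>\<B>'))"
        unfolding midset_commute[of "\<Union>\<A>'"] mult.commute[of "vol (\<Union>\<A>')"]
          using * by (intro less.hyps) auto
    qed
    then show ?thesis unfolding midset_commute[of "\<Union>\<A>"] mult.commute[of "vol (\<Union>\<A>)"] .
  next
    case c
    obtain A where A: "A \<in> \<A>" using less.prems(3) by blast
    obtain B where B: "B \<in> \<B>" using less.prems(4) by blast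
    have AB: "\<A> = {A}" "\<B> = {B}" using one[OF A c(1)] one[OF B c(2)] .
    obtain a b where "A = box a b" "A \<noteq> {}" using less.prems(1) A unfolding disjoint_boxes_def by meson
    moreover obtain c d where "B = box c d" "B \<noteq> {}" using less.prems(2) B unfolding disjoint_boxes_def by meson
    ultimately show ?thesis using midset_boxes[of a b c d] AB by simp
  qed
qed

text \<open>A countable cover of \<open>U\<close> by cells with disjoint interiors, all inside
  \<open>U\<close>, exhausts \<open>U\<close> up to the null frontiers of the cells. Finitely many
  open cells then reach the volume up to \<open>e\<close>.\<close>

lemma open_inner_boxes:
  fixes U :: "'a::euclidean_space set"
  assumes U: "open U" "bounded U" and e: "e > 0"
  obtains \<A> where "disjoint_boxes \<A>" "\<Union>\<A> \<subseteq> U" "vol U - e \<le> vol (\<Union>\<A>)"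
proof -
  obtain a where a: "U \<subseteq> box (-a) a" using bounded_subset_box_symmetric[OF U(2)] by blast
  show thesis
  proof (cases "U = {}")
    case True
    show thesis by (rule that[of "{}"]) (use True e in \<open>auto simp: disjoint_boxes_def\<close>)
  next
    case False
    then have ne: "box (-a) a \<noteq> {}" using a by blast
    \<comment> \<open>Each cell of the covering lemma lies in \<open>g x\<close> for one of its
      points \<open>x\<close> in \<open>U\<close>; this gauge therefore forces the cells into
      \<open>U\<close>.\<close>
    define g where "g = (\<lambda>x. if x \<in> U then U else UNIV)"
    have "gauge g" unfolding gauge_def g_def using U by auto
    then obtain \<D> where \<D>: "countable \<D>" "\<Union>\<D> \<subseteq> cbox (-a) a"
      "\<And>K. K \<in> \<D> \<Longrightarrow> interior K \<noteq> {} \<and> (\<exists>c d. K = cbox c d)"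
      "pairwise (\<lambda>A B. interior A \<inter> interior B = {}) \<D>"
      "\<And>K. K \<in> \<D> \<Longrightarrow> \<exists>x \<in> U \<inter> K. K \<subseteq> g x"
      "U \<subseteq> \<Union>\<D>"
      by (rule covering_lemma[of U "-a" a g, OF subset_trans[OF a box_subset_cbox] ne]) blast+
    have sub: "K \<subseteq> U" if "K \<in> \<D>" for K using \<D>(5)[OF that] by (auto simp: g_def split: if_splits)
    have Dne: "\<D> \<noteq> {}" using \<D>(6) False by auto
    define K where "K = from_nat_into \<D>"
    have rK: "range K = \<D>" unfolding K_def using Dne \<D>(1) by (simp add: range_from_nat_into)
    have KD: "K n \<in> \<D>" for n using rK by blast
    define V where "V n = (\<Union>i<n. interior (K i))" for n
    \<comment> \<open>As a set of sets it is insensitive to the repetitions that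
      \<open>from_nat_into\<close> produces when the family of cells is finite.\<close>
    define \<A> where "\<A> n = (\<lambda>i. interior (K i)) ` {..<n}" for n
    have dA: "disjoint_boxes (\<A> n)" for n
    proof -
      have "A \<inter> B = {}" if AB: "A \<in> \<A> n" "B \<in> \<A> n" "A \<noteq> B" for A B
      proof -
        obtain i j where "A = interior (K i)" "B = interior (K j)" using AB unfolding \<A>_def by blast
        then show ?thesis using \<D>(4) KD[of i] KD[of j] AB(3) unfolding pairwise_def by metis
      qed
      moreover have "B \<noteq> {} \<and> (\<exists>a b. B = box a b)" if "B \<in> \<A> n" for B
        using that \<D>(3) KD unfolding \<A>_def by (smt (verit) imageE interior_cbox)
      ultimately show ?thesis unfolding disjoint_boxes_def by (auto simp: \<A>_def disjoint_def)
    qed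
    have V: "\<Union>(\<A> n) = V n" for n by (auto simp: \<A>_def V_def)
    have Vm: "V n \<in> sets lborel" for n by (auto simp: V_def)
    have VU: "V n \<subseteq> U" for n unfolding V_def using sub KD interior_subset by blast
    have fU: "U \<in> fmeasurable lborel" by (rule bounded_open_fmeasurable[OF U])
    have "(\<lambda>n. vol (V n)) \<longlonglongrightarrow> vol (\<Union>n. V n)"
    proof (rule Lim_measure_incseq)
      show "range V \<subseteq> sets lborel" using Vm by auto
      show "incseq V" by (intro incseq_SucI) (auto simp: V_def lessThan_Suc)
      have "emeasure lborel (\<Union>n. V n) \<le> emeasure lborel U"
        using VU fU by (intro emeasure_mono) (auto dest: fmeasurableD)
      then show "emeasure lborel (\<Union>n. V n) \<noteq> \<infinity>" using fU by (auto simp: fmeasurable_def top_unique)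
    qed
    also have "vol (\<Union>n. V n) = vol U"
    proof (rule measure_eq_AE)
      have "frontier (K n) \<in> null_sets lborel" for n
      proof -
        obtain c d where "K n = cbox c d" using \<D>(3) KD by blast
        then have "negligible (frontier (K n))" by (simp add: negligible_convex_frontier)
        moreover have "frontier (K n) \<in> sets lborel" by (simp add: borel_closed)
        ultimately show ?thesis by (intro borel_negligible_null_sets) auto
      qed
      then have "AE x in lborel. \<forall>n. x \<notin> frontier (K n)" using AE_not_in by (auto simp: AE_all_countable)
      then show "AE x in lborel. (x \<in> (\<Union>n. V n)) = (x \<in> U)"
      proof eventually_elim
        case (elim x)
        have "x \<in> (\<Union>n. V n)" if "x \<in> U"
        proof -
          obtain n where "x \<in> K n" using \<D>(6) \<open>x \<in> U\<close> rK by blast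
          then have "x \<in> interior (K n)" using elim by (auto simp: frontier_def closure_def)
          then show ?thesis unfolding V_def by blast
        qed
        then show ?case using VU by blast
      qed
    qed (use Vm U in auto)
    finally have "eventually (\<lambda>n. vol (V n) > vol U - e) sequentially"
      using e by (intro order_tendstoD) auto
    then obtain n where "vol (V n) > vol U - e" by (auto simp: eventually_sequentially)
    then show thesis using that[of "\<A> n"] dA VU V by auto
  qed
qed

theorem Brunn_Minkowski_midset:
  fixes U V :: "'a::euclidean_space set"
  assumes U: "open U" "bounded U" and V: "open V" "bounded V"
  shows "sqrt (vol U * vol V) \<le> vol (midset U V)"
proof -
  define m where "m = vol (midset U V)"
  have fm: "midset U V \<in> fmeasurable lborel" using assms by (intro bounded_open_fmeasurable open_midset bounded_midset)
  have approx: "(vol U - e) * (vol V - e) \<le> m\<^sup>2"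
    if e: "0 < e" "e < vol U" "e < vol V" for e
  proof -
    obtain \<A> where \<A>: "disjoint_boxes \<A>" "\<Union>\<A> \<subseteq> U" "vol U - e \<le> vol (\<Union>\<A>)"
      using open_inner_boxes[OF U e(1)] by blast
    obtain \<B> where \<B>: "disjoint_boxes \<B>" "\<Union>\<B> \<subseteq> V" "vol V - e \<le> vol (\<Union>\<B>)"
      using open_inner_boxes[OF V e(1)] by blast
    have "\<A> \<noteq> {}" "\<B> \<noteq> {}" using \<A>(3) \<B>(3) e by auto
    then have "sqrt (vol (\<Union>\<A>) * vol (\<Union>\<B>)) \<le> vol (midset (\<Union>\<A>) (\<Union>\<B>))"
      using midset_measure_boxes \<A>(1) \<B>(1) by blast
    also have "\<dots> \<le> m" unfolding m_def
      using \<A>(1,2) \<B>(1,2) fm by (intro measure_mono_fmeasurable midset_mono)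
        (auto intro!: borel_open open_midset disjoint_boxes_open_bounded)
    finally have "(sqrt (vol (\<Union>\<A>) * vol (\<Union>\<B>)))\<^sup>2 \<le> m\<^sup>2" by (intro power_mono) auto
    then have "vol (\<Union>\<A>) * vol (\<Union>\<B>) \<le> m\<^sup>2" by simp
    moreover have "(vol U - e) * (vol V - e) \<le> vol (\<Union>\<A>) * vol (\<Union>\<B>)"
      using \<A>(3) \<B>(3) e by (intro mult_mono) auto
    ultimately show ?thesis by linarith
  qed
  have "vol U * vol V \<le> m\<^sup>2"
  proof (cases "vol U = 0 \<or> vol V = 0")
    case False
    then have pos: "0 < vol U" "0 < vol V" by (auto simp: less_le)
    show ?thesis
    proof (rule tendsto_upperbound)
      have "((\<lambda>e. (vol U - e) * (vol V - e)) \<longlongrightarrow> (vol U - 0) * (vol V - 0)) (at_right 0)"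
        by (intro tendsto_intros)
      then show "((\<lambda>e. (vol U - e) * (vol V - e)) \<longlongrightarrow> vol U * vol V) (at_right 0)" by simp
      show "eventually (\<lambda>e. (vol U - e) * (vol V - e) \<le> m\<^sup>2) (at_right 0)"
        by (rule eventually_at_rightI[of 0 "min (vol U) (vol V)"]) (use pos approx in auto)
    qed simp
  qed auto
  then show ?thesis unfolding m_def[symmetric] by (simp add: real_le_lsqrt m_def)
qed

section \<open>The isodiametric inequality\<close>

text \<open>Vitali's theorem fills an open set with disjoint balls, and \<open>T\<close> maps balls to balls of the same radius.\<close>

lemma isometric_involution_distr_lborel:
  fixes T :: "'a::euclidean_space \<Rightarrow> 'a"
  assumes inv: "\<And>x. T (T x) = x" and iso: "\<And>x y. dist (T x) (T y) = dist x y"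
  shows "distr lborel borel T = lborel"
proof -
  have cont: "continuous_on UNIV T"
    by (rule lipschitz_on_continuous_on[where L=1]) (auto intro!: lipschitz_onI simp: iso)
  have im: "T -` A = T ` A" for A
  proof
    show "T -` A \<subseteq> T ` A" using inv by (metis image_eqI subsetI vimageD)
    show "T ` A \<subseteq> T -` A" using inv by auto
  qed
  have ball: "T ` cball x r = cball (T x) r" for x r
  proof
    show "T ` cball x r \<subseteq> cball (T x) r" using iso by auto
    show "cball (T x) r \<subseteq> T ` cball x r"
    proof
      fix y assume "y \<in> cball (T x) r"
      then have "T y \<in> cball x r" using iso[of "T x" y] inv by simp
      then show "y \<in> T ` cball x r" using inv by (metis image_eqI)
    qed
  qed
  have op: "open (T -` U)" if "open U" for U using cont that continuous_on_open_vimage[of UNIV T] by auto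
  have le: "emeasure lborel U \<le> emeasure lborel (T -` U)" if U: "open U" for U
  proof -
    define K where "K = {(x, r::real). 0 < r \<and> cball x r \<subseteq> U}"
    have fine: "\<exists>i. i \<in> K \<and> x \<in> cball (fst i) (snd i) \<and> snd i < d" if "x \<in> U" "0 < d" for x d
    proof -
      obtain e where e: "e > 0" "cball x e \<subseteq> U" using U \<open>x \<in> U\<close> unfolding open_contains_cball by blast
      show ?thesis
        by (rule exI[of _ "(x, min e (d/2))"]) (use e \<open>0 < d\<close> in \<open>auto simp: K_def subset_iff\<close>)
    qed
    obtain C where C: "countable C" "C \<subseteq> K"
      "pairwise (\<lambda>i j. disjnt (cball (fst i) (snd i)) (cball (fst j) (snd j))) C"
      "negligible (U - (\<Union>i\<in>C. cball (fst i) (snd i)))"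
      by (rule Vitali_covering_theorem_cballs[of K snd U fst]) (use fine in \<open>auto simp: K_def\<close>)
    define X Y where "X i = cball (fst i) (snd i)" and "Y i = cball (T (fst i)) (snd i)" for i :: "'a \<times> real"
    have XY: "Y i = T ` X i" "emeasure lborel (X i) = emeasure lborel (Y i)" if "i \<in> C" for i
      using C(2) that emeasure_cball[of "snd i"] by (auto simp: X_def Y_def ball K_def less_imp_le emeasure_cball)
    have dX: "disjoint_family_on X C"
      using C(3) unfolding disjoint_family_on_def pairwise_def disjnt_def X_def by blast
    have "inj T" using inv by (metis injI)
    then have dY: "disjoint_family_on Y C"
      using dX XY(1) unfolding disjoint_family_on_def by (metis image_Int image_empty)
    have sX: "(\<Union>i\<in>C. X i) \<in> sets borel" using C(1) by (intro sets.countable_UN') (auto simp: X_def)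
    have "U - (\<Union>i\<in>C. X i) \<in> null_sets lborel"
      using C(4) sX U by (intro borel_negligible_null_sets) (auto simp: X_def)
    then have "emeasure lborel U = emeasure lborel (U \<inter> (\<Union>i\<in>C. X i))"
      using sX U by (intro emeasure_eq_AE) (auto dest!: AE_not_in elim!: eventually_mono)
    also have "\<dots> \<le> emeasure lborel (\<Union>i\<in>C. X i)" using sX by (intro emeasure_mono) auto
    also have "\<dots> = (\<integral>\<^sup>+i. emeasure lborel (X i) \<partial>count_space C)"
      by (rule emeasure_UN_countable[OF _ C(1) dX]) (simp add: X_def)
    also have "\<dots> = (\<integral>\<^sup>+i. emeasure lborel (Y i) \<partial>count_space C)"
      by (intro nn_integral_cong) (use XY in auto)
    also have "\<dots> = emeasure lborel (\<Union>i\<in>C. Y i)"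
      by (rule emeasure_UN_countable[OF _ C(1) dY, symmetric]) (simp add: Y_def)
    also have "\<dots> \<le> emeasure lborel (T -` U)"
    proof (rule emeasure_mono)
      show "(\<Union>i\<in>C. Y i) \<subseteq> T -` U"
      proof -
        have "X i \<subseteq> U" if "i \<in> C" for i
          using subsetD[OF C(2) that] unfolding K_def X_def by auto
        then show ?thesis using XY(1) unfolding im by blast
      qed
    qed (use op[OF U] in auto)
    finally show ?thesis .
  qed
  \<comment> \<open>The reverse inequality is the same one applied to the preimage, since
    \<open>T\<close> is its own inverse.\<close>
  have eq: "emeasure lborel (T -` U) = emeasure lborel U" if U: "open U" for U
  proof (rule antisym)
    have "T -` T -` U = U" using inv by auto
    then show "emeasure lborel (T -` U) \<le> emeasure lborel U" using le[OF op[OF U]] by simp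
  qed (rule le[OF U])
  have Tm: "T \<in> borel_measurable borel" by (rule borel_measurable_continuous_onI[OF cont])
  show ?thesis
  proof (rule lborel_eqI[symmetric])
    fix l u :: 'a assume "\<And>b. b \<in> Basis \<Longrightarrow> l \<bullet> b \<le> u \<bullet> b"
    then show "emeasure (distr lborel borel T) (box l u) = (\<Prod>b\<in>Basis. (u - l) \<bullet> b)"
      using Tm by (simp add: emeasure_distr eq open_box)
  qed simp
qed

section \<open>The volume of a solid cylinder with arbitrary axis\<close>

definition cylinder :: "'a::euclidean_space \<Rightarrow> real \<Rightarrow> real \<Rightarrow> 'a set" where
  "cylinder n r h = {v. norm (v - (v \<bullet> n) *\<^sub>R n) \<le> r \<and> \<bar>v \<bullet> n\<bar> \<le> h}"

lemma closed_cylinder: "closed (cylinder n r h)"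
  unfolding cylinder_def by (intro closed_Collect_conj closed_Collect_le continuous_intros)

text \<open>In product coordinates the coordinate along \<open>b\<close> splits off as an interval,
  and the others form a ball whose volume in dimension \<open>card A\<close> is known.
  \<open>h\<close> is the half-height, which explains \<open>2 * h\<close>.\<close>

lemma emeasure_cylinder_Basis:
  fixes b :: "'a::euclidean_space"
  assumes b: "b \<in> Basis" and r: "r > 0" and h: "h \<ge> 0"
  shows "emeasure lborel (cylinder b r h) = ennreal (unit_ball_vol (real (DIM('a) - 1)) * r ^ (DIM('a) - 1) * (2 * h))"
proof -
  interpret product_sigma_finite "\<lambda>_. lborel :: real measure" by standard
  define A where "A = Basis - {b}"
  have A: "finite A" "b \<notin> A" "insert b A = Basis" "card A = DIM('a) - 1"
    using b by (auto simp: A_def card_Diff_singleton)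
  define S where "S = (\<lambda>f::'a \<Rightarrow> real. \<Sum>i\<in>Basis. f i *\<^sub>R i)"
  have Sb: "S f \<bullet> b = f b" for f unfolding S_def using b by (simp add: inner_sum_left_Basis)
  have Sn: "norm (S f - (S f \<bullet> b) *\<^sub>R b) = sqrt (\<Sum>i\<in>A. (f i)\<^sup>2)" for f
  proof -
    have "norm v = sqrt (\<Sum>i\<in>Basis. (v \<bullet> i)\<^sup>2)" for v :: 'a
      by (subst norm_eq_sqrt_inner, subst euclidean_inner) (simp add: power2_eq_square)
    then have "norm (S f - (S f \<bullet> b) *\<^sub>R b) = sqrt (\<Sum>i\<in>Basis. ((S f - (S f \<bullet> b) *\<^sub>R b) \<bullet> i)\<^sup>2)" .
    also have "(\<Sum>i\<in>Basis. ((S f - (S f \<bullet> b) *\<^sub>R b) \<bullet> i)\<^sup>2) = (\<Sum>i\<in>A. (f i)\<^sup>2)"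
    proof -
      have "(\<Sum>i\<in>Basis. ((S f - (S f \<bullet> b) *\<^sub>R b) \<bullet> i)\<^sup>2) = ((S f - (S f \<bullet> b) *\<^sub>R b) \<bullet> b)\<^sup>2 + (\<Sum>i\<in>A. ((S f - (S f \<bullet> b) *\<^sub>R b) \<bullet> i)\<^sup>2)"
        unfolding A_def by (rule sum.remove) (use b in auto)
      moreover have "(S f - (S f \<bullet> b) *\<^sub>R b) \<bullet> b = 0" using b by (simp add: inner_diff_left)
      moreover have "(S f - (S f \<bullet> b) *\<^sub>R b) \<bullet> i = f i" if "i \<in> A" for i
        using b that by (auto simp: A_def inner_diff_left S_def inner_sum_left_Basis inner_Basis)
      ultimately show ?thesis by simp
    qed
    finally show ?thesis .
  qed
  let ?P = "Pi\<^sub>M (insert b A) (\<lambda>_. lborel :: real measure)"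
  let ?Q = "Pi\<^sub>M A (\<lambda>_. lborel :: real measure)"
  have Sm: "S \<in> measurable ?P borel" unfolding S_def A(3) by measurable
  have "emeasure lborel (cylinder b r h) = emeasure (distr ?P borel S) (cylinder b r h)"
    unfolding A(3) S_def by (subst lborel_eq) simp
  also have "\<dots> = emeasure ?P (S -` cylinder b r h \<inter> space ?P)"
    by (rule emeasure_distr[OF Sm]) (simp add: borel_closed closed_cylinder)
  also have "\<dots> = (\<integral>\<^sup>+ f. indicator (S -` cylinder b r h \<inter> space ?P) f \<partial>?P)"
    by (rule nn_integral_indicator[symmetric]) (intro measurable_sets[OF Sm] borel_closed closed_cylinder)
  also have "\<dots> = (\<integral>\<^sup>+ y. \<integral>\<^sup>+ x. indicator (S -` cylinder b r h \<inter> space ?P) (x(b := y)) \<partial>?Q \<partial>lborel)"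
    by (rule product_nn_integral_insert_rev[OF A(1,2) borel_measurable_indicator])
      (intro measurable_sets[OF Sm] borel_closed closed_cylinder)
  also have "\<dots> = (\<integral>\<^sup>+ y. \<integral>\<^sup>+ x. indicator {-h..h} y * indicator ({f. sqrt (\<Sum>i\<in>A. (f i)\<^sup>2) \<le> r} \<inter> space ?Q) x \<partial>?Q \<partial>lborel)"
  proof (intro nn_integral_cong)
    fix y :: real and x assume x: "x \<in> space ?Q"
    have e: "(\<Sum>i\<in>A. ((x(b := y)) i)\<^sup>2) = (\<Sum>i\<in>A. (x i)\<^sup>2)" using A(2) by (intro sum.cong) auto
    have Sy: "S (x(b := y)) \<bullet> b = y" by (simp add: Sb)
    have "norm (S (x(b := y)) - y *\<^sub>R b) = sqrt (\<Sum>i\<in>A. (x i)\<^sup>2)" using Sn[of "x(b := y)"] unfolding e Sy .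
    moreover have "x(b := y) \<in> space ?P" using x by (auto simp: space_PiM PiE_def extensional_def)
    ultimately show "indicator (S -` cylinder b r h \<inter> space ?P) (x(b := y)) =
        (indicator {-h..h} y * indicator ({f. sqrt (\<Sum>i\<in>A. (f i)\<^sup>2) \<le> r} \<inter> space ?Q) x :: ennreal)"
      using x Sy by (auto simp: indicator_def cylinder_def abs_le_iff)
  qed
  also have "\<dots> = (\<integral>\<^sup>+ y. indicator {-h..h} y * emeasure ?Q ({f. sqrt (\<Sum>i\<in>A. (f i)\<^sup>2) \<le> r} \<inter> space ?Q) \<partial>lborel)"
    by (intro nn_integral_cong, subst nn_integral_cmult) (auto simp: nn_integral_indicator)
  also have "\<dots> = ennreal (unit_ball_vol (real (card A)) * r ^ card A) * ennreal (2 * h)"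
    unfolding emeasure_cball_aux[OF A(1) r] using h by (subst nn_integral_multc) (auto simp: mult.commute)
  finally show ?thesis using r h by (simp add: A(4) ennreal_mult')
qed

lemma emeasure_cylinder:
  fixes n :: "'a::euclidean_space"
  assumes n: "norm n = 1" and r: "r > 0" and h: "h \<ge> 0"
  shows "emeasure lborel (cylinder n r h) = ennreal (unit_ball_vol (real (DIM('a) - 1)) * r ^ (DIM('a) - 1) * (2 * h))"
proof -
  obtain b :: 'a where b: "b \<in> Basis" using nonempty_Basis by blast
  have nb: "n \<bullet> n = 1" "b \<bullet> b = 1" using n b by (simp_all add: norm_eq_1)
  show ?thesis
  proof (cases "n = b")
    case True then show ?thesis using emeasure_cylinder_Basis[OF b r h] by simp
  next
    case False
    \<comment> \<open>\<open>T\<close> below is the Householder reflection in the hyperplane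
      orthogonal to \<open>w\<close>; it exchanges the unit vectors \<open>n\<close> and
      \<open>b\<close> and reduces the claim to a coordinate axis.\<close>
    define w where "w = n - b"
    have w0: "w \<bullet> w \<noteq> 0" using False by (simp add: w_def)
    have ww: "w \<bullet> w = 2 - 2 * (n \<bullet> b)" "n \<bullet> w = 1 - n \<bullet> b"
      using nb by (simp_all add: w_def inner_diff inner_commute[of b n])
    define T where "T v = v - (2 * (v \<bullet> w) / (w \<bullet> w)) *\<^sub>R w" for v
    have Tdiff: "T x - T y = T (x - y)" for x y
      by (simp add: T_def inner_diff_left diff_divide_distrib algebra_simps)
    have Tsc: "T (c *\<^sub>R x) = c *\<^sub>R T x" for c x by (simp add: T_def algebra_simps)
    have TT: "T (T x) = x" for x using w0 by (simp add: T_def inner_diff_left algebra_simps)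
    have Tin: "T x \<bullet> T y = x \<bullet> y" for x y
      using w0 by (simp add: T_def inner_diff inner_commute[of w y] field_simps)
    have Tn: "norm (T x) = norm x" for x using Tin[of x x] by (simp add: norm_eq_sqrt_inner)
    have "2 * (n \<bullet> w) = w \<bullet> w" using ww by simp
    then have "2 * (n \<bullet> w) / (w \<bullet> w) = 1" using divide_self[OF w0] by (simp only:)
    then have "T n = n - w" by (simp only: T_def scaleR_one)
    then have Tnb: "T n = b" by (simp add: w_def)
    have d: "distr lborel borel T = lborel"
      by (rule isometric_involution_distr_lborel[OF TT]) (simp add: dist_norm Tdiff Tn)
    have "T \<in> borel_measurable borel" unfolding T_def by measurable
    then have "emeasure lborel (cylinder b r h) = emeasure lborel (T -` cylinder b r h)"
      by (subst d[symmetric], subst emeasure_distr) (auto simp: borel_closed closed_cylinder)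
    also have "T -` cylinder b r h = cylinder n r h"
    proof -
      have "T v \<bullet> b = v \<bullet> n" "norm (T v - (T v \<bullet> b) *\<^sub>R b) = norm (v - (v \<bullet> n) *\<^sub>R n)" for v
      proof -
        show a: "T v \<bullet> b = v \<bullet> n" using Tin[of v n] Tnb by simp
        have "T v - (T v \<bullet> b) *\<^sub>R b = T (v - (v \<bullet> n) *\<^sub>R n)" unfolding a Tdiff[symmetric] Tsc Tnb ..
        then show "norm (T v - (T v \<bullet> b) *\<^sub>R b) = norm (v - (v \<bullet> n) *\<^sub>R n)" by (simp add: Tn)
      qed
      then show ?thesis unfolding cylinder_def by auto
    qed
    finally show ?thesis using emeasure_cylinder_Basis[OF b r h] by simp
  qed
qed

text \<open>Averaging \<open>U\<close> with its reflection does not decrease the volume, by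
  Brunn-Minkowski. The average consists of halves of differences of points of \<open>U\<close>, so
  it lies in a cylinder of radius \<open>d / 2\<close> and half-height \<open>h / 2\<close>. Only
  the part of differences orthogonal to \<open>n\<close> is bounded by \<open>d\<close>, which is
  the form needed for tall columns.\<close>

lemma measure_le_isodiametric_open:
  fixes U :: "'a::euclidean_space set"
  assumes U: "open U" "bounded U" and n: "norm n = 1" and d: "d > 0" and h: "h \<ge> 0"
    and diam: "\<And>x y. x \<in> U \<Longrightarrow> y \<in> U \<Longrightarrow> norm ((x - y) - ((x - y) \<bullet> n) *\<^sub>R n) \<le> d"
    and height: "\<And>x y. x \<in> U \<Longrightarrow> y \<in> U \<Longrightarrow> \<bar>(x - y) \<bullet> n\<bar> \<le> h"
  shows "vol U \<le> unit_ball_vol (real (DIM('a) - 1)) * (d / 2) ^ (DIM('a) - 1) * h"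
proof -
  define V where "V = uminus -` U"
  have oV: "open V" unfolding V_def using U by (auto intro!: open_vimage continuous_intros)
  have Vim: "V = uminus ` U" unfolding V_def by force
  have bV: "bounded V" unfolding Vim using U by (auto simp: bounded_iff)
  have "distr lborel borel (uminus :: 'a \<Rightarrow> 'a) = lborel"
    by (rule isometric_involution_distr_lborel) (auto simp: dist_norm norm_minus_commute)
  then have "vol U = measure (distr lborel borel uminus) U" by simp
  also have "\<dots> = vol V" unfolding V_def using U by (subst measure_distr) auto
  finally have VU: "vol V = vol U" by simp
  have "vol U = sqrt (vol U * vol V)" unfolding VU by simp
  also have "\<dots> \<le> vol (midset U V)" by (rule Brunn_Minkowski_midset[OF U oV bV])
  also have "\<dots> \<le> vol (cylinder n (d / 2) (h / 2))"
  proof (rule measure_mono_fmeasurable)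
    show "midset U V \<subseteq> cylinder n (d / 2) (h / 2)"
    proof
      have half: "(1/2) *\<^sub>R v - ((1/2) *\<^sub>R v \<bullet> n) *\<^sub>R n = (1/2) *\<^sub>R (v - (v \<bullet> n) *\<^sub>R n)" for v
        by (simp add: scaleR_diff_right)
      fix z assume "z \<in> midset U V"
      then obtain x y where xy: "x \<in> U" "y \<in> U" "z = (1/2) *\<^sub>R (x - y)"
        unfolding midset_def Vim by auto
      have "z - (z \<bullet> n) *\<^sub>R n = (1/2) *\<^sub>R ((x - y) - ((x - y) \<bullet> n) *\<^sub>R n)"
        using half[of "x - y"] unfolding xy(3) .
      then have "norm (z - (z \<bullet> n) *\<^sub>R n) = norm ((x - y) - ((x - y) \<bullet> n) *\<^sub>R n) / 2" by (simp only: norm_scaleR)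
      moreover have "\<bar>z \<bullet> n\<bar> = \<bar>(x - y) \<bullet> n\<bar> / 2"
        unfolding xy(3) inner_scaleR_left abs_mult by linarith
      ultimately show "z \<in> cylinder n (d / 2) (h / 2)"
        unfolding cylinder_def using diam[OF xy(1,2)] height[OF xy(1,2)] by simp
    qed
    show "midset U V \<in> sets lborel" using open_midset[OF U(1)] by simp
    show "cylinder n (d / 2) (h / 2) \<in> fmeasurable lborel"
      using emeasure_cylinder[OF n, of "d/2" "h/2"] d h
      by (intro fmeasurableI) (simp_all add: borel_closed closed_cylinder)
  qed
  also have "\<dots> = unit_ball_vol (real (DIM('a) - 1)) * (d / 2) ^ (DIM('a) - 1) * h"
    using emeasure_cylinder[OF n, of "d/2" "h/2"] d h by (simp add: measure_def)
  finally show ?thesis .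
qed

text \<open>The open case for the \<open>s\<close>-neighbourhood, with \<open>s\<close> tending to
  0; this also admits degenerate \<open>d\<close>. A difference of two points changes by at most
  \<open>2 * s\<close>, and its orthogonal part, by the crude factor 2 for the projection, by at
  most \<open>4 * s\<close>.\<close>

lemma measure_le_isodiametric_compact:
  fixes X :: "'a::euclidean_space set"
  assumes X: "compact X" and n: "norm n = 1" and d: "d \<ge> 0" and h: "h \<ge> 0"
    and diam: "\<And>x y. x \<in> X \<Longrightarrow> y \<in> X \<Longrightarrow> norm ((x - y) - ((x - y) \<bullet> n) *\<^sub>R n) \<le> d"
    and height: "\<And>x y. x \<in> X \<Longrightarrow> y \<in> X \<Longrightarrow> \<bar>(x - y) \<bullet> n\<bar> \<le> h"
  shows "vol X \<le> unit_ball_vol (real (DIM('a) - 1)) * (d / 2) ^ (DIM('a) - 1) * h"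
proof -
  have le: "vol X \<le> unit_ball_vol (real (DIM('a) - 1)) * ((d + 4 * s) / 2) ^ (DIM('a) - 1) * (h + 2 * s)"
    if s: "s > 0" for s
  proof -
    define U where "U = (\<Union>x\<in>X. ball x s)"
    have U: "open U" unfolding U_def by blast
    obtain B where B: "\<And>x. x \<in> X \<Longrightarrow> norm x \<le> B" using X compact_imp_bounded bounded_iff by metis
    have "norm y \<le> B + s" if "y \<in> U" for y
    proof -
      obtain x where x: "x \<in> X" "dist x y < s" using \<open>y \<in> U\<close> unfolding U_def by auto
      have "norm y \<le> norm x + dist x y" by (simp add: dist_norm norm_minus_commute) norm
      then show ?thesis using x B[OF x(1)] by linarith
    qed
    then have bU: "bounded U" unfolding bounded_iff by blast
    have pr: "norm (v - (v \<bullet> n) *\<^sub>R n) \<le> 2 * norm v" for v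
    proof -
      have "norm (v - (v \<bullet> n) *\<^sub>R n) \<le> norm v + norm ((v \<bullet> n) *\<^sub>R n)" by (rule norm_triangle_ineq4)
      also have "norm ((v \<bullet> n) *\<^sub>R n) \<le> norm v" using Cauchy_Schwarz_ineq2[of v n] n by simp
      finally show ?thesis by simp
    qed
    have pt: "norm ((x - y) - ((x - y) \<bullet> n) *\<^sub>R n) \<le> d + 4 * s \<and> \<bar>(x - y) \<bullet> n\<bar> \<le> h + 2 * s"
      if "x \<in> U" "y \<in> U" for x y
    proof -
      obtain a where a: "a \<in> X" "dist a x < s" using \<open>x \<in> U\<close> unfolding U_def by auto
      obtain c where c: "c \<in> X" "dist c y < s" using \<open>y \<in> U\<close> unfolding U_def by auto
      define v where "v = (x - a) - (y - c)"
      have "norm v \<le> norm (x - a) + norm (y - c)" unfolding v_def by (rule norm_triangle_ineq4)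
      then have v: "norm v \<le> 2 * s" using a(2) c(2) by (simp add: dist_norm norm_minus_commute)
      have xy: "x - y = (a - c) + v" by (simp add: v_def)
      have "(x - y) - ((x - y) \<bullet> n) *\<^sub>R n = ((a - c) - ((a - c) \<bullet> n) *\<^sub>R n) + (v - (v \<bullet> n) *\<^sub>R n)"
        unfolding xy inner_add_left scaleR_add_left by simp
      then have "norm ((x - y) - ((x - y) \<bullet> n) *\<^sub>R n) \<le> norm ((a - c) - ((a - c) \<bullet> n) *\<^sub>R n) + norm (v - (v \<bullet> n) *\<^sub>R n)"
        by (metis norm_triangle_ineq)
      then have 1: "norm ((x - y) - ((x - y) \<bullet> n) *\<^sub>R n) \<le> d + 4 * s"
        using diam[OF a(1) c(1)] pr[of v] v by linarith
      have "\<bar>v \<bullet> n\<bar> \<le> 2 * s" using Cauchy_Schwarz_ineq2[of v n] n v by simp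
      moreover have "(x - y) \<bullet> n = (a - c) \<bullet> n + v \<bullet> n" unfolding xy inner_add_left ..
      ultimately show ?thesis using 1 height[OF a(1) c(1)] by linarith
    qed
    have "vol X \<le> vol U"
      using s X by (intro measure_mono_fmeasurable bounded_open_fmeasurable[OF U bU]) (auto simp: U_def compact_imp_closed)
    also have "\<dots> \<le> unit_ball_vol (real (DIM('a) - 1)) * ((d + 4 * s) / 2) ^ (DIM('a) - 1) * (h + 2 * s)"
      by (rule measure_le_isodiametric_open[OF U bU n]) (use pt s d h in auto)
    finally show ?thesis .
  qed
  show ?thesis
  proof (rule tendsto_lowerbound)
    have "((\<lambda>s. unit_ball_vol (real (DIM('a) - 1)) * ((d + 4 * s) / 2) ^ (DIM('a) - 1) * (h + 2 * s)) \<longlongrightarrow>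
      unit_ball_vol (real (DIM('a) - 1)) * ((d + 4 * 0) / 2) ^ (DIM('a) - 1) * (h + 2 * 0)) (at_right 0)"
      by (intro tendsto_intros) simp_all
    then show "((\<lambda>s. unit_ball_vol (real (DIM('a) - 1)) * ((d + 4 * s) / 2) ^ (DIM('a) - 1) * (h + 2 * s)) \<longlongrightarrow>
      unit_ball_vol (real (DIM('a) - 1)) * (d / 2) ^ (DIM('a) - 1) * h) (at_right 0)" by simp
    show "\<forall>\<^sub>F s in at_right 0. vol X \<le> unit_ball_vol (real (DIM('a) - 1)) * ((d + 4 * s) / 2) ^ (DIM('a) - 1) * (h + 2 * s)"
      by (rule eventually_at_rightI[of 0 1]) (use le in auto)
  qed simp
qed

section \<open>Hausdorff measure as a Borel measure\<close>

lemma ennreal_suminf_tail_tendsto_0: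
  fixes f :: "nat \<Rightarrow> ennreal"
  assumes fin: "(\<Sum>i. f i) < \<infinity>"
  shows "(\<lambda>n. \<Sum>i. f (i + n)) \<longlonglongrightarrow> 0"
proof -
  define g where "g i = enn2real (f i)" for i
  have fg: "f i = ennreal (g i)" for i
    using ennreal_suminf_lessD[of f \<infinity> i] fin by (simp add: g_def less_top)
  have g0: "0 \<le> g i" for i by (simp add: g_def)
  have "(\<Sum>i. ennreal (g i)) \<noteq> top" using fin unfolding fg[symmetric] by simp
  then have g: "summable g" using g0 by (intro summable_suminf_not_top) auto
  have "(\<lambda>n. suminf g - (\<Sum>i<n. g i)) \<longlonglongrightarrow> suminf g - suminf g"
    by (intro tendsto_intros summable_LIMSEQ[OF g])
  then have "(\<lambda>n. ennreal (\<Sum>i. g (i + n))) \<longlonglongrightarrow> ennreal 0"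
    by (intro tendsto_ennrealI) (simp add: suminf_minus_initial_segment[OF g])
  moreover have "(\<Sum>i. f (i + n)) = ennreal (\<Sum>i. g (i + n))" for n
    unfolding fg by (rule suminf_ennreal2) (use g g0 in \<open>auto simp: summable_iff_shift\<close>)
  ultimately show ?thesis by simp
qed

text \<open>The last axiom is superadditivity on sets at positive distance; together with
  subadditivity it is additivity there, which is what makes closed sets measurable.\<close>

locale metric_outer_measure =
  fixes \<mu> :: "'a::metric_space set \<Rightarrow> ennreal"
  assumes empty: "\<mu> {} = 0"
    and mono: "\<And>A B. A \<subseteq> B \<Longrightarrow> \<mu> A \<le> \<mu> B"
    and subadd: "\<And>A :: nat \<Rightarrow> 'a set. \<mu> (\<Union>i. A i) \<le> (\<Sum>i. \<mu> (A i))"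
    and metric_add: "\<And>A B d. d > 0 \<Longrightarrow> (\<And>a b. a \<in> A \<Longrightarrow> b \<in> B \<Longrightarrow> d \<le> dist a b) \<Longrightarrow> \<mu> A + \<mu> B \<le> \<mu> (A \<union> B)"
begin

lemma subadd2: "\<mu> (A \<union> B) \<le> \<mu> A + \<mu> B"
proof -
  have "\<mu> (A \<union> B) = \<mu> (\<Union>i. binaryset A B i)" by (simp add: UN_binaryset_eq)
  also have "\<dots> \<le> (\<Sum>i. \<mu> (binaryset A B i))" by (rule subadd)
  also have "\<dots> = \<mu> A + \<mu> B" by (rule suminf_binaryset_eq) (simp add: empty)
  finally show ?thesis .
qed

text \<open>Alternate annuli around \<open>F\<close> are at positive distance from each other, which bounds the sum of their measures.\<close>

lemma sum_separated:
  fixes R :: "nat \<Rightarrow> 'a set"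
  assumes sep: "\<And>i. i < n \<Longrightarrow> \<exists>d>0. \<forall>a\<in>(\<Union>j<i. R j). \<forall>b\<in>R i. d \<le> dist a b"
  shows "(\<Sum>i<n. \<mu> (R i)) \<le> \<mu> (\<Union>i<n. R i)"
  using sep
proof (induction n)
  case (Suc n)
  obtain d where d: "d > 0" "\<forall>a\<in>(\<Union>j<n. R j). \<forall>b\<in>R n. d \<le> dist a b" using Suc.prems[of n] by blast
  have "(\<Sum>i<Suc n. \<mu> (R i)) = (\<Sum>i<n. \<mu> (R i)) + \<mu> (R n)" by simp
  also have "\<dots> \<le> \<mu> (\<Union>i<n. R i) + \<mu> (R n)" using Suc by (intro add_right_mono) auto
  also have "\<dots> \<le> \<mu> ((\<Union>i<n. R i) \<union> R n)" by (rule metric_add[OF d(1)]) (use d(2) in blast)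
  also have "(\<Union>i<n. R i) \<union> R n = (\<Union>i<Suc n. R i)" by (auto simp: lessThan_Suc)
  finally show ?case .
qed (simp add: empty)

text \<open>Caratheodory's criterion. The part \<open>A n\<close> of \<open>T\<close> at distance at
  least \<open>r n\<close> from \<open>F\<close> is separated from \<open>F\<close>, so the measures
  add. The rest of \<open>T - F\<close> is covered by the annuli \<open>R i\<close> with
  \<open>i \<ge> n\<close>, and their measures form the tail of a convergent series.\<close>

lemma closed_splits:
  assumes F: "closed F"
  shows "\<mu> (F \<inter> T) + \<mu> (T - F) \<le> \<mu> T"
proof (cases "F = {} \<or> \<mu> T = \<infinity>")
  case True
  then show ?thesis by (auto simp: empty)
next
  case False
  then have F0: "F \<noteq> {}" and fin: "\<mu> T < \<infinity>" by (auto simp: less_top)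
  define r where "r n = inverse (real (Suc n))" for n
  have r: "r n > 0" "m \<le> n \<Longrightarrow> r n \<le> r m" for n m by (auto simp: r_def field_simps)
  define A where "A n = {x \<in> T - F. r n \<le> infdist x F}" for n
  define R where "R n = A (Suc n) - A n" for n
  have AT: "A n \<subseteq> T - F" for n by (auto simp: A_def)
  have sep: "r (Suc i) - r j \<le> dist a b"
    if "a \<in> A (Suc i)" "b \<in> R j" for i j a b
  proof -
    have "infdist b F < r j" "r (Suc i) \<le> infdist a F" using that by (auto simp: A_def R_def)
    moreover have "infdist a F \<le> infdist b F + dist a b" by (rule infdist_triangle)
    ultimately show ?thesis by linarith
  qed
  \<comment> \<open>Neighbouring annuli may touch, but those of equal parity have an annulus between
    them. The cases \<open>k = 0\<close> and \<open>k = 1\<close> together give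
    \<open>2 * \<mu> T\<close> for the whole series.\<close>
  have bound: "(\<Sum>i<n. \<mu> (R (2 * i + k))) \<le> \<mu> T" for n k
  proof -
    have "(\<Sum>i<n. \<mu> (R (2 * i + k))) \<le> \<mu> (\<Union>i<n. R (2 * i + k))"
    proof (rule sum_separated)
      fix i assume "i < n"
      have rr: "r (Suc (2 * j + k)) - r (2 * i + k) \<ge> r (2 * i + k - 1) - r (2 * i + k)" if "j < i" for j
        using r(2)[of "Suc (2 * j + k)" "2 * i + k - 1"] that by simp
      show "\<exists>d>0. \<forall>a\<in>\<Union>j<i. R (2 * j + k). \<forall>b\<in>R (2 * i + k). d \<le> dist a b"
      proof (cases "i = 0")
        case True then show ?thesis by (auto intro: exI[of _ 1])
      next
        case False
        have "r (2 * i + k - 1) - r (2 * i + k) > 0" using False unfolding r_def by (simp add: of_nat_diff)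
        moreover have "r (2 * i + k - 1) - r (2 * i + k) \<le> dist a b"
          if "a \<in> R (2 * j + k)" "b \<in> R (2 * i + k)" "j < i" for a b j
          using sep[of a "2 * j + k" b "2 * i + k"] rr[OF that(3)] that(1,2) by (auto simp: R_def)
        ultimately show ?thesis by blast
      qed
    qed
    also have "\<dots> \<le> \<mu> T" using AT by (intro mono) (auto simp: R_def)
    finally show ?thesis .
  qed
  have split: "(\<Sum>i<2 * n. f i) = (\<Sum>i<n. f (2 * i)) + (\<Sum>i<n. f (2 * i + 1))" for f :: "nat \<Rightarrow> ennreal" and n
    by (induction n) (auto simp: algebra_simps)
  have "(\<Sum>i. \<mu> (R i)) \<le> 2 * \<mu> T"
  proof (rule suminf_le_const)
    fix n
    have "(\<Sum>i<n. \<mu> (R i)) \<le> (\<Sum>i<2 * n. \<mu> (R i))" by (rule sum_mono2) auto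
    also have "\<dots> \<le> \<mu> T + \<mu> T" unfolding split using bound[where n=n and k=0] bound[where n=n and k=1] by (intro add_mono) auto
    finally show "(\<Sum>i<n. \<mu> (R i)) \<le> 2 * \<mu> T" by (simp add: mult_2)
  qed simp
  also have "\<dots> < \<infinity>" using fin by (simp add: ennreal_mult_less_top)
  finally have sumR: "(\<Sum>i. \<mu> (R i)) < \<infinity>" .
  have le: "\<mu> (F \<inter> T) + \<mu> (T - F) \<le> \<mu> T + (\<Sum>i. \<mu> (R (i + n)))" for n
  proof -
    have "T - F \<subseteq> A n \<union> (\<Union>i. R (i + n))"
    proof
      fix x assume x: "x \<in> T - F"
      have "infdist x F > 0" using F F0 x infdist_pos_not_in_closed by blast
      then obtain m where "r m < infdist x F" using reals_Archimedean unfolding r_def by blast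
      then have ex: "\<exists>m. x \<in> A m" using x by (auto simp: A_def intro!: exI[of _ m])
      define m where "m = (LEAST m. x \<in> A m)"
      have m: "x \<in> A m" "\<And>k. k < m \<Longrightarrow> x \<notin> A k" unfolding m_def using ex by (auto intro: LeastI_ex dest: not_less_Least)
      have mon: "A i \<subseteq> A j" if "i \<le> j" for i j using r(2)[OF that] by (auto simp: A_def)
      show "x \<in> A n \<union> (\<Union>i. R (i + n))"
      proof (cases "m \<le> n")
        case True then show ?thesis using mon m(1) by blast
      next
        case False
        then obtain l where l: "m = Suc (l + n)" using less_imp_Suc_add[of n m] by (auto simp: add.commute)
        then have "x \<in> R (l + n)" using m by (simp add: R_def)
        then show ?thesis by blast
      qed
    qed
    then have "\<mu> (T - F) \<le> \<mu> (A n \<union> (\<Union>i. R (i + n)))" by (rule mono)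
    also have "\<dots> \<le> \<mu> (A n) + (\<Sum>i. \<mu> (R (i + n)))" by (rule order.trans[OF subadd2 add_left_mono[OF subadd]])
    finally have "\<mu> (F \<inter> T) + \<mu> (T - F) \<le> (\<mu> (F \<inter> T) + \<mu> (A n)) + (\<Sum>i. \<mu> (R (i + n)))"
      by (simp add: add_left_mono add.assoc)
    also have "\<mu> (F \<inter> T) + \<mu> (A n) \<le> \<mu> ((F \<inter> T) \<union> A n)"
    proof (rule metric_add[OF r(1)[of n]])
      fix a b assume "a \<in> F \<inter> T" "b \<in> A n"
      then show "r n \<le> dist a b" using infdist_le[of a F b] by (auto simp: A_def dist_commute)
    qed
    also have "\<dots> \<le> \<mu> T" using AT by (intro mono) auto
    finally show ?thesis by (simp add: add_right_mono)
  qed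
  have "(\<lambda>n. \<mu> T + (\<Sum>i. \<mu> (R (i + n)))) \<longlonglongrightarrow> \<mu> T + 0"
    using sumR by (intro tendsto_intros ennreal_suminf_tail_tendsto_0)
  then show ?thesis using le by (intro LIMSEQ_le_const[of _ "\<mu> T"]) auto
qed

text \<open>By the splitting property, closed sets lie in the Caratheodory sigma-algebra, and they
  generate the Borel sets.\<close>

lemma measure_space_borel: "measure_space UNIV (sets borel) \<mu>"
proof -
  interpret P: sigma_algebra UNIV "Pow (UNIV :: 'a set)" by (rule sigma_algebra_Pow)
  have oms: "outer_measure_space (Pow UNIV) \<mu>"
    unfolding outer_measure_space_def positive_def increasing_def countably_subadditive_def
    using empty mono subadd by auto
  define L where "L = lambda_system UNIV (Pow UNIV) \<mu>"
  have L: "measure_space UNIV L \<mu>" unfolding L_def by (rule P.caratheodory_lemma[OF oms])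
  have sL: "sigma_algebra UNIV L" using L by (simp add: measure_space_def)
  have "F \<in> L" if F: "closed F" for F
  proof -
    have "\<mu> (F \<inter> x) + \<mu> ((UNIV - F) \<inter> x) = \<mu> x" for x
    proof (rule antisym)
      have "(UNIV - F) \<inter> x = x - F" by blast
      then show "\<mu> (F \<inter> x) + \<mu> ((UNIV - F) \<inter> x) \<le> \<mu> x" using closed_splits[OF F] by simp
      have "x = (F \<inter> x) \<union> ((UNIV - F) \<inter> x)" by blast
      then show "\<mu> x \<le> \<mu> (F \<inter> x) + \<mu> ((UNIV - F) \<inter> x)" using subadd2 by metis
    qed
    then show ?thesis unfolding L_def lambda_system_def by simp
  qed
  then have "sigma_sets UNIV (Collect closed) \<subseteq> L"
    by (intro sigma_algebra.sigma_sets_subset[OF sL]) auto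
  then have sub: "sets borel \<subseteq> L" by (simp add: borel_eq_closed sets_measure_of)
  show ?thesis
    by (rule measure_down[OF L _ sub]) (metis sets.sigma_algebra_axioms space_borel)
qed

end

section \<open>Hausdorff premeasures at a fixed scale, and the limit of small scales\<close>

lemma hausdorff_pre_le:
  assumes "A \<subseteq> (\<Union>i. C i)" "\<And>i::nat. bounded (C i)" "\<And>i. diameter (C i) \<le> \<delta>"
  shows "hausdorff_pre k \<delta> A \<le> (\<Sum>i. hausdorff_weight k (C i))"
  unfolding hausdorff_pre_def by (rule INF_lower) (use assms in auto)

lemma hausdorff_pre_empty: "\<delta> > 0 \<Longrightarrow> hausdorff_pre k \<delta> {} = 0"
  using hausdorff_pre_le[of "{}" "\<lambda>_. {}" \<delta> k] by (simp add: hausdorff_weight_def)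

lemma hausdorff_pre_mono: "A \<subseteq> B \<Longrightarrow> hausdorff_pre k \<delta> A \<le> hausdorff_pre k \<delta> B"
  unfolding hausdorff_pre_def by (intro INF_superset_mono) auto

lemma hausdorff_pre_antimono: "\<delta> \<le> \<delta>' \<Longrightarrow> hausdorff_pre k \<delta>' A \<le> hausdorff_pre k \<delta> A"
  unfolding hausdorff_pre_def by (intro INF_superset_mono) (auto intro: order.trans)

lemma hausdorff_pre_subadd:
  fixes A :: "nat \<Rightarrow> 'a::metric_space set"
  shows "hausdorff_pre k \<delta> (\<Union>i. A i) \<le> (\<Sum>i. hausdorff_pre k \<delta> (A i))"
proof (rule ennreal_le_epsilon)
  fix e :: real assume e: "0 < e" and fin: "(\<Sum>i. hausdorff_pre k \<delta> (A i)) < top"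
  have "\<exists>C. A n \<subseteq> (\<Union>i. C i) \<and> (\<forall>i::nat. bounded (C i) \<and> diameter (C i) \<le> \<delta>) \<and>
      (\<Sum>i. hausdorff_weight k (C i)) \<le> hausdorff_pre k \<delta> (A n) + e * (1/2) ^ Suc n" for n
  proof -
    have "hausdorff_pre k \<delta> (A n) < top" using ennreal_suminf_lessD[OF fin] .
    then have "hausdorff_pre k \<delta> (A n) < hausdorff_pre k \<delta> (A n) + e * (1/2) ^ Suc n" using e by simp
    then show ?thesis unfolding hausdorff_pre_def[of k \<delta> "A n"] INF_less_iff by (auto intro: less_imp_le)
  qed
  then obtain B where B: "\<And>n. A n \<subseteq> (\<Union>i. B n i)" "\<And>n i::nat. bounded (B n i)" "\<And>n i. diameter (B n i) \<le> \<delta>"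
    "\<And>n. (\<Sum>i. hausdorff_weight k (B n i)) \<le> hausdorff_pre k \<delta> (A n) + e * (1/2) ^ Suc n" by metis
  define C where "C i = (case prod_decode i of (n, m) \<Rightarrow> B n m)" for i
  have "(\<Union>i. A i) \<subseteq> (\<Union>i. C i)"
  proof
    fix x assume "x \<in> (\<Union>i. A i)"
    then obtain n m where "x \<in> B n m" using B(1) by blast
    then have "x \<in> C (prod_encode (n, m))" by (simp add: C_def)
    then show "x \<in> (\<Union>i. C i)" by blast
  qed
  then have "hausdorff_pre k \<delta> (\<Union>i. A i) \<le> (\<Sum>i. hausdorff_weight k (C i))"
    by (rule hausdorff_pre_le) (auto simp: C_def B split: prod.split)
  also have "\<dots> = (\<Sum>i. (\<lambda>(n, m). hausdorff_weight k (B n m)) (prod_decode i))"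
    by (intro suminf_cong) (auto simp: C_def split: prod.split)
  also have "\<dots> = (\<Sum>n. \<Sum>m. hausdorff_weight k (B n m))" by (rule suminf_ennreal_2dimen) auto
  also have "\<dots> \<le> (\<Sum>n. hausdorff_pre k \<delta> (A n) + e * (1/2) ^ Suc n)" by (intro suminf_le B) auto
  also have "\<dots> = (\<Sum>n. hausdorff_pre k \<delta> (A n)) + (\<Sum>n. ennreal e * ennreal ((1/2) ^ Suc n))"
    using e by (subst suminf_add[symmetric]) (auto simp del: ennreal_suminf_cmult simp add: ennreal_mult[symmetric])
  also have "\<dots> = (\<Sum>n. hausdorff_pre k \<delta> (A n)) + e"
    unfolding ennreal_suminf_cmult by (subst suminf_ennreal_eq[OF zero_le_power power_half_series]) auto
  finally show "hausdorff_pre k \<delta> (\<Union>i. A i) \<le> (\<Sum>n. hausdorff_pre k \<delta> (A n)) + e" .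
qed

lemma hausdorff_pre_subadd2:
  assumes "\<delta> > 0" shows "hausdorff_pre k \<delta> (A \<union> B) \<le> hausdorff_pre k \<delta> A + hausdorff_pre k \<delta> B"
proof -
  have "hausdorff_pre k \<delta> (A \<union> B) = hausdorff_pre k \<delta> (\<Union>i. binaryset A B i)" by (simp add: UN_binaryset_eq)
  also have "\<dots> \<le> (\<Sum>i. hausdorff_pre k \<delta> (binaryset A B i))" by (rule hausdorff_pre_subadd)
  also have "\<dots> = hausdorff_pre k \<delta> A + hausdorff_pre k \<delta> B"
    by (rule suminf_binaryset_eq) (simp add: hausdorff_pre_empty assms)
  finally show ?thesis .
qed

text \<open>A set of diameter at most \<delta> < \<open>d\<close> cannot meet both \<open>A\<close>
  and \<open>B\<close>. A cover of the union therefore splits into a cover of each, with no set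
  counted twice.\<close>

lemma hausdorff_pre_metric:
  assumes \<delta>: "0 < \<delta>" "\<delta> < d" and sep: "\<And>a b. a \<in> A \<Longrightarrow> b \<in> B \<Longrightarrow> d \<le> dist a b"
  shows "hausdorff_pre k \<delta> A + hausdorff_pre k \<delta> B \<le> hausdorff_pre k \<delta> (A \<union> B)"
  unfolding hausdorff_pre_def[of k \<delta> "A \<union> B"]
proof (rule INF_greatest)
  fix C :: "nat \<Rightarrow> 'a set"
  assume "C \<in> {C. A \<union> B \<subseteq> (\<Union>i. C i) \<and> (\<forall>i. bounded (C i) \<and> diameter (C i) \<le> \<delta>)}"
  then have C: "A \<union> B \<subseteq> (\<Union>i. C i)" "\<And>i. bounded (C i)" "\<And>i. diameter (C i) \<le> \<delta>" by auto
  define CA where "CA i = (if C i \<inter> A = {} then {} else C i)" for i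
  define CB where "CB i = (if C i \<inter> B = {} then {} else C i)" for i
  have "hausdorff_pre k \<delta> A \<le> (\<Sum>i. hausdorff_weight k (CA i))"
  proof (rule hausdorff_pre_le)
    show "A \<subseteq> (\<Union>i. CA i)"
    proof
      fix x assume x: "x \<in> A"
      then obtain i where "x \<in> C i" using C(1) by blast
      then have "x \<in> CA i" using x by (auto simp: CA_def)
      then show "x \<in> (\<Union>i. CA i)" by blast
    qed
  qed (use C \<delta> in \<open>auto simp: CA_def\<close>)
  moreover have "hausdorff_pre k \<delta> B \<le> (\<Sum>i. hausdorff_weight k (CB i))"
  proof (rule hausdorff_pre_le)
    show "B \<subseteq> (\<Union>i. CB i)"
    proof
      fix x assume x: "x \<in> B"
      then obtain i where "x \<in> C i" using C(1) by blast
      then have "x \<in> CB i" using x by (auto simp: CB_def)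
      then show "x \<in> (\<Union>i. CB i)" by blast
    qed
  qed (use C \<delta> in \<open>auto simp: CB_def\<close>)
  ultimately have "hausdorff_pre k \<delta> A + hausdorff_pre k \<delta> B \<le> (\<Sum>i. hausdorff_weight k (CA i)) + (\<Sum>i. hausdorff_weight k (CB i))"
    by (rule add_mono)
  also have "\<dots> = (\<Sum>i. hausdorff_weight k (CA i) + hausdorff_weight k (CB i))" by (rule suminf_add) auto
  also have "\<dots> \<le> (\<Sum>i. hausdorff_weight k (C i))"
  proof (intro suminf_le allI)
    fix i
    have "C i \<inter> A = {} \<or> C i \<inter> B = {}"
    proof (rule ccontr)
      assume "\<not> ?thesis"
      then obtain a b where "a \<in> C i" "a \<in> A" "b \<in> C i" "b \<in> B" by blast
      then show False using diameter_bounded_bound[OF C(2), of a i b] C(3)[of i] sep[of a b] \<delta> by linarith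
    qed
    then show "hausdorff_weight k (CA i) + hausdorff_weight k (CB i) \<le> hausdorff_weight k (C i)"
      by (auto simp: CA_def CB_def hausdorff_weight_def)
  qed auto
  finally show "hausdorff_pre k \<delta> A + hausdorff_pre k \<delta> B \<le> (\<Sum>i. hausdorff_weight k (C i))" .
qed

lemma hausdorff_pre_le_outer: "\<delta> > 0 \<Longrightarrow> hausdorff_pre k \<delta> A \<le> hausdorff_outer k A"
  unfolding hausdorff_outer_def by (rule SUP_upper) auto

interpretation hausdorff: metric_outer_measure "hausdorff_outer k :: 'a::metric_space set \<Rightarrow> ennreal" for k
proof
  show "hausdorff_outer k ({} :: 'a set) = 0" unfolding hausdorff_outer_def
    by (intro SUP_eq_const) (auto simp: hausdorff_pre_empty)
  show "hausdorff_outer k A \<le> hausdorff_outer k B" if "A \<subseteq> B" for A B :: "'a set"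
    unfolding hausdorff_outer_def by (intro SUP_mono) (use hausdorff_pre_mono[OF that] in auto)
  show "hausdorff_outer k (\<Union>i. A i) \<le> (\<Sum>i. hausdorff_outer k (A i))" for A :: "nat \<Rightarrow> 'a set"
    unfolding hausdorff_outer_def[of k "\<Union>i. A i"]
  proof (rule SUP_least)
    fix \<delta> :: real assume \<delta>: "\<delta> \<in> {0<..}"
    have "hausdorff_pre k \<delta> (\<Union>i. A i) \<le> (\<Sum>i. hausdorff_pre k \<delta> (A i))" by (rule hausdorff_pre_subadd)
    also have "\<dots> \<le> (\<Sum>i. hausdorff_outer k (A i))" using \<delta> by (intro suminf_le hausdorff_pre_le_outer) auto
    finally show "hausdorff_pre k \<delta> (\<Union>i. A i) \<le> (\<Sum>i. hausdorff_outer k (A i))" .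
  qed
  show "hausdorff_outer k A + hausdorff_outer k B \<le> hausdorff_outer k (A \<union> B)"
    if d: "d > 0" "\<And>a b. a \<in> A \<Longrightarrow> b \<in> B \<Longrightarrow> d \<le> dist a b" for A B :: "'a set" and d
  proof -
    \<comment> \<open>Both premeasures increase as the scale decreases, so the sum of the suprema is
      the supremum of the sums.\<close>
    have "hausdorff_outer k A + hausdorff_outer k B = (SUP \<delta>\<in>{0<..}. hausdorff_pre k \<delta> A + hausdorff_pre k \<delta> B)"
      unfolding hausdorff_outer_def
    proof (rule SUP_add_directed_ennreal[symmetric])
      fix i j :: real assume ij: "i \<in> {0<..}" "j \<in> {0<..}"
      show "\<exists>l\<in>{0<..}. hausdorff_pre k i A + hausdorff_pre k j B \<le> hausdorff_pre k l A + hausdorff_pre k l B"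
        by (rule bexI[of _ "min i j"]) (use ij in \<open>auto intro!: add_mono hausdorff_pre_antimono\<close>)
    qed
    also have "\<dots> \<le> hausdorff_outer k (A \<union> B)"
    proof (rule SUP_least)
      fix \<delta> :: real assume \<delta>: "\<delta> \<in> {0<..}"
      define \<delta>' where "\<delta>' = min \<delta> (d / 2)"
      have \<delta>': "0 < \<delta>'" "\<delta>' < d" "\<delta>' \<le> \<delta>" using \<delta> d by (auto simp: \<delta>'_def)
      have "hausdorff_pre k \<delta> A + hausdorff_pre k \<delta> B \<le> hausdorff_pre k \<delta>' A + hausdorff_pre k \<delta>' B"
        by (intro add_mono hausdorff_pre_antimono \<delta>')
      also have "\<dots> \<le> hausdorff_pre k \<delta>' (A \<union> B)" by (rule hausdorff_pre_metric[OF \<delta>'(1,2) d(2)])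
      also have "\<dots> \<le> hausdorff_outer k (A \<union> B)" by (rule hausdorff_pre_le_outer[OF \<delta>'(1)])
      finally show "hausdorff_pre k \<delta> A + hausdorff_pre k \<delta> B \<le> hausdorff_outer k (A \<union> B)" .
    qed
    finally show ?thesis .
  qed
qed

lemma sets_hausdorff_measure[simp, measurable_cong]: "sets (hausdorff_measure k :: 'a::metric_space measure) = sets borel"
proof -
  have "sigma_sets UNIV (sets (borel :: 'a measure)) = sets borel"
    using sets.sigma_sets_eq[of "borel :: 'a measure"] by simp
  then show ?thesis unfolding hausdorff_measure_def by (simp add: sets_measure_of)
qed

text \<open>\<open>measure_of\<close> falls back to the value 0 when its argument is not a measure;
  the Caratheodory argument excludes this default.\<close>

lemma emeasure_hausdorff_measure:
  fixes A :: "'a::metric_space set"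
  assumes "A \<in> sets borel" shows "emeasure (hausdorff_measure k) A = hausdorff_outer k A"
proof -
  have "measure_space UNIV (sets borel) (hausdorff_outer k :: 'a set \<Rightarrow> ennreal)" by (rule hausdorff.measure_space_borel)
  then have "positive (sets borel) (hausdorff_outer k :: 'a set \<Rightarrow> ennreal)" "countably_additive (sets borel) (hausdorff_outer k :: 'a set \<Rightarrow> ennreal)"
    by (auto simp: measure_space_def)
  then show ?thesis
    by (intro emeasure_measure_of[OF hausdorff_measure_def]) (use assms in \<open>auto simp: sets_hausdorff_measure\<close>)
qed

section \<open>The area of Lipschitz graphs\<close>

text \<open>For a unit vector \<open>n\<close> this is the orthogonal projection to the hyperplane
  orthogonal to \<open>n\<close>.\<close>

definition orth :: "'a::real_inner \<Rightarrow> 'a \<Rightarrow> 'a" where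
  "orth n v = v - (v \<bullet> n) *\<^sub>R n"

lemma orth_add: "orth n (v + w) = orth n v + orth n w"
  and orth_diff: "orth n (v - w) = orth n v - orth n w"
  and orth_scaleR: "orth n (c *\<^sub>R v) = c *\<^sub>R orth n v"
  by (simp_all add: orth_def inner_simps algebra_simps)

lemma orth_self: "norm n = 1 \<Longrightarrow> orth n n = 0"
  by (simp add: orth_def norm_eq_1)

lemma norm_orth_decomp: "norm n = 1 \<Longrightarrow> (norm v)\<^sup>2 = (norm (orth n v))\<^sup>2 + (v \<bullet> n)\<^sup>2"
  unfolding orth_def power2_norm_eq_inner
  by (simp add: inner_simps norm_eq_1 inner_commute[of n v] power2_eq_square)

lemma norm_orth_le: "norm n = 1 \<Longrightarrow> norm (orth n v) \<le> norm v"
  using norm_orth_decomp[of n v] power2_le_imp_le[of "norm (orth n v)" "norm v"] by simp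

text \<open>A function on the hyperplane orthogonal to \<open>n\<close> is encoded as a function on
  the whole space that is constant along \<open>n\<close>; this dispenses with a separate type or
  coordinates for the hyperplane.\<close>

locale lipschitz_graph =
  fixes n :: "'a::euclidean_space" and \<phi> :: "'a \<Rightarrow> real" and \<delta> :: real
  assumes n: "norm n = 1" and \<delta>: "0 \<le> \<delta>"
    and \<phi>_vertical: "\<And>y t. \<phi> (y + t *\<^sub>R n) = \<phi> y"
    and \<phi>_lipschitz': "\<And>y z. \<bar>\<phi> y - \<phi> z\<bar> \<le> \<delta> * norm (y - z)"
begin

definition height :: "'a \<Rightarrow> real" where "height y = y \<bullet> n - \<phi> y"
text \<open>The projection to the graph along \<open>n\<close>, not the nearest point. It makes
  \<open>height\<close> and \<open>foot\<close> exact coordinates under vertical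
  translation.\<close>

definition foot :: "'a \<Rightarrow> 'a" where "foot y = y - height y *\<^sub>R n"
definition graph :: "'a set" where "graph = {y. height y = 0}"
definition layer :: "'a set \<Rightarrow> real \<Rightarrow> real \<Rightarrow> 'a set" where
  "layer A a b = {y. foot y \<in> A \<and> a \<le> height y \<and> height y < b}"

lemma nn [simp]: "n \<bullet> n = 1" using n by (simp add: norm_eq_1)

lemma \<phi>_orth: "\<phi> (orth n y) = \<phi> y"
  using \<phi>_vertical[of y "- (y \<bullet> n)"] by (simp add: orth_def)

lemma \<phi>_lipschitz: "\<bar>\<phi> y - \<phi> z\<bar> \<le> \<delta> * norm (orth n (y - z))"
  using \<phi>_lipschitz'[of "orth n y" "orth n z"] by (simp add: \<phi>_orth orth_diff)

lemma continuous_\<phi>: "continuous_on UNIV \<phi>"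
  by (rule lipschitz_on_continuous_on[where L=\<delta>], rule lipschitz_onI)
    (use \<delta> \<phi>_lipschitz' in \<open>auto simp: dist_norm dist_real_def\<close>)

lemma continuous_height: "continuous_on UNIV height"
  unfolding height_def by (intro continuous_intros continuous_\<phi>)

lemma continuous_foot: "continuous_on UNIV foot"
  unfolding foot_def by (intro continuous_intros continuous_height)

lemma measurable_height [measurable]: "height \<in> borel_measurable borel"
  by (rule borel_measurable_continuous_onI[OF continuous_height])

lemma measurable_foot [measurable]: "foot \<in> borel_measurable borel"
  by (rule borel_measurable_continuous_onI[OF continuous_foot])

lemma height_vertical [simp]: "height (y + t *\<^sub>R n) = height y + t"
  by (simp add: height_def \<phi>_vertical inner_add_left)

lemma foot_vertical [simp]: "foot (y + t *\<^sub>R n) = foot y"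
  by (simp add: foot_def scaleR_add_left)

lemma foot_height: "foot y + height y *\<^sub>R n = y"
  by (simp add: foot_def)

lemma height_foot [simp]: "height (foot y) = 0"
  using height_vertical[of "foot y" "height y"] unfolding foot_height by simp

lemma foot_in_graph [simp]: "foot y \<in> graph"
  by (simp add: graph_def)

lemma foot_graph: "y \<in> graph \<Longrightarrow> foot y = y"
  by (simp add: graph_def foot_def)

lemma orth_foot: "orth n (foot y - foot z) = orth n (y - z)"
  by (simp add: foot_def orth_diff orth_scaleR orth_self n)

lemma foot_inner: "foot y \<bullet> n = \<phi> y"
  by (simp add: foot_def height_def inner_diff_left)

text \<open>Pythagoras: the horizontal displacement is unchanged, and the vertical one is at most
  \<delta> times as long.\<close>

lemma foot_lipschitz: "norm (foot y - foot z) \<le> sqrt (1 + \<delta>\<^sup>2) * norm (orth n (y - z))"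
proof -
  have "(norm (foot y - foot z))\<^sup>2 = (norm (orth n (y - z)))\<^sup>2 + \<bar>\<phi> y - \<phi> z\<bar>\<^sup>2"
    using norm_orth_decomp[OF n, of "foot y - foot z"] by (simp add: orth_foot inner_diff_left foot_inner)
  also have "\<dots> \<le> (norm (orth n (y - z)))\<^sup>2 + (\<delta> * norm (orth n (y - z)))\<^sup>2"
    using \<phi>_lipschitz by (intro add_left_mono power_mono) auto
  also have "\<dots> = (sqrt (1 + \<delta>\<^sup>2) * norm (orth n (y - z)))\<^sup>2"
    by (simp add: power_mult_distrib algebra_simps)
  finally show ?thesis by (rule power2_le_imp_le) simp
qed

section \<open>Projected area and the volumes of layers over a graph\<close>

lemma layer_borel [measurable]:
  assumes "A \<in> sets borel" shows "layer A a b \<in> sets borel"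
proof -
  have "foot -` A \<inter> height -` {a..<b} \<in> sets borel"
    using measurable_sets[OF measurable_foot assms] measurable_sets[OF measurable_height, of "{a..<b}"] by (auto intro!: sets.Int)
  moreover have "foot -` A \<inter> height -` {a..<b} = layer A a b" by (auto simp: layer_def)
  ultimately show ?thesis by simp
qed

text \<open>The area of the projection of a piece of the graph to the hyperplane orthogonal to \<open>n\<close>. It is measured as the
  volume of a layer of height 1, which avoids Lebesgue measure on hyperplanes.\<close>

definition area :: "'a measure" where
  "area = distr (density lborel (indicator {y. 0 \<le> height y \<and> height y < 1})) borel foot"

lemma sets_area [simp, measurable_cong]: "sets area = sets borel"
  and space_area [simp]: "space area = UNIV"
  by (simp_all add: area_def)

lemma emeasure_area:
  assumes "A \<in> sets borel" shows "emeasure area A = emeasure lborel (layer A 0 1)"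
proof -
  have "emeasure area A = emeasure (density lborel (indicator {y. 0 \<le> height y \<and> height y < 1})) (foot -` A)"
    unfolding area_def using assms by (subst emeasure_distr) auto
  also have "\<dots> = (\<integral>\<^sup>+ y. indicator {y. 0 \<le> height y \<and> height y < 1} y * indicator (foot -` A) y \<partial>lborel)"
    using measurable_sets[OF measurable_foot assms] by (intro emeasure_density) auto
  also have "\<dots> = (\<integral>\<^sup>+ y. indicator (layer A 0 1) y \<partial>lborel)"
    by (intro nn_integral_cong) (auto simp: indicator_def layer_def)
  also have "\<dots> = emeasure lborel (layer A 0 1)" using assms by (intro nn_integral_indicator) auto
  finally show ?thesis .
qed

text \<open>Both sides equal the integral over \<open>t\<close> of the volume of the unit layer over \<open>A\<close> that starts at height \<open>t\<close>,
  cut down to heights in \<open>[0, h)\<close>; translation by \<open>t n\<close> turns one computation into the other.\<close>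

lemma emeasure_layer_0:
  assumes A [measurable]: "A \<in> sets borel" and h: "h \<ge> 0"
  shows "emeasure lborel (layer A 0 h) = ennreal h * emeasure area A"
proof -
  define S where "S = {y. foot y \<in> A}"
  have S [measurable]: "S \<in> sets borel" unfolding S_def by measurable
  define f where "f y t = (indicator S y * indicator {0..<1} (height y - t) * indicator {0..<h} (height y) :: ennreal)" for y t
  have fm [measurable]: "(\<lambda>(y, t). f y t) \<in> borel_measurable (lborel \<Otimes>\<^sub>M lborel)" unfolding f_def by measurable
  have "emeasure lborel (layer A 0 h) = (\<integral>\<^sup>+ y. indicator (layer A 0 h) y \<partial>lborel)"
    by (intro nn_integral_indicator[symmetric]) auto
  also have "\<dots> = (\<integral>\<^sup>+ y. (\<integral>\<^sup>+ t. f y t \<partial>lborel) \<partial>lborel)"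
  proof (rule nn_integral_cong)
    fix y
    have "(\<integral>\<^sup>+ t. f y t \<partial>lborel) = (\<integral>\<^sup>+ t. indicator (layer A 0 h) y * indicator {height y - 1<..height y} t \<partial>lborel)"
      by (intro nn_integral_cong) (auto simp: f_def indicator_def layer_def S_def)
    also have "\<dots> = indicator (layer A 0 h) y" by (subst nn_integral_cmult) auto
    finally show "indicator (layer A 0 h) y = (\<integral>\<^sup>+ t. f y t \<partial>lborel)" by simp
  qed
  also have "\<dots> = (\<integral>\<^sup>+ t. (\<integral>\<^sup>+ y. f y t \<partial>lborel) \<partial>lborel)"
    by (rule lborel_pair.Fubini'[OF fm, symmetric])
  also have "\<dots> = (\<integral>\<^sup>+ t. (\<integral>\<^sup>+ y. f (t *\<^sub>R n + y) t \<partial>lborel) \<partial>lborel)"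
  proof (rule nn_integral_cong)
    fix t :: real
    have "(\<integral>\<^sup>+ y. f y t \<partial>lborel) = (\<integral>\<^sup>+ y. f y t \<partial>(distr lborel borel ((+) (t *\<^sub>R n))))"
      by (simp only: lborel_distr_plus)
    also have "\<dots> = (\<integral>\<^sup>+ y. f (t *\<^sub>R n + y) t \<partial>lborel)"
      by (rule nn_integral_distr) (auto simp: f_def)
    finally show "(\<integral>\<^sup>+ y. f y t \<partial>lborel) = (\<integral>\<^sup>+ y. f (t *\<^sub>R n + y) t \<partial>lborel)" .
  qed
  also have "\<dots> = (\<integral>\<^sup>+ y. (\<integral>\<^sup>+ t. f (t *\<^sub>R n + y) t \<partial>lborel) \<partial>lborel)"
    by (rule lborel_pair.Fubini') (unfold f_def, measurable)
  also have "\<dots> = (\<integral>\<^sup>+ y. ennreal h * indicator (layer A 0 1) y \<partial>lborel)"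
  proof (rule nn_integral_cong)
    fix y
    have "height (t *\<^sub>R n + y) = height y + t" "foot (t *\<^sub>R n + y) = foot y" for t
      using height_vertical[of y t] foot_vertical[of y t] by (simp_all only: add.commute)
    then have "(\<integral>\<^sup>+ t. f (t *\<^sub>R n + y) t \<partial>lborel) = (\<integral>\<^sup>+ t. indicator (layer A 0 1) y * indicator {- height y..<h - height y} t \<partial>lborel)"
      by (intro nn_integral_cong) (auto simp: f_def indicator_def layer_def S_def)
    also have "\<dots> = indicator (layer A 0 1) y * ennreal h" using h by (subst nn_integral_cmult) auto
    finally show "(\<integral>\<^sup>+ t. f (t *\<^sub>R n + y) t \<partial>lborel) = ennreal h * indicator (layer A 0 1) y" by (simp add: mult.commute)
  qed
  also have "\<dots> = ennreal h * emeasure area A"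
    by (subst nn_integral_cmult) (auto simp: nn_integral_indicator emeasure_area)
  finally show ?thesis .
qed

lemma emeasure_layer:
  assumes A: "A \<in> sets borel" and ab: "a \<le> b"
  shows "emeasure lborel (layer A a b) = ennreal (b - a) * emeasure area A"
proof -
  have "emeasure lborel (layer A a b) = emeasure (distr lborel borel ((+) (a *\<^sub>R n))) (layer A a b)"
    by (simp only: lborel_distr_plus)
  also have "\<dots> = emeasure lborel ((+) (a *\<^sub>R n) -` layer A a b)" using A by (subst emeasure_distr) auto
  also have "(+) (a *\<^sub>R n) -` layer A a b = layer A 0 (b - a)"
  proof -
    have "height (t *\<^sub>R n + y) = height y + t" "foot (t *\<^sub>R n + y) = foot y" for y t
      using height_vertical[of y t] foot_vertical[of y t] by (simp_all only: add.commute)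
    then show ?thesis by (auto simp: layer_def)
  qed
  finally show ?thesis using emeasure_layer_0[OF A, of "b - a"] ab by simp
qed

lemma emeasure_area_Int_graph:
  assumes "A \<in> sets borel" shows "emeasure area (A \<inter> graph) = emeasure area A"
proof -
  have "graph \<in> sets borel" unfolding graph_def by measurable
  moreover have "layer (A \<inter> graph) 0 1 = layer A 0 1" by (auto simp: layer_def)
  ultimately show ?thesis using assms by (simp add: emeasure_area)
qed

lemma borel_graph [measurable]: "graph \<in> sets borel"
  unfolding graph_def by measurable

lemma emeasure_area_bounded:
  assumes "A \<in> sets borel" "bounded A" shows "emeasure area A < \<infinity>"
proof -
  obtain R where R: "\<And>x. x \<in> A \<Longrightarrow> norm x \<le> R" using assms bounded_iff by metis
  have "norm y \<le> R + 1" if "y \<in> layer A 0 1" for y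
  proof -
    have "norm y \<le> norm (foot y) + norm (height y *\<^sub>R n)" using norm_triangle_ineq[of "foot y" "height y *\<^sub>R n"] by (simp add: foot_height)
    then show ?thesis using that R[of "foot y"] n by (auto simp: layer_def)
  qed
  then have "layer A 0 1 \<subseteq> cball 0 (R + 1)" by auto
  then have "emeasure lborel (layer A 0 1) \<le> emeasure lborel (cball (0::'a) (R + 1))" by (intro emeasure_mono) auto
  also have "\<dots> < \<infinity>" by (rule emeasure_lborel_cball_finite)
  finally show ?thesis using assms by (simp add: emeasure_area)
qed

text \<open>\<open>d\<close> is a vertical error that does not grow with the height \<open>h\<close>
  of a column. Division by \<open>h\<close> and \<open>h\<close> tending to infinity remove it,
  which turns volume bounds into bounds for the area of the base.\<close>

lemma ennreal_mult_le_limit: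
  fixes E :: ennreal
  assumes E: "E < \<infinity>" and c: "c \<ge> 0" and d: "d \<ge> 0" and le: "\<And>h. h > 0 \<Longrightarrow> ennreal h * E \<le> ennreal (c * (h + d))"
  shows "E \<le> ennreal c"
proof -
  define e where "e = enn2real E"
  have Ee: "E = ennreal e" "e \<ge> 0" using E by (auto simp: e_def less_top)
  have "e \<le> c * (1 + d / h)" if "h > 0" for h
  proof -
    have "ennreal (h * e) \<le> ennreal (c * (h + d))" using le[OF that] Ee that by (simp add: ennreal_mult)
    then have "h * e \<le> c * (h + d)" using c d that by (subst (asm) ennreal_le_iff) auto
    then show ?thesis using that by (simp add: field_simps)
  qed
  moreover have "((\<lambda>h. c * (1 + d / h)) \<longlongrightarrow> c * (1 + 0)) at_top"
    by (intro tendsto_intros tendsto_divide_0[OF tendsto_const] filterlim_at_top_imp_at_infinity filterlim_ident)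
  ultimately have "e \<le> c * (1 + 0)"
    by (intro tendsto_lowerbound[where F=at_top]) (auto intro!: eventually_at_top_linorderI[of 1])
  then show ?thesis using Ee by (simp add: ennreal_leI)
qed

text \<open>A column of height \<open>h\<close> over \<open>C\<close> has horizontal diameter at
  most \<open>d\<close> and vertical extent at most \<open>h + d\<close>, where \<open>d\<close> is
  the diameter of \<open>C\<close>. The isodiametric inequality for tall columns gives the sharp
  constant in one dimension less.\<close>

lemma emeasure_area_le_weight:
  assumes C: "compact C" shows "emeasure area C \<le> hausdorff_weight (DIM('a) - 1) C"
proof (cases "C = {}")
  case False
  have Cb: "C \<in> sets borel" "bounded C" using C by (auto simp: compact_imp_closed compact_imp_bounded)
  define d where "d = diameter C"
  have d: "d \<ge> 0" "\<And>x y. x \<in> C \<Longrightarrow> y \<in> C \<Longrightarrow> norm (x - y) \<le> d"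
    using diameter_ge_0[OF Cb(2)] diameter_bounded_bound[OF Cb(2)] by (auto simp: d_def dist_norm)
  define c where "c = unit_ball_vol (real (DIM('a) - 1)) * (d / 2) ^ (DIM('a) - 1)"
  have c: "c \<ge> 0" using d by (simp add: c_def)
  have "emeasure area C \<le> ennreal c"
  proof (rule ennreal_mult_le_limit[OF _ c d(1)])
    show "emeasure area C < \<infinity>" by (rule emeasure_area_bounded[OF Cb])
    fix h :: real assume h: "h > 0"
    \<comment> \<open>Unlike \<open>layer\<close>, it includes the upper end, so that it is
      compact.\<close>
    define X where "X = {y. foot y \<in> C \<and> 0 \<le> height y \<and> height y \<le> h}"
    have "closed (foot -` C)" using continuous_foot compact_imp_closed[OF C] continuous_on_closed_vimage[of UNIV foot] by auto
    moreover have "X = foot -` C \<inter> {y. 0 \<le> height y} \<inter> {y. height y \<le> h}" by (auto simp: X_def)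
    ultimately have clX: "closed X"
      by (auto intro!: closed_Int closed_Collect_le continuous_height)
    obtain R where R: "\<And>x. x \<in> C \<Longrightarrow> norm x \<le> R" using Cb bounded_iff by metis
    have "norm y \<le> R + h" if "y \<in> X" for y
    proof -
      have "norm y \<le> norm (foot y) + norm (height y *\<^sub>R n)" using norm_triangle_ineq[of "foot y" "height y *\<^sub>R n"] by (simp add: foot_height)
      then show ?thesis using that R[of "foot y"] n by (auto simp: X_def)
    qed
    then have "bounded X" unfolding bounded_iff by blast
    then have cX: "compact X" using clX by (simp add: compact_eq_bounded_closed)
    have "vol X \<le> unit_ball_vol (real (DIM('a) - 1)) * (d / 2) ^ (DIM('a) - 1) * (h + d)"
    proof (rule measure_le_isodiametric_compact[OF cX n d(1)])
      fix x y assume xy: "x \<in> X" "y \<in> X"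
      then have f: "norm (foot x - foot y) \<le> d" using d(2) by (auto simp: X_def)
      have "orth n (x - y) = orth n (foot x - foot y)" by (simp add: orth_foot)
      then show "norm (x - y - ((x - y) \<bullet> n) *\<^sub>R n) \<le> d"
        using norm_orth_le[OF n, of "foot x - foot y"] f unfolding orth_def by simp
      have "(x - y) \<bullet> n = (foot x - foot y) \<bullet> n + (height x - height y)"
        by (simp add: inner_diff_left foot_inner height_def)
      moreover have "\<bar>(foot x - foot y) \<bullet> n\<bar> \<le> d" using Cauchy_Schwarz_ineq2[of "foot x - foot y" n] f n by simp
      ultimately show "\<bar>(x - y) \<bullet> n\<bar> \<le> h + d" using xy by (auto simp: X_def)
    qed (use h d in auto)
    then have 1: "vol X \<le> c * (h + d)" by (simp add: c_def)
    have "ennreal h * emeasure area C = emeasure lborel (layer C 0 h)" using emeasure_layer_0[OF Cb(1)] h by simp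
    also have "\<dots> \<le> emeasure lborel X" using clX by (intro emeasure_mono) (auto simp: layer_def X_def)
    also have "\<dots> = ennreal (vol X)"
      by (rule emeasure_eq_ennreal_measure) (use emeasure_compact_finite[OF cX] in auto)
    also have "\<dots> \<le> ennreal (c * (h + d))" using 1 by (rule ennreal_leI)
    finally show "ennreal h * emeasure area C \<le> ennreal (c * (h + d))" .
  qed
  then show ?thesis using False by (simp add: hausdorff_weight_def c_def d_def)
qed (simp add: hausdorff_weight_def)

text \<open>The weight of a single covering set already bounds its area, whatever its size; hence
  the premeasure at scale 1 suffices. Passing to closures makes the covering sets compact and keeps
  their diameters.\<close>

theorem area_le_hausdorff:
  assumes A: "A \<in> sets borel"
  shows "emeasure area A \<le> hausdorff_outer (DIM('a) - 1) (A \<inter> graph)"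
proof -
  have "emeasure area (A \<inter> graph) \<le> hausdorff_pre (DIM('a) - 1) 1 (A \<inter> graph)"
    unfolding hausdorff_pre_def
  proof (rule INF_greatest)
    fix C :: "nat \<Rightarrow> 'a set"
    assume "C \<in> {C. A \<inter> graph \<subseteq> (\<Union>i. C i) \<and> (\<forall>i. bounded (C i) \<and> diameter (C i) \<le> 1)}"
    then have C: "A \<inter> graph \<subseteq> (\<Union>i. C i)" "\<And>i. bounded (C i)" by auto
    have "(\<Union>i. C i) \<subseteq> (\<Union>i. closure (C i))" by (intro UN_mono closure_subset order.refl)
    then have "A \<inter> graph \<subseteq> (\<Union>i. closure (C i))" using C(1) by (rule order.trans[rotated])
    then have "emeasure area (A \<inter> graph) \<le> emeasure area (\<Union>i. closure (C i))"
      by (rule emeasure_mono) (auto intro!: sets.countable_UN)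
    also have "\<dots> \<le> (\<Sum>i. emeasure area (closure (C i)))" by (rule emeasure_subadditive_countably) auto
    also have "\<dots> \<le> (\<Sum>i. hausdorff_weight (DIM('a) - 1) (C i))"
    proof (intro suminf_le allI)
      fix i
      have "emeasure area (closure (C i)) \<le> hausdorff_weight (DIM('a) - 1) (closure (C i))"
        using C(2) by (intro emeasure_area_le_weight) (simp add: compact_closure)
      moreover have "hausdorff_weight (DIM('a) - 1) (closure (C i)) = hausdorff_weight (DIM('a) - 1) (C i)"
        by (simp add: hausdorff_weight_def diameter_closure[OF C(2)])
      ultimately show "emeasure area (closure (C i)) \<le> hausdorff_weight (DIM('a) - 1) (C i)" by metis
    qed auto
    finally show "emeasure area (A \<inter> graph) \<le> (\<Sum>i. hausdorff_weight (DIM('a) - 1) (C i))" .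
  qed
  also have "\<dots> \<le> hausdorff_outer (DIM('a) - 1) (A \<inter> graph)" by (rule hausdorff_pre_le_outer) simp
  finally show ?thesis by (simp add: emeasure_area_Int_graph[OF A])
qed

end

section \<open>Hausdorff measure bounded by area: coverings of a graph by balls\<close>

lemma hausdorff_pre_UN_countable:
  assumes I: "countable I" and X: "\<And>i. i \<in> I \<Longrightarrow> bounded (X i)" "\<And>i. i \<in> I \<Longrightarrow> diameter (X i) \<le> \<delta>" and \<delta>: "\<delta> > 0"
  shows "hausdorff_pre k \<delta> (\<Union>i\<in>I. X i) \<le> (\<integral>\<^sup>+i. hausdorff_weight k (X i) \<partial>count_space I)"
proof -
  define J where "J = to_nat_on I ` I"
  define C where "C m = (if m \<in> J then X (from_nat_into I m) else {})" for m
  have fJ: "from_nat_into I m \<in> I" if "m \<in> J" for m using that I by (auto simp: J_def)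
  have "(\<Union>i\<in>I. X i) \<subseteq> (\<Union>m. C m)"
  proof
    fix x assume "x \<in> (\<Union>i\<in>I. X i)"
    then obtain i where i: "i \<in> I" "x \<in> X i" by blast
    then have "x \<in> C (to_nat_on I i)" using I by (auto simp: C_def J_def)
    then show "x \<in> (\<Union>m. C m)" by blast
  qed
  then have "hausdorff_pre k \<delta> (\<Union>i\<in>I. X i) \<le> (\<Sum>m. hausdorff_weight k (C m))"
  proof (rule hausdorff_pre_le)
    show "bounded (C m)" "diameter (C m) \<le> \<delta>" for m using X fJ \<delta> by (auto simp: C_def)
  qed
  also have "\<dots> = (\<integral>\<^sup>+m. hausdorff_weight k (C m) \<partial>count_space UNIV)" by (rule nn_integral_count_space_nat[symmetric])
  also have "\<dots> = (\<integral>\<^sup>+m. hausdorff_weight k (X (from_nat_into I m)) * indicator J m \<partial>count_space UNIV)"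
    by (intro nn_integral_cong) (auto simp: C_def indicator_def hausdorff_weight_def)
  also have "\<dots> = (\<integral>\<^sup>+m. hausdorff_weight k (X (from_nat_into I m)) \<partial>count_space J)"
    by (rule nn_integral_count_space_indicator[symmetric]) simp
  also have "\<dots> = (\<integral>\<^sup>+i. hausdorff_weight k (X (from_nat_into I (to_nat_on I i))) \<partial>count_space I)"
    by (rule nn_integral_bij_count_space[symmetric]) (simp add: J_def bij_betw_def inj_on_to_nat_on I)
  also have "\<dots> = (\<integral>\<^sup>+i. hausdorff_weight k (X i) \<partial>count_space I)"
    by (intro nn_integral_cong) (use I in auto)
  finally show ?thesis .
qed

lemma hausdorff_weight_cball:
  fixes z :: "'a::euclidean_space"
  assumes "r \<ge> 0" shows "hausdorff_weight k (cball z r) \<le> ennreal (unit_ball_vol (real k) * r ^ k)"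
proof -
  have "diameter (cball z r) \<le> 2 * r"
  proof (rule diameter_le)
    fix x y assume "x \<in> cball z r" "y \<in> cball z r"
    then show "norm (x - y) \<le> 2 * r" using dist_triangle2[of x y z] by (simp add: dist_norm norm_minus_commute)
  qed (use assms in auto)
  moreover have "0 \<le> diameter (cball z r)" by (intro diameter_ge_0) auto
  ultimately show ?thesis
    by (auto simp: hausdorff_weight_def intro!: ennreal_leI mult_left_mono power_mono)
qed

lemma emeasure_UN_countable_le:
  assumes "countable I" "\<And>i. i \<in> I \<Longrightarrow> X i \<in> sets M"
  shows "emeasure M (\<Union>i\<in>I. X i) \<le> (\<integral>\<^sup>+i. emeasure M (X i) \<partial>count_space I)"
proof -
  have "emeasure M (\<Union>i\<in>I. X i) = (\<integral>\<^sup>+x. indicator (\<Union>i\<in>I. X i) x \<partial>M)"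
    using assms by (intro nn_integral_indicator[symmetric] sets.countable_UN') auto
  also have "\<dots> \<le> (\<integral>\<^sup>+x. (\<integral>\<^sup>+i. indicator (X i) x \<partial>count_space I) \<partial>M)"
  proof (rule nn_integral_mono)
    fix x
    show "indicator (\<Union>i\<in>I. X i) x \<le> (\<integral>\<^sup>+i. indicator (X i) x \<partial>count_space I)"
    proof (cases "x \<in> (\<Union>i\<in>I. X i)")
      case True
      then obtain j where j: "j \<in> I" "x \<in> X j" by blast
      have "1 = (\<integral>\<^sup>+i. indicator {j} i \<partial>count_space I)" using j by (simp add: nn_integral_indicator)
      also have "\<dots> \<le> (\<integral>\<^sup>+i. indicator (X i) x \<partial>count_space I)"
        using j by (intro nn_integral_mono) (auto simp: indicator_def)
      finally show ?thesis using True by simp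
    qed simp
  qed
  also have "\<dots> = (\<integral>\<^sup>+i. (\<integral>\<^sup>+x. indicator (X i) x \<partial>M) \<partial>count_space I)"
    using assms by (intro nn_integral_count_space_nn_integral) auto
  also have "\<dots> = (\<integral>\<^sup>+i. emeasure M (X i) \<partial>count_space I)"
    using assms by (intro nn_integral_cong nn_integral_indicator) auto
  finally show ?thesis .
qed

text \<open>The argument only carries the type.\<close>

definition hyperplane_dim :: "'a::euclidean_space \<Rightarrow> nat" where
  "hyperplane_dim _ = DIM('a) - 1"

context lipschitz_graph begin

abbreviation "k \<equiv> hyperplane_dim n"
text \<open>The lift from the hyperplane to the graph has Lipschitz constant
  \<open>sqrt (1 + \<delta>\<^sup>2)\<close> by \<open>foot_lipschitz\<close>, so it enlarges
  measure in dimension \<open>k\<close> at most by this power. It tends to 1 with \<delta>.\<close>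

definition \<kappa> :: real where "\<kappa> = sqrt (1 + \<delta>\<^sup>2) ^ k"
definition tube :: "'a \<Rightarrow> real \<Rightarrow> 'a set" where "tube z r = {w. norm (orth n (w - z)) \<le> r}"

lemma \<kappa>_ge_1: "\<kappa> \<ge> 1"
  unfolding \<kappa>_def by (rule one_le_power) simp

lemma borel_tube [simp]: "tube z r \<in> sets borel"
proof -
  have "closed (tube z r)" unfolding tube_def orth_def by (intro closed_Collect_le continuous_intros)
  then show ?thesis by (rule borel_closed)
qed

lemma cylinder_orth: "v \<in> cylinder n r h \<longleftrightarrow> norm (orth n v) \<le> r \<and> \<bar>v \<bullet> n\<bar> \<le> h"
  by (simp add: cylinder_def orth_def)

lemma emeasure_shifted_cylinder:
  assumes "r > 0" "h \<ge> 0"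
  shows "emeasure lborel ((\<lambda>y. y - c) -` cylinder n r h) = ennreal (unit_ball_vol (real k) * r ^ k * (2 * h))"
proof -
  have "emeasure lborel (cylinder n r h) = emeasure (distr lborel borel ((+) (- c))) (cylinder n r h)"
    by (simp only: lborel_distr_plus)
  also have "\<dots> = emeasure lborel ((+) (- c) -` cylinder n r h)"
    by (subst emeasure_distr) (auto intro!: borel_closed closed_cylinder)
  also have "(+) (- c) -` cylinder n r h = (\<lambda>y. y - c) -` cylinder n r h" by auto
  finally show ?thesis using emeasure_cylinder[OF n assms] by (simp add: hyperplane_dim_def)
qed

lemma layer_tube_bounds:
  assumes z: "z \<in> graph" and y: "norm (orth n (y - z)) \<le> r"
  shows "\<bar>(y - z) \<bullet> n - height y\<bar> \<le> \<delta> * r"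
proof -
  have "(y - z) \<bullet> n - height y = \<phi> y - \<phi> z"
    using z by (simp add: graph_def height_def inner_diff_left)
  moreover have "\<bar>\<phi> y - \<phi> z\<bar> \<le> \<delta> * norm (orth n (y - z))" by (rule \<phi>_lipschitz)
  moreover have "\<dots> \<le> \<delta> * r" using y \<delta> by (rule mult_left_mono)
  ultimately show ?thesis by simp
qed

lemma foot_tube: "foot y \<in> tube z r \<longleftrightarrow> norm (orth n (y - z)) \<le> r"
proof -
  have "orth n (foot y - z) = orth n (y - z)"
    by (simp add: foot_def orth_diff orth_scaleR orth_self n)
  then show ?thesis by (simp add: tube_def)
qed

text \<open>Over a tube of radius \<open>r\<close> the graph deviates from its tangent-like
  hyperplane through \<open>z\<close> by at most \<delta> \<open>r\<close>, so the layer fits into a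
  cylinder that is only \<open>2 * (\<delta> * r)\<close> taller. This error disappears for tall
  layers.\<close>

lemma area_tube_le:
  assumes z: "z \<in> graph" and r: "r > 0"
  shows "emeasure area (tube z r) \<le> ennreal (unit_ball_vol (real k) * r ^ k)"
proof -
  define c where "c = unit_ball_vol (real k) * r ^ k"
  have c: "c \<ge> 0" using r by (simp add: c_def)
  have le: "ennreal h * emeasure area (tube z r) \<le> ennreal (c * (h + 2 * (\<delta> * r)))" if h: "h > 0" for h
  proof -
    have "ennreal h * emeasure area (tube z r) = emeasure lborel (layer (tube z r) 0 h)"
      using emeasure_layer_0[of "tube z r" h] h by simp
    also have "\<dots> \<le> emeasure lborel ((\<lambda>y. y - (z + (h / 2) *\<^sub>R n)) -` cylinder n r (h / 2 + \<delta> * r))"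
    proof (rule emeasure_mono)
      show "layer (tube z r) 0 h \<subseteq> (\<lambda>y. y - (z + (h / 2) *\<^sub>R n)) -` cylinder n r (h / 2 + \<delta> * r)"
      proof
        fix y assume "y \<in> layer (tube z r) 0 h"
        then have y: "norm (orth n (y - z)) \<le> r" "0 \<le> height y" "height y < h" by (auto simp: layer_def foot_tube)
        have "orth n (y - (z + (h / 2) *\<^sub>R n)) = orth n (y - z)"
          by (simp add: orth_diff orth_add orth_scaleR orth_self n)
        moreover have "(y - (z + (h / 2) *\<^sub>R n)) \<bullet> n = (y - z) \<bullet> n - h / 2" by (simp add: inner_simps)
        ultimately show "y \<in> (\<lambda>y. y - (z + (h / 2) *\<^sub>R n)) -` cylinder n r (h / 2 + \<delta> * r)"
          using y layer_tube_bounds[OF z y(1)] by (simp add: cylinder_orth abs_le_iff)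
      qed
      have "closed ((\<lambda>y. y - (z + (h / 2) *\<^sub>R n)) -` cylinder n r (h / 2 + \<delta> * r))"
        by (intro closed_vimage closed_cylinder continuous_intros)
      then show "(\<lambda>y. y - (z + (h / 2) *\<^sub>R n)) -` cylinder n r (h / 2 + \<delta> * r) \<in> sets lborel" by simp
    qed
    also have "\<dots> = ennreal (c * (h + 2 * (\<delta> * r)))"
      using r h \<delta> by (subst emeasure_shifted_cylinder) (auto simp: c_def algebra_simps)
    finally show ?thesis .
  qed
  have "emeasure area (tube z r) < \<infinity>"
  proof -
    have "emeasure area (tube z r) \<le> ennreal (c * (1 + 2 * (\<delta> * r)))" using le[of 1] by simp
    also have "\<dots> < \<infinity>" by simp
    finally show ?thesis .
  qed
  then show ?thesis unfolding c_def[symmetric]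
    by (rule ennreal_mult_le_limit[where d="2 * (\<delta> * r)"]) (use c le \<delta> r in auto)
qed

lemma area_tube_ge:
  assumes z: "z \<in> graph" and r: "r > 0"
  shows "ennreal (unit_ball_vol (real k) * r ^ k) \<le> emeasure area (tube z r)"
proof -
  define c where "c = unit_ball_vol (real k) * r ^ k"
  have c: "c \<ge> 0" using r by (simp add: c_def)
  define e where "e = enn2real (emeasure area (tube z r))"
  have "emeasure area (tube z r) < \<infinity>" using area_tube_le[OF z r] by (rule le_less_trans) simp
  then have e: "emeasure area (tube z r) = ennreal e" "e \<ge> 0" by (auto simp: e_def less_top)
  \<comment> \<open>The inscribed cylinder is shortened by 1 more at each end, which keeps it
    strictly below the open upper end of the layer; the limit in \<open>h\<close> absorbs the
    loss.\<close>
  have le: "c * (1 - (2 * (\<delta> * r) + 2) / h) \<le> e" if h: "h > 2 * (\<delta> * r) + 2" for h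
  proof -
    have h0: "h > 0" using h \<delta> r by (smt (verit) mult_nonneg_nonneg)
    have "ennreal (c * (h - 2 * (\<delta> * r) - 2)) = emeasure lborel ((\<lambda>y. y - (z + (h / 2) *\<^sub>R n)) -` cylinder n r (h / 2 - \<delta> * r - 1))"
      using r h by (subst emeasure_shifted_cylinder) (auto simp: c_def algebra_simps)
    also have "\<dots> \<le> emeasure lborel (layer (tube z r) 0 h)"
    proof (rule emeasure_mono)
      show "(\<lambda>y. y - (z + (h / 2) *\<^sub>R n)) -` cylinder n r (h / 2 - \<delta> * r - 1) \<subseteq> layer (tube z r) 0 h"
      proof
        fix y assume y: "y \<in> (\<lambda>y. y - (z + (h / 2) *\<^sub>R n)) -` cylinder n r (h / 2 - \<delta> * r - 1)"
        have "orth n (y - (z + (h / 2) *\<^sub>R n)) = orth n (y - z)"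
          by (simp add: orth_diff orth_add orth_scaleR orth_self n)
        moreover have "(y - (z + (h / 2) *\<^sub>R n)) \<bullet> n = (y - z) \<bullet> n - h / 2" by (simp add: inner_simps)
        ultimately have y: "norm (orth n (y - z)) \<le> r" "\<bar>(y - z) \<bullet> n - h / 2\<bar> \<le> h / 2 - \<delta> * r - 1"
          using y by (simp_all add: cylinder_orth)
        then show "y \<in> layer (tube z r) 0 h"
          using layer_tube_bounds[OF z y(1)] by (auto simp: layer_def foot_tube abs_le_iff)
      qed
    qed (simp add: layer_borel)
    also have "\<dots> = ennreal (h * e)" using emeasure_layer_0[of "tube z r" h] h0 e by (simp add: ennreal_mult)
    finally have "c * (h - 2 * (\<delta> * r) - 2) \<le> h * e" using h0 e by (simp add: ennreal_le_iff)
    then show ?thesis using h0 by (simp add: field_simps)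
  qed
  have "((\<lambda>h. c * (1 - (2 * (\<delta> * r) + 2) / h)) \<longlongrightarrow> c * (1 - 0)) at_top"
    by (intro tendsto_intros tendsto_divide_0[OF tendsto_const] filterlim_at_top_imp_at_infinity filterlim_ident)
  then have "c * (1 - 0) \<le> e"
    by (rule tendsto_upperbound) (auto intro!: eventually_mono[OF eventually_gt_at_top[of "2 * (\<delta> * r) + 2"]] le)
  then show ?thesis using e by (simp add: c_def ennreal_leI)
qed

lemma area_cball_le:
  assumes "z \<in> graph" "r > 0"
  shows "emeasure area (cball z r) \<le> ennreal (unit_ball_vol (real k) * r ^ k)"
proof -
  have "cball z r \<subseteq> tube z r"
  proof
    fix w assume "w \<in> cball z r"
    then show "w \<in> tube z r"
      using norm_orth_le[OF n, of "w - z"] by (simp add: tube_def dist_norm norm_minus_commute)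
  qed
  then have "emeasure area (cball z r) \<le> emeasure area (tube z r)" by (intro emeasure_mono) auto
  then show ?thesis using area_tube_le[OF assms] by (rule order.trans)
qed

lemma area_cball_ge:
  assumes z: "z \<in> graph" and r: "r > 0"
  shows "ennreal (unit_ball_vol (real k) * r ^ k) \<le> ennreal \<kappa> * emeasure area (cball z r)"
proof -
  define q where "q = sqrt (1 + \<delta>\<^sup>2)"
  have q: "q > 0" unfolding q_def by (simp add: add_pos_nonneg)
  have rq: "r / q > 0" using r q by simp
  \<comment> \<open>Points of the graph are at most \<open>q\<close> times as far from
    \<open>z\<close> as their projections. Shrinking the tube by \<open>q\<close> costs the factor
    \<open>q ^ k\<close>, which is \<kappa>.\<close>
  have "tube z (r / q) \<inter> graph \<subseteq> cball z r"
  proof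
    fix w assume w: "w \<in> tube z (r / q) \<inter> graph"
    have "norm (w - z) \<le> q * norm (orth n (w - z))"
      using foot_lipschitz[of w z] w z foot_graph by (simp add: q_def)
    also have "\<dots> \<le> q * (r / q)" using w q by (intro mult_left_mono) (auto simp: tube_def)
    also have "\<dots> = r" using q by simp
    finally show "w \<in> cball z r" by (simp add: dist_norm norm_minus_commute)
  qed
  then have "emeasure area (tube z (r / q) \<inter> graph) \<le> emeasure area (cball z r)" by (intro emeasure_mono) auto
  then have "ennreal (unit_ball_vol (real k) * (r / q) ^ k) \<le> emeasure area (cball z r)"
    using area_tube_ge[OF z rq] emeasure_area_Int_graph[of "tube z (r / q)"] by simp
  then have "ennreal \<kappa> * ennreal (unit_ball_vol (real k) * (r / q) ^ k) \<le> ennreal \<kappa> * emeasure area (cball z r)"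
    by (intro mult_left_mono) auto
  moreover have "ennreal \<kappa> * ennreal (unit_ball_vol (real k) * (r / q) ^ k) = ennreal (unit_ball_vol (real k) * r ^ k)"
    using q r \<kappa>_ge_1 by (subst ennreal_mult[symmetric]) (auto simp: \<kappa>_def q_def[symmetric] power_divide)
  ultimately show ?thesis by simp
qed

lemma ball_quintuple_le:
  assumes z: "z \<in> graph" and r: "r > 0"
  shows "ennreal (unit_ball_vol (real k) * (5 * r) ^ k) \<le> ennreal (5 ^ k * \<kappa>) * emeasure area (cball z r)"
proof -
  have "ennreal (unit_ball_vol (real k) * (5 * r) ^ k) = ennreal (5 ^ k) * ennreal (unit_ball_vol (real k) * r ^ k)"
    using r by (subst ennreal_mult[symmetric]) (auto simp: power_mult_distrib algebra_simps)
  also have "\<dots> \<le> ennreal (5 ^ k) * (ennreal \<kappa> * emeasure area (cball z r))"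
    by (intro mult_left_mono area_cball_ge z r) auto
  also have "\<dots> = ennreal (5 ^ k * \<kappa>) * emeasure area (cball z r)"
    using \<kappa>_ge_1 by (simp add: ennreal_mult mult.assoc)
  finally show ?thesis .
qed

lemma area_cball_doubling:
  assumes "z \<in> graph" "r > 0"
  shows "emeasure area (cball z (5 * r)) \<le> ennreal (5 ^ k * \<kappa>) * emeasure area (cball z r)"
  using area_cball_le[of z "5 * r"] ball_quintuple_le[OF assms] assms by (auto intro: order.trans)

lemma Vitali_graph:
  assumes G: "open G" "bounded G" and s: "s > 0"
  obtains C where "countable C" "\<forall>i\<in>C. fst i \<in> graph \<and> 0 < snd i \<and> 10 * snd i \<le> s \<and> cball (fst i) (snd i) \<subseteq> G"
    "disjoint_family_on (\<lambda>i. cball (fst i) (snd i)) C"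
    "G \<inter> graph \<subseteq> (\<Union>i\<in>C. cball (fst i) (5 * snd i))"
proof -
  \<comment> \<open>The factor 10 makes the fivefold enlargements have diameter at most
    \<open>s\<close>, so they are admissible at scale \<open>s\<close>.\<close>
  define K where "K = {i :: 'a \<times> real. fst i \<in> graph \<and> 0 < snd i \<and> 10 * snd i \<le> s \<and> cball (fst i) (snd i) \<subseteq> G}"
  have "G \<inter> graph \<subseteq> (\<Union>i\<in>K. cball (fst i) (snd i))"
  proof
    fix z assume z: "z \<in> G \<inter> graph"
    then obtain e where e: "e > 0" "cball z e \<subseteq> G" using G open_contains_cball by blast
    have "(z, min e (s / 10)) \<in> K" using z e s by (auto simp: K_def)
    moreover have "z \<in> cball (fst (z, min e (s / 10))) (snd (z, min e (s / 10)))" using e s by auto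
    ultimately show "z \<in> (\<Union>i\<in>K. cball (fst i) (snd i))" by blast
  qed
  then obtain C where C: "countable C" "C \<subseteq> K" "pairwise (\<lambda>i j. disjnt (cball (fst i) (snd i)) (cball (fst j) (snd j))) C"
    "G \<inter> graph \<subseteq> (\<Union>i\<in>C. cball (fst i) (5 * snd i))"
    by (rule Vitali_covering_lemma_cballs[where K=K and a=fst and r=snd and B=s]) (use s in \<open>auto simp: K_def\<close>)
  show thesis
  proof (rule that[OF C(1) _ _ C(4)])
    show "disjoint_family_on (\<lambda>i. cball (fst i) (snd i)) C"
      using C(3) by (auto simp: disjoint_family_on_def pairwise_def disjnt_def)
    show "\<forall>i\<in>C. fst i \<in> graph \<and> 0 < snd i \<and> 10 * snd i \<le> s \<and> cball (fst i) (snd i) \<subseteq> G"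
      using C(2) by (auto simp: K_def)
  qed
qed

text \<open>\<open>B\<close> is the union of the disjoint Vitali balls. Covered by these very balls
  it has the good ratio \<kappa>, and by the fivefold enlargement it carries a fixed proportion of
  the area of \<open>G\<close>, independent of \<open>s\<close>.\<close>

lemma Vitali_graph_covered:
  assumes G: "open G" "bounded G" and s: "s > 0"
  obtains B where "B \<in> sets borel" "B \<subseteq> G" "hausdorff_pre k s B \<le> ennreal \<kappa> * emeasure area B"
    "emeasure area G \<le> ennreal (5 ^ k * \<kappa>) * emeasure area B"
    "hausdorff_pre k s (G \<inter> graph) \<le> ennreal (5 ^ k * \<kappa>) * emeasure area B"
proof -
  obtain C where C: "countable C" "\<forall>i\<in>C. fst i \<in> graph \<and> 0 < snd i \<and> 10 * snd i \<le> s \<and> cball (fst i) (snd i) \<subseteq> G"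
    "disjoint_family_on (\<lambda>i. cball (fst i) (snd i)) C"
    "G \<inter> graph \<subseteq> (\<Union>i\<in>C. cball (fst i) (5 * snd i))"
    by (rule Vitali_graph[OF G s])
  define B where "B = (\<Union>i\<in>C. cball (fst i) (snd i))"
  have area_B: "(\<integral>\<^sup>+i. ennreal c * emeasure area (cball (fst i) (snd i)) \<partial>count_space C) = ennreal c * emeasure area B" for c
    unfolding B_def by (subst nn_integral_cmult, simp, subst emeasure_UN_countable[OF _ C(1,3)]) simp_all
  have weight: "hausdorff_weight k (cball (fst i) (snd i)) \<le> ennreal \<kappa> * emeasure area (cball (fst i) (snd i))"
    "hausdorff_weight k (cball (fst i) (5 * snd i)) \<le> ennreal (5 ^ k * \<kappa>) * emeasure area (cball (fst i) (snd i))"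
    if "i \<in> C" for i
  proof -
    have i: "fst i \<in> graph" "0 < snd i" using C(2) that by auto
    show "hausdorff_weight k (cball (fst i) (snd i)) \<le> ennreal \<kappa> * emeasure area (cball (fst i) (snd i))"
      using hausdorff_weight_cball[of "snd i" k "fst i"] area_cball_ge[OF i] i by (auto intro: order.trans)
    show "hausdorff_weight k (cball (fst i) (5 * snd i)) \<le> ennreal (5 ^ k * \<kappa>) * emeasure area (cball (fst i) (snd i))"
      using hausdorff_weight_cball[of "5 * snd i" k "fst i"] ball_quintuple_le[OF i] i by (auto intro: order.trans)
  qed
  show thesis
  proof (rule that)
    show "B \<in> sets borel" unfolding B_def using C(1) by (intro sets.countable_UN') auto
    show "B \<subseteq> G" unfolding B_def using C(2) by blast
    have "hausdorff_pre k s B \<le> (\<integral>\<^sup>+i. hausdorff_weight k (cball (fst i) (snd i)) \<partial>count_space C)"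
      unfolding B_def by (rule hausdorff_pre_UN_countable[OF C(1) _ _ s]) (use C(2) in \<open>fastforce simp: diameter_cball\<close>)+
    also have "\<dots> \<le> (\<integral>\<^sup>+i. ennreal \<kappa> * emeasure area (cball (fst i) (snd i)) \<partial>count_space C)"
      using weight(1) by (intro nn_integral_mono) auto
    finally show "hausdorff_pre k s B \<le> ennreal \<kappa> * emeasure area B" unfolding area_B .
    have "hausdorff_pre k s (G \<inter> graph) \<le> hausdorff_pre k s (\<Union>i\<in>C. cball (fst i) (5 * snd i))"
      by (rule hausdorff_pre_mono[OF C(4)])
    also have "\<dots> \<le> (\<integral>\<^sup>+i. hausdorff_weight k (cball (fst i) (5 * snd i)) \<partial>count_space C)"
      by (rule hausdorff_pre_UN_countable[OF C(1) _ _ s]) (use C(2) in \<open>fastforce simp: diameter_cball\<close>)+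
    also have "\<dots> \<le> (\<integral>\<^sup>+i. ennreal (5 ^ k * \<kappa>) * emeasure area (cball (fst i) (snd i)) \<partial>count_space C)"
      using weight(2) by (intro nn_integral_mono) auto
    finally show "hausdorff_pre k s (G \<inter> graph) \<le> ennreal (5 ^ k * \<kappa>) * emeasure area B" unfolding area_B .
    have "emeasure area G = emeasure area (G \<inter> graph)" using G by (simp add: emeasure_area_Int_graph)
    also have "\<dots> \<le> emeasure area (\<Union>i\<in>C. cball (fst i) (5 * snd i))"
      using C(1,4) by (intro emeasure_mono) (auto intro!: sets.countable_UN')
    also have "\<dots> \<le> (\<integral>\<^sup>+i. emeasure area (cball (fst i) (5 * snd i)) \<partial>count_space C)"
      by (rule emeasure_UN_countable_le) (use C(1) in auto)
    also have "\<dots> \<le> (\<integral>\<^sup>+i. ennreal (5 ^ k * \<kappa>) * emeasure area (cball (fst i) (snd i)) \<partial>count_space C)"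
      by (intro nn_integral_mono area_cball_doubling) (use C(2) in auto)
    finally show "emeasure area G \<le> ennreal (5 ^ k * \<kappa>) * emeasure area B" unfolding area_B .
  qed
qed

text \<open>The starting point of the iteration: the enlarged balls cover, while the original ones
  are disjoint inside \<open>G\<close>. The constant does not depend on the scale.\<close>

lemma hausdorff_open_crude:
  assumes G: "open G" "bounded G"
  shows "hausdorff_outer k (G \<inter> graph) \<le> ennreal (5 ^ k * \<kappa>) * emeasure area G"
  unfolding hausdorff_outer_def
proof (rule SUP_least)
  fix s :: real assume "s \<in> {0<..}"
  then obtain B where B: "B \<subseteq> G" "hausdorff_pre k s (G \<inter> graph) \<le> ennreal (5 ^ k * \<kappa>) * emeasure area B"
    using Vitali_graph_covered[OF G, of s] by auto
  have "emeasure area B \<le> emeasure area G" using B(1) G by (intro emeasure_mono) auto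
  then show "hausdorff_pre k s (G \<inter> graph) \<le> ennreal (5 ^ k * \<kappa>) * emeasure area G"
    by (intro order.trans[OF B(2)] mult_left_mono) auto
qed

text \<open>Outer regularity of area, which is restricted to a ball in order to have a finite
  measure.\<close>

lemma hausdorff_le_area_open_imp_borel:
  assumes op: "\<And>G. open G \<Longrightarrow> bounded G \<Longrightarrow> hausdorff_outer k (G \<inter> graph) \<le> ennreal c * emeasure area G"
    and c: "c \<ge> 0" and E: "E \<in> sets borel" "bounded E"
  shows "hausdorff_outer k (E \<inter> graph) \<le> ennreal c * emeasure area E"
proof -
  obtain R where R: "R > 0" "E \<subseteq> ball 0 R" using bounded_subset_ballD[OF E(2), of 0] by blast
  define M where "M = density area (indicator (ball 0 R))"
  have M: "emeasure M A = emeasure area (A \<inter> ball 0 R)" if "A \<in> sets borel" for A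
    unfolding M_def using that borel_measurable_indicator[of "ball 0 R" area]
    by (subst emeasure_density) (auto simp: nn_integral_indicator[symmetric] indicator_inter_arith mult.commute intro!: nn_integral_cong)
  have "emeasure M (space M) \<noteq> \<infinity>"
    using M[of UNIV] emeasure_area_bounded[of "ball 0 R"] by (simp add: M_def)
  then have inf: "emeasure M E = (INF U \<in> {U. E \<subseteq> U \<and> open U}. emeasure M U)"
    by (intro outer_regular) (auto simp: M_def E)
  have ME: "emeasure M E = emeasure area E" using M[OF E(1)] R by (simp add: Int_absorb2)
  have le: "hausdorff_outer k (E \<inter> graph) \<le> ennreal c * emeasure M U" if U: "E \<subseteq> U" "open U" for U
  proof -
    have "hausdorff_outer k (E \<inter> graph) \<le> hausdorff_outer k ((U \<inter> ball 0 R) \<inter> graph)"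
      using U R by (intro hausdorff.mono) auto
    also have "\<dots> \<le> ennreal c * emeasure area (U \<inter> ball 0 R)" using U by (intro op) (auto simp: bounded_Int)
    finally show ?thesis using M[of U] U by simp
  qed
  show ?thesis
  proof (rule ennreal_le_epsilon)
    fix e :: real assume e: "0 < e"
    \<comment> \<open>The summand 1 covers the case \<open>c = 0\<close>.\<close>
    define e' where "e' = e / (c + 1)"
    have e': "e' > 0" "c * e' \<le> e" using e c by (auto simp: e'_def field_simps)
    have "emeasure M E \<noteq> \<infinity>" using ME emeasure_area_bounded[OF E] by simp
    then obtain U where U: "E \<subseteq> U" "open U" "emeasure M U < emeasure M E + e'"
      using INF_approx_ennreal[OF e'(1) inf] by auto
    have "hausdorff_outer k (E \<inter> graph) \<le> ennreal c * emeasure M U" by (rule le[OF U(1,2)])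
    also have "\<dots> \<le> ennreal c * (emeasure M E + e')" using U(3) by (intro mult_left_mono) auto
    also have "\<dots> = ennreal c * emeasure M E + ennreal (c * e')"
      using c e' by (simp add: distrib_left ennreal_mult)
    also have "\<dots> \<le> ennreal c * emeasure M E + ennreal e" using e' by (intro add_left_mono ennreal_leI)
    finally show "hausdorff_outer k (E \<inter> graph) \<le> ennreal c * emeasure area E + ennreal e" unfolding ME .
  qed
qed

text \<open>A bound \<open>c\<close> for the ratio of Hausdorff measure to area improves to a convex combination of \<open>c\<close> and \<open>\<kappa>\<close>,
  since small balls realise the ratio \<open>\<kappa>\<close> on a fixed proportion of every open set. Iteration drives the bound to \<open>\<kappa>\<close>.\<close>

lemma hausdorff_open_improve:
  defines "d \<equiv> 5 ^ k * \<kappa>"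
  assumes c: "c \<ge> \<kappa>"
    and bd: "\<And>E. E \<in> sets borel \<Longrightarrow> bounded E \<Longrightarrow> hausdorff_outer k (E \<inter> graph) \<le> ennreal c * emeasure area E"
    and G: "open G" "bounded G"
  shows "hausdorff_outer k (G \<inter> graph) \<le> ennreal (\<kappa> / d + c * (1 - 1 / d)) * emeasure area G"
  unfolding hausdorff_outer_def
proof (rule SUP_least)
  fix s :: real assume "s \<in> {0<..}"
  then have s: "s > 0" by simp
  obtain B where B [measurable]: "B \<in> sets borel" and BG: "B \<subseteq> G"
    and HB: "hausdorff_pre k s B \<le> ennreal \<kappa> * emeasure area B" and GB: "emeasure area G \<le> ennreal d * emeasure area B"
    unfolding d_def using Vitali_graph_covered[OF G s] by metis
  have d: "d \<ge> 1" unfolding d_def using \<kappa>_ge_1 mult_mono[of 1 "5 ^ k :: real" 1 \<kappa>] by simp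
  define a b where "a = enn2real (emeasure area B)" and "b = enn2real (emeasure area (G - B))"
  have "bounded B" "bounded (G - B)" using G BG bounded_subset by blast+
  then have ab: "emeasure area B = ennreal a" "emeasure area (G - B) = ennreal b" "a \<ge> 0" "b \<ge> 0"
    using emeasure_area_bounded[of B] emeasure_area_bounded[of "G - B"] G by (auto simp: a_def b_def less_top)
  have "emeasure area G = emeasure area B + emeasure area (G - B)"
    using BG G by (subst plus_emeasure) (auto intro!: arg_cong[where f="emeasure area"])
  then have L: "emeasure area G = ennreal (a + b)" using ab by (simp add: ennreal_plus)
  have "ennreal (a + b) \<le> ennreal (d * a)" using GB unfolding L ab using d ab by (simp add: ennreal_mult)
  then have Lda: "a + b \<le> d * a" using ab d by (subst (asm) ennreal_le_iff) auto
  have "G \<inter> graph \<subseteq> B \<union> ((G - B) \<inter> graph)" by blast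
  then have "hausdorff_pre k s (G \<inter> graph) \<le> hausdorff_pre k s (B \<union> ((G - B) \<inter> graph))" by (rule hausdorff_pre_mono)
  also have "\<dots> \<le> hausdorff_pre k s B + hausdorff_pre k s ((G - B) \<inter> graph)" by (rule hausdorff_pre_subadd2[OF s])
  also have "\<dots> \<le> ennreal (\<kappa> * a) + ennreal (c * b)"
  proof (rule add_mono)
    show "hausdorff_pre k s B \<le> ennreal (\<kappa> * a)" using HB unfolding ab using ab \<kappa>_ge_1 by (simp add: ennreal_mult)
    have "hausdorff_pre k s ((G - B) \<inter> graph) \<le> hausdorff_outer k ((G - B) \<inter> graph)" by (rule hausdorff_pre_le_outer[OF s])
    also have "\<dots> \<le> ennreal c * emeasure area (G - B)" by (rule bd) (use G \<open>bounded (G - B)\<close> in auto)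
    finally show "hausdorff_pre k s ((G - B) \<inter> graph) \<le> ennreal (c * b)"
      unfolding ab using ab c \<kappa>_ge_1 by (simp add: ennreal_mult)
  qed
  also have "\<dots> = ennreal (\<kappa> * a + c * b)" using ab c \<kappa>_ge_1 by (intro ennreal_plus[symmetric]) auto
  also have "\<dots> \<le> ennreal ((\<kappa> / d + c * (1 - 1 / d)) * (a + b))"
  proof (rule ennreal_leI)
    \<comment> \<open>\<open>B\<close> carries at least the fraction \<open>1 / d\<close> of the
      area \<open>a + b\<close>, and replacing the ratio \<open>c\<close> by \<kappa> on it saves
      \<open>(c - \<kappa>) * a\<close>.\<close>
    have "(c - \<kappa>) * ((a + b) / d) \<le> (c - \<kappa>) * a" using Lda d c by (intro mult_left_mono) (auto simp: field_simps)
    moreover have "(\<kappa> / d + c * (1 - 1 / d)) * (a + b) = c * (a + b) - (c - \<kappa>) * ((a + b) / d)"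
      using d by (simp add: field_simps)
    ultimately show "\<kappa> * a + c * b \<le> (\<kappa> / d + c * (1 - 1 / d)) * (a + b)" by (simp add: algebra_simps)
  qed
  also have "\<dots> = ennreal (\<kappa> / d + c * (1 - 1 / d)) * emeasure area G"
  proof -
    have "0 \<le> \<kappa> / d + c * (1 - 1 / d)"
      using c d \<kappa>_ge_1 by (intro add_nonneg_nonneg mult_nonneg_nonneg divide_nonneg_nonneg) auto
    then show ?thesis unfolding L using ab by (intro ennreal_mult) auto
  qed
  finally show "hausdorff_pre k s (G \<inter> graph) \<le> ennreal (\<kappa> / d + c * (1 - 1 / d)) * emeasure area G" .
qed

text \<open>The improvement step is affine in the bound, with fixed point \<kappa> and contraction
  factor \<open>q = 1 - 1 / d\<close>. Starting from \<kappa> + \<open>d\<close>, which exceeds the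
  crude bound \<open>d\<close>, the excess after \<open>j\<close> steps is
  \<open>d * q ^ j\<close>.\<close>

theorem hausdorff_le_area:
  assumes E: "E \<in> sets borel" "bounded E"
  shows "hausdorff_outer k (E \<inter> graph) \<le> ennreal \<kappa> * emeasure area E"
proof -
  define d where "d = 5 ^ k * \<kappa>"
  have d: "d \<ge> 1" unfolding d_def using \<kappa>_ge_1 mult_mono[of 1 "5 ^ k :: real" 1 \<kappa>] by simp
  define q where "q = 1 - 1 / d"
  have q: "0 \<le> q" "q < 1" using d by (auto simp: q_def)
  have it: "\<forall>E. E \<in> sets borel \<longrightarrow> bounded E \<longrightarrow> hausdorff_outer k (E \<inter> graph) \<le> ennreal (\<kappa> + d * q ^ j) * emeasure area E" for j
  proof (induction j)
    case 0
    have "hausdorff_outer k (E \<inter> graph) \<le> ennreal (\<kappa> + d) * emeasure area E" if E: "E \<in> sets borel" "bounded E" for E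
    proof (rule hausdorff_le_area_open_imp_borel[OF _ _ E])
      fix G :: "'a set" assume G: "open G" "bounded G"
      have "hausdorff_outer k (G \<inter> graph) \<le> ennreal d * emeasure area G"
        unfolding d_def by (rule hausdorff_open_crude[OF G])
      also have "\<dots> \<le> ennreal (\<kappa> + d) * emeasure area G"
        using \<kappa>_ge_1 by (intro mult_right_mono ennreal_leI) auto
      finally show "hausdorff_outer k (G \<inter> graph) \<le> ennreal (\<kappa> + d) * emeasure area G" .
    qed (use \<kappa>_ge_1 d in auto)
    then show ?case by simp
  next
    case (Suc j)
    have dq: "d * q ^ j \<ge> 0" "d * q ^ Suc j \<ge> 0" using d q by auto
    have "\<kappa> / d + (\<kappa> + d * q ^ j) * (1 - 1 / d) = \<kappa> + d * q ^ Suc j"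
      using d by (simp add: q_def[symmetric] algebra_simps) (simp add: q_def field_simps)
    then have step: "hausdorff_outer k (G \<inter> graph) \<le> ennreal (\<kappa> + d * q ^ Suc j) * emeasure area G"
      if "open G" "bounded G" for G
      using hausdorff_open_improve[of "\<kappa> + d * q ^ j", OF _ _ that] Suc dq by (simp add: d_def[symmetric])
    show ?case
      using hausdorff_le_area_open_imp_borel[OF step] dq \<kappa>_ge_1 by auto
  qed
  define e where "e = enn2real (emeasure area E)"
  have e: "emeasure area E = ennreal e" "e \<ge> 0" using emeasure_area_bounded[OF E] by (auto simp: e_def less_top)
  have le: "hausdorff_outer k (E \<inter> graph) \<le> ennreal ((\<kappa> + d * q ^ j) * e)" for j
    using it[of j] E e d q \<kappa>_ge_1 by (auto simp: ennreal_mult)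
  have "(\<lambda>j. ennreal ((\<kappa> + d * q ^ j) * e)) \<longlonglongrightarrow> ennreal ((\<kappa> + d * 0) * e)"
    using q by (intro tendsto_ennrealI tendsto_intros LIMSEQ_realpow_zero)
  then have "hausdorff_outer k (E \<inter> graph) \<le> ennreal ((\<kappa> + d * 0) * e)"
    by (rule LIMSEQ_le_const) (use le in auto)
  then show ?thesis using e \<kappa>_ge_1 by (simp add: ennreal_mult)
qed

end

section \<open>Charts\<close>

text \<open>The zero set of \<open>f\<close> near \<open>x\<close> is nearly orthogonal to \<open>g x\<close>; \<open>\<phi>\<close> is the McShane extension
  of its height function over the tangent plane.\<close>

lemma C1_regular_graph_chart:
  fixes f :: "'a::euclidean_space \<Rightarrow> real"
  assumes U: "open U" "x \<in> U" and f: "C1_regular_on U f g" "f x = 0" and \<delta>: "\<delta> > 0"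
  obtains r \<phi> where "r > 0" "ball x r \<subseteq> U" "lipschitz_graph (sgn (g x)) \<phi> \<delta>"
    "\<And>y. y \<in> ball x r \<Longrightarrow> f y = 0 \<longleftrightarrow> y \<bullet> sgn (g x) = \<phi> y"
    "\<And>y. y \<in> ball x r \<Longrightarrow> f y \<le> 0 \<longleftrightarrow> y \<bullet> sgn (g x) \<le> \<phi> y"
    "\<And>y. y \<in> ball x r \<Longrightarrow> norm (sgn (g y) - sgn (g x)) \<le> \<delta>"
proof -
  define n where "n = sgn (g x)"
  define G where "G = norm (g x)"
  have gx: "g x \<noteq> 0" using f U by (auto simp: C1_regular_on_def)
  have G: "G > 0" using gx by (simp add: G_def)
  have n: "norm n = 1" using gx by (simp add: n_def norm_sgn)
  have gn: "g x = G *\<^sub>R n" using gx by (simp add: G_def n_def sgn_div_norm)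
  \<comment> \<open>The relative error allowed for the gradient. The bound 1/2 makes
    \<open>f\<close> change sign with the vertical displacement; together with the bound by half of
    \<delta> it gives the slope, as an inequality \<open>a \<le> \<kappa> * (b + a)\<close> implies
    \<open>a \<le> 2 * \<kappa> * b\<close>.\<close>
  define \<kappa> where "\<kappa> = min (1/2) (\<delta>/2)"
  have \<kappa>: "0 < \<kappa>" "\<kappa> \<le> 1/2" "\<kappa> \<le> \<delta>/2" using \<delta> by (auto simp: \<kappa>_def)
  have cont: "continuous (at x) g"
    using f U continuous_on_eq_continuous_at[of U g] by (auto simp: C1_regular_on_def)
  have csgn: "continuous (at x) (\<lambda>y. sgn (g y))"
    unfolding sgn_div_norm using cont gx by (intro continuous_intros) auto
  obtain a where a: "a > 0" "ball x a \<subseteq> U" using U open_contains_ball by blast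
  obtain b where b: "b > 0" "\<And>y. dist y x < b \<Longrightarrow> dist (g y) (g x) < \<kappa> * G"
    using cont \<kappa>(1) G unfolding continuous_at_eps_delta by (meson mult_pos_pos)
  obtain c where c: "c > 0" "\<And>y. dist y x < c \<Longrightarrow> dist (sgn (g y)) (sgn (g x)) < \<delta>"
    using csgn \<delta> unfolding continuous_at_eps_delta by meson
  define R where "R = min a (min b c)"
  have R: "R > 0" "ball x R \<subseteq> U" using a b c by (auto simp: R_def)
  have gR: "norm (g y - g x) \<le> \<kappa> * G" "norm (sgn (g y) - sgn (g x)) \<le> \<delta>" if "y \<in> ball x R" for y
    using b(2)[of y] c(2)[of y] that by (auto simp: R_def dist_norm norm_minus_commute)
  \<comment> \<open>The mean value inequality for \<open>f\<close> minus its linear part at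
    \<open>x\<close>.\<close>
  have near: "\<bar>f y - f z - (y - z) \<bullet> g x\<bar> \<le> \<kappa> * G * norm (y - z)" if "y \<in> ball x R" "z \<in> ball x R" for y z
  proof -
    have "norm ((f y - y \<bullet> g x) - (f z - z \<bullet> g x)) \<le> \<kappa> * G * norm (y - z)"
    proof (rule differentiable_bound[where S="ball x R" and f="\<lambda>y. f y - y \<bullet> g x" and f'="\<lambda>y h. h \<bullet> g y - h \<bullet> g x"])
      fix w assume w: "w \<in> ball x R"
      then have "GDERIV f w :> g w" using f R by (auto simp: C1_regular_on_def)
      then have "(f has_derivative (\<lambda>h. h \<bullet> g w)) (at w within ball x R)"
        unfolding gderiv_def by (rule has_derivative_at_withinI)
      then show "((\<lambda>y. f y - y \<bullet> g x) has_derivative (\<lambda>h. h \<bullet> g w - h \<bullet> g x)) (at w within ball x R)"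
        by (intro derivative_intros) auto
      show "onorm (\<lambda>h. h \<bullet> g w - h \<bullet> g x) \<le> \<kappa> * G"
      proof (rule onorm_bound)
        fix h :: 'a
        have "\<bar>h \<bullet> (g w - g x)\<bar> \<le> norm h * norm (g w - g x)" by (rule Cauchy_Schwarz_ineq2)
        also have "\<dots> \<le> norm h * (\<kappa> * G)" using gR(1)[OF w] by (rule mult_left_mono) simp
        finally show "norm (h \<bullet> g w - h \<bullet> g x) \<le> \<kappa> * G * norm h" by (simp add: inner_diff_right mult.commute)
      qed (use \<kappa> G in simp)
    qed (use that in auto)
    then show ?thesis by (simp add: inner_diff_left algebra_simps)
  qed
  define Z where "Z = {z \<in> ball x R. f z = 0}"
  have xZ: "x \<in> Z" using f R by (simp add: Z_def)
  have flat: "\<bar>(y - z) \<bullet> n\<bar> \<le> \<delta> * norm (orth n (y - z))" if "y \<in> Z" "z \<in> Z" for y z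
  proof -
    have "\<bar>(y - z) \<bullet> g x\<bar> \<le> \<kappa> * G * norm (y - z)" using near[of y z] that by (simp add: Z_def)
    moreover have "\<bar>(y - z) \<bullet> g x\<bar> = G * \<bar>(y - z) \<bullet> n\<bar>" unfolding gn inner_scaleR_right abs_mult using G by simp
    ultimately have "G * \<bar>(y - z) \<bullet> n\<bar> \<le> G * (\<kappa> * norm (y - z))" by (simp only: mult_ac)
    then have 1: "\<bar>(y - z) \<bullet> n\<bar> \<le> \<kappa> * norm (y - z)" using G by simp
    have "norm (y - z) = norm (orth n (y - z) + ((y - z) \<bullet> n) *\<^sub>R n)" by (simp add: orth_def)
    also have "\<dots> \<le> norm (orth n (y - z)) + \<bar>(y - z) \<bullet> n\<bar>" by (rule order.trans[OF norm_triangle_ineq]) (simp add: n)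
    finally have "\<kappa> * norm (y - z) \<le> \<kappa> * norm (orth n (y - z)) + \<kappa> * \<bar>(y - z) \<bullet> n\<bar>"
      using \<kappa>(1) by (metis distrib_left mult_left_mono less_imp_le)
    moreover have "\<kappa> * \<bar>(y - z) \<bullet> n\<bar> \<le> 1/2 * \<bar>(y - z) \<bullet> n\<bar>" using \<kappa>(2) by (intro mult_right_mono) auto
    moreover have "2 * \<kappa> * norm (orth n (y - z)) \<le> \<delta> * norm (orth n (y - z))" using \<kappa>(3) by (intro mult_right_mono) auto
    ultimately show ?thesis using 1 by linarith
  qed
  define F where "F y z = z \<bullet> n + \<delta> * norm (orth n (y - z))" for y z
  define \<phi> where "\<phi> y = (INF z\<in>Z. F y z)" for y
  have Ftri: "F y w \<le> F z w + \<delta> * norm (orth n (y - z))" for y z w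
  proof -
    have "orth n (y - w) = orth n (y - z) + orth n (z - w)" by (simp add: orth_diff)
    then have "norm (orth n (y - w)) \<le> norm (orth n (y - z)) + norm (orth n (z - w))" by (simp add: norm_triangle_ineq)
    then have "\<delta> * norm (orth n (y - w)) \<le> \<delta> * (norm (orth n (y - z)) + norm (orth n (z - w)))" using \<delta> by (intro mult_left_mono) auto
    then show ?thesis by (simp add: F_def algebra_simps)
  qed
  have Flow: "z \<bullet> n \<le> F z w" if "z \<in> Z" "w \<in> Z" for z w
    using flat[OF that] by (simp add: F_def inner_diff_left)
  have Fbdd: "bdd_below (F y ` Z)" for y
  proof (rule bdd_belowI2)
    fix w assume w: "w \<in> Z"
    show "x \<bullet> n - \<delta> * norm (orth n (x - y)) \<le> F y w" using Flow[OF xZ w] Ftri[of x w y] by linarith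
  qed
  have \<phi>_le: "\<phi> y \<le> F y w" if "w \<in> Z" for y w unfolding \<phi>_def using Fbdd that by (rule cINF_lower)
  have \<phi>_ge: "c \<le> \<phi> y" if "\<And>w. w \<in> Z \<Longrightarrow> c \<le> F y w" for c y unfolding \<phi>_def using xZ that by (intro cINF_greatest) auto
  have \<phi>_lip: "\<phi> y \<le> \<phi> z + \<delta> * norm (y - z)" for y z
  proof -
    have "\<phi> y - \<delta> * norm (y - z) \<le> \<phi> z"
    proof (rule \<phi>_ge)
      fix w assume w: "w \<in> Z"
      have "\<delta> * norm (orth n (y - z)) \<le> \<delta> * norm (y - z)" using norm_orth_le[OF n] \<delta> by (intro mult_left_mono) auto
      then show "\<phi> y - \<delta> * norm (y - z) \<le> F z w" using \<phi>_le[OF w, of y] Ftri[of y w z] by linarith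
    qed
    then show ?thesis by simp
  qed
  have \<phi>_vert: "\<phi> (y + t *\<^sub>R n) = \<phi> y" for y t
  proof -
    have "F (y + t *\<^sub>R n) w = F y w" for w
      by (simp add: F_def orth_add orth_diff orth_scaleR orth_self[OF n])
    then show ?thesis unfolding \<phi>_def by simp
  qed
  have graph: "lipschitz_graph n \<phi> \<delta>"
  proof
    show "\<bar>\<phi> y - \<phi> z\<bar> \<le> \<delta> * norm (y - z)" for y z
      using \<phi>_lip[of y z] \<phi>_lip[of z y] norm_minus_commute[of y z] by (simp add: abs_le_iff)
  qed (use n \<delta> \<phi>_vert in auto)
  have \<phi>_Z: "\<phi> z = z \<bullet> n" if "z \<in> Z" for z
    using \<phi>_le[OF that, of z] \<phi>_ge[of "z \<bullet> n" z] Flow[OF that] by (auto simp: F_def orth_def[of n 0] intro: antisym)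
  \<comment> \<open>The vertical line through \<open>y\<close> meets the zero set at
    \<open>y + t *\<^sub>R n\<close>, and \<open>\<phi>\<close> has the same value there. Hence
    \<open>t\<close> is the vertical gap to the graph, and the sign of \<open>f y\<close> is
    opposite to that of \<open>t\<close>.\<close>
  have key: "\<exists>t. \<phi> y = y \<bullet> n + t \<and> \<bar>f y + t * G\<bar> \<le> 1/2 * G * \<bar>t\<bar>" if y: "y \<in> ball x (R / 4)" for y
  proof -
    \<comment> \<open>With \<open>y\<close> within \<open>R / 4\<close> of \<open>x\<close> the
      segment stays in the ball of radius \<open>R\<close>. Its length also suffices for the sign
      change: the total error at the ends, \<open>1/2 * G * (R / 4 + T) + G * (R / 4)\<close>,
      equals exactly \<open>T * G\<close>.\<close>
    define T where "T = 3 * (R / 4)"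
    have yx: "norm (y - x) < R / 4" using y by (simp add: dist_norm norm_minus_commute)
    have inb: "y + t *\<^sub>R n \<in> ball x R" if "\<bar>t\<bar> \<le> T" for t
    proof -
      have "norm (y + t *\<^sub>R n - x) \<le> norm (y - x) + \<bar>t\<bar>"
        using norm_triangle_ineq[of "y - x" "t *\<^sub>R n"] n by (simp add: algebra_simps)
      then have "norm (y + t *\<^sub>R n - x) < R" using yx \<open>\<bar>t\<bar> \<le> T\<close> by (simp add: T_def)
      then show ?thesis by (simp add: dist_norm norm_minus_commute)
    qed
    have xR: "x \<in> ball x R" using R by simp
    have sgn: "f (y + T *\<^sub>R n) \<ge> 0" "f (y + (- T) *\<^sub>R n) \<le> 0"
    proof -
      have T: "T > 0" using R by (simp add: T_def)
      have main: "\<bar>f (y + t *\<^sub>R n) - t * G\<bar> \<le> T * G" if t: "\<bar>t\<bar> = T" for t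
      proof -
        have e: "norm (y + t *\<^sub>R n - x) \<le> norm (y - x) + \<bar>t\<bar>"
          using norm_triangle_ineq[of "y - x" "t *\<^sub>R n"] n by (simp add: algebra_simps)
        have "\<bar>f (y + t *\<^sub>R n) - (y + t *\<^sub>R n - x) \<bullet> g x\<bar> \<le> \<kappa> * G * norm (y + t *\<^sub>R n - x)"
          using near[OF inb xR, of t] t f(2) by simp
        also have "\<dots> \<le> 1/2 * G * (R / 4 + T)" using \<kappa> G e yx t by (intro mult_mono) auto
        finally have 1: "\<bar>f (y + t *\<^sub>R n) - (y + t *\<^sub>R n - x) \<bullet> g x\<bar> \<le> 1/2 * G * (R / 4 + T)" .
        have 2: "(y + t *\<^sub>R n - x) \<bullet> g x = G * ((y - x) \<bullet> n) + t * G"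
          using n by (simp add: gn inner_simps norm_eq_1 algebra_simps)
        have "\<bar>(y - x) \<bullet> n\<bar> \<le> R / 4" using Cauchy_Schwarz_ineq2[of "y - x" n] n yx by simp
        then have "\<bar>G * ((y - x) \<bullet> n)\<bar> \<le> G * (R / 4)" using G by (simp add: abs_mult)
        then have "\<bar>f (y + t *\<^sub>R n) - t * G\<bar> \<le> 1/2 * G * (R / 4 + T) + G * (R / 4)" using 1 unfolding 2 by linarith
        also have "\<dots> = T * G" by (simp add: T_def algebra_simps)
        finally show ?thesis .
      qed
      show "f (y + T *\<^sub>R n) \<ge> 0" using main[of T] T by (simp add: abs_le_iff)
      show "f (y + (- T) *\<^sub>R n) \<le> 0" using main[of "- T"] T by (simp add: abs_le_iff)
    qed
    have contU: "continuous_on U f"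
    proof -
      have "(f has_derivative (\<lambda>h. h \<bullet> g y)) (at y)" if "y \<in> U" for y
        using f that by (auto simp: C1_regular_on_def gderiv_def)
      then show ?thesis using has_derivative_continuous continuous_at_imp_continuous_on by blast
    qed
    have inU: "y + t *\<^sub>R n \<in> U" if "t \<in> {- T..T}" for t
      using subsetD[OF R(2) inb[of t]] that by auto
    have "continuous_on {- T..T} (\<lambda>t. f (y + t *\<^sub>R n))"
      by (rule continuous_on_compose2[OF contU]) (use inU in \<open>auto intro!: continuous_intros\<close>)
    then obtain t where t: "- T \<le> t" "t \<le> T" "f (y + t *\<^sub>R n) = 0"
      using IVT'[of "\<lambda>t. f (y + t *\<^sub>R n)" "- T" 0 T] sgn R by (auto simp: T_def)
    then have tT: "\<bar>t\<bar> \<le> T" by simp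
    then have zZ: "y + t *\<^sub>R n \<in> Z" using inb t by (simp add: Z_def)
    have "\<phi> y = y \<bullet> n + t"
      using \<phi>_vert[of y t] \<phi>_Z[OF zZ] n by (simp add: inner_simps norm_eq_1)
    moreover have "\<bar>f y + t * G\<bar> \<le> 1/2 * G * \<bar>t\<bar>"
    proof -
      have nb: "\<bar>f y - f (y + t *\<^sub>R n) - (y - (y + t *\<^sub>R n)) \<bullet> g x\<bar> \<le> \<kappa> * G * norm (y - (y + t *\<^sub>R n))"
        using inb[of 0] inb[OF tT] R by (intro near) (auto simp: T_def)
      have e: "(y - (y + t *\<^sub>R n)) \<bullet> g x = - (t * G)" "norm (y - (y + t *\<^sub>R n)) = \<bar>t\<bar>"
        using n by (simp_all add: gn norm_eq_1)
      have "\<bar>f y + t * G\<bar> \<le> \<kappa> * G * \<bar>t\<bar>" using nb unfolding e t(3) by simp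
      moreover have "\<kappa> * G * \<bar>t\<bar> \<le> 1/2 * G * \<bar>t\<bar>" using \<kappa> G by (intro mult_right_mono) auto
      ultimately show ?thesis by linarith
    qed
    ultimately show ?thesis by blast
  qed
  have sign: "(f y = 0 \<longleftrightarrow> y \<bullet> n = \<phi> y) \<and> (f y \<le> 0 \<longleftrightarrow> y \<bullet> n \<le> \<phi> y)" if y: "y \<in> ball x (R / 4)" for y
  proof -
    obtain t where t: "\<phi> y = y \<bullet> n + t" "\<bar>f y + t * G\<bar> \<le> 1/2 * G * \<bar>t\<bar>" using key[OF y] by blast
    consider "t = 0" | "t > 0" | "t < 0" by linarith
    then show ?thesis
    proof cases
      case 1 then show ?thesis using t by simp
    next
      case 2
      then have "t * G > 0" using G by simp
      moreover have "1/2 * G * \<bar>t\<bar> = 1/2 * (t * G)" using 2 by simp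
      ultimately have "f y < 0" using t(2) by linarith
      then show ?thesis using t(1) 2 by simp
    next
      case 3
      then have "t * G < 0" using G by (simp add: mult_neg_pos)
      moreover have "1/2 * G * \<bar>t\<bar> = - (1/2 * (t * G))" using 3 by simp
      ultimately have "f y > 0" using t(2) by linarith
      then show ?thesis using t(1) 3 by simp
    qed
  qed
  show thesis
  proof (rule that[of "R / 4" \<phi>])
    show "R / 4 > 0" using R by simp
    show "ball x (R / 4) \<subseteq> U" using R by (auto simp: subset_iff)
    show "norm (sgn (g y) - sgn (g x)) \<le> \<delta>" if "y \<in> ball x (R / 4)" for y
      by (rule gR(2)) (use that R in auto)
  qed (use graph sign in \<open>simp_all add: n_def\<close>)
qed

section \<open>Neighbourhoods of graphs\<close>

definition thicken :: "'a::euclidean_space set \<Rightarrow> real \<Rightarrow> 'a set" where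
  "thicken E \<epsilon> = {y. \<exists>e\<in>E. dist e y \<le> \<epsilon>}"

lemma thicken_eq_sum: "thicken E \<epsilon> = {x + y | x y. x \<in> E \<and> y \<in> cball 0 \<epsilon>}"
proof -
  have "\<exists>x z. y = x + z \<and> x \<in> E \<and> z \<in> cball 0 \<epsilon>" if "e \<in> E" "dist e y \<le> \<epsilon>" for e y
    by (rule exI[of _ e], rule exI[of _ "y - e"]) (use that in \<open>auto simp: dist_norm norm_minus_commute\<close>)
  moreover have "\<exists>e\<in>E. dist e (x + y) \<le> \<epsilon>" if "x \<in> E" "y \<in> cball 0 \<epsilon>" for x y
    by (rule bexI[of _ x]) (use that in \<open>auto simp: dist_norm\<close>)
  ultimately show ?thesis unfolding thicken_def by blast
qed

lemma compact_thicken: "compact E \<Longrightarrow> compact (thicken E \<epsilon>)"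
  unfolding thicken_eq_sum by (rule compact_sums) auto

lemma thicken_mono: "E \<subseteq> F \<Longrightarrow> \<epsilon> \<le> \<epsilon>' \<Longrightarrow> thicken E \<epsilon> \<subseteq> thicken F \<epsilon>'"
  unfolding thicken_def by force

lemma thicken_UN: "thicken (\<Union>i\<in>I. E i) \<epsilon> = (\<Union>i\<in>I. thicken (E i) \<epsilon>)"
  unfolding thicken_def by blast

lemma Inter_thicken:
  assumes E: "closed E" shows "(\<Inter>i. thicken E (inverse (real (Suc i)))) = E"
proof
  show "E \<subseteq> (\<Inter>i. thicken E (inverse (real (Suc i))))" unfolding thicken_def by force
  show "(\<Inter>i. thicken E (inverse (real (Suc i)))) \<subseteq> E"
  proof
    fix y assume y: "y \<in> (\<Inter>i. thicken E (inverse (real (Suc i))))"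
    have "y \<in> closure E"
      unfolding closure_approachable
    proof (intro allI impI)
      fix e :: real assume "e > 0"
      then obtain i where i: "inverse (real (Suc i)) < e" using reals_Archimedean by blast
      from y have "y \<in> thicken E (inverse (real (Suc i)))" by blast
      then obtain x where "x \<in> E" "dist x y \<le> inverse (real (Suc i))" unfolding thicken_def by blast
      then show "\<exists>x\<in>E. dist x y < e" using i by force
    qed
    then show "y \<in> E" using E by simp
  qed
qed

lemma compact_fmeasurable_lborel: "compact (X::'a::euclidean_space set) \<Longrightarrow> X \<in> fmeasurable lborel"
proof -
  assume X: "compact X"
  then obtain a where "X \<subseteq> cbox (-a) a" using bounded_subset_cbox_symmetric compact_imp_bounded by blast
  then show ?thesis by (rule fmeasurableI2[OF fmeasurable_cbox]) (use X in \<open>auto simp: compact_imp_closed\<close>)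
qed

section \<open>Volumes of neighbourhoods and local volume changes near a graph\<close>

context lipschitz_graph begin

lemma fmeasurable_area: "A \<in> sets borel \<Longrightarrow> bounded A \<Longrightarrow> A \<in> fmeasurable area"
  using emeasure_area_bounded by (intro fmeasurableI) auto

lemma measure_layer:
  assumes "A \<in> sets borel" "bounded A" "a \<le> b"
  shows "layer A a b \<in> fmeasurable lborel" "vol (layer A a b) = (b - a) * measure area A"
proof -
  have *: "emeasure lborel (layer A a b) = ennreal ((b - a) * measure area A)"
    using emeasure_layer[OF assms(1,3)] emeasure_eq_ennreal_measure[of area A] emeasure_area_bounded[OF assms(1,2)] assms(3)
    by (simp add: ennreal_mult)
  then show "layer A a b \<in> fmeasurable lborel" using assms layer_borel by (intro fmeasurableI) auto
  show "vol (layer A a b) = (b - a) * measure area A" using * assms by (simp add: measure_def)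
qed

text \<open>The two comparisons in terms of real-valued measures; finiteness of the Hausdorff
  measure comes from the upper one.\<close>

lemma hausdorff_area:
  assumes A: "A \<in> sets borel" "bounded A" "A \<subseteq> graph"
  shows "A \<in> fmeasurable (hausdorff_measure (DIM('a) - 1))"
    "measure area A \<le> measure (hausdorff_measure (DIM('a) - 1)) A"
    "measure (hausdorff_measure (DIM('a) - 1)) A \<le> \<kappa> * measure area A"
proof -
  let ?H = "hausdorff_measure (DIM('a) - 1) :: 'a measure"
  have Ag: "A \<inter> graph = A" using A by blast
  have a: "emeasure area A = ennreal (measure area A)"
    using emeasure_area_bounded[OF A(1,2)] by (intro emeasure_eq_ennreal_measure) auto
  have up: "emeasure ?H A \<le> ennreal (\<kappa> * measure area A)"
    using hausdorff_le_area[OF A(1,2)] \<kappa>_ge_1 a Ag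
    by (simp add: emeasure_hausdorff_measure[OF A(1)] hyperplane_dim_def ennreal_mult)
  also have "\<dots> < \<infinity>" by simp
  finally show "A \<in> fmeasurable ?H" using A by (intro fmeasurableI) auto
  then have h: "emeasure ?H A = ennreal (measure ?H A)" by (intro emeasure_eq_ennreal_measure) (auto simp: fmeasurable_def)
  show "measure ?H A \<le> \<kappa> * measure area A" using up \<kappa>_ge_1 unfolding h by (subst (asm) ennreal_le_iff) auto
  have "ennreal (measure area A) \<le> ennreal (measure ?H A)"
    using area_le_hausdorff[OF A(1)] unfolding Ag emeasure_hausdorff_measure[OF A(1), symmetric] a h .
  then show "measure area A \<le> measure ?H A" by (subst (asm) ennreal_le_iff) auto
qed

lemma near_graph:
  assumes e: "e \<in> graph" and y: "dist e y \<le> \<epsilon>"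
  shows "\<bar>height y\<bar> \<le> (1 + \<delta>) * \<epsilon>" "dist e (foot y) \<le> (1 + \<delta>) * \<epsilon>"
proof -
  have ny: "norm (y - e) \<le> \<epsilon>" using y by (simp add: dist_norm norm_minus_commute)
  have "height y = (y - e) \<bullet> n - (\<phi> y - \<phi> e)" using e by (simp add: graph_def height_def inner_diff_left)
  moreover have "\<bar>(y - e) \<bullet> n\<bar> \<le> norm (y - e)" using Cauchy_Schwarz_ineq2[of "y - e" n] n by simp
  moreover have "\<bar>\<phi> y - \<phi> e\<bar> \<le> \<delta> * norm (y - e)" by (rule \<phi>_lipschitz')
  ultimately have "\<bar>height y\<bar> \<le> (1 + \<delta>) * norm (y - e)" by (simp add: algebra_simps)
  also have "\<dots> \<le> (1 + \<delta>) * \<epsilon>" using ny \<delta> by (intro mult_left_mono) auto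
  finally show "\<bar>height y\<bar> \<le> (1 + \<delta>) * \<epsilon>" .
  have "norm (foot y - foot e) \<le> sqrt (1 + \<delta>\<^sup>2) * norm (orth n (y - e))" by (rule foot_lipschitz)
  also have "\<dots> \<le> (1 + \<delta>) * \<epsilon>"
  proof (rule mult_mono)
    show "sqrt (1 + \<delta>\<^sup>2) \<le> 1 + \<delta>" using \<delta> by (intro real_le_lsqrt) (auto simp: power2_eq_square algebra_simps)
    show "norm (orth n (y - e)) \<le> \<epsilon>" using norm_orth_le[OF n, of "y - e"] ny by linarith
  qed (use \<delta> in auto)
  finally show "dist e (foot y) \<le> (1 + \<delta>) * \<epsilon>" using foot_graph[OF e] by (simp add: dist_norm norm_minus_commute)
qed

lemma dist_foot: "dist y (foot y) = \<bar>height y\<bar>"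
  using n by (simp add: dist_norm foot_def)

lemma measure_thicken_ge:
  assumes E: "compact E" and \<epsilon>: "\<epsilon> \<ge> 0"
  shows "\<epsilon> * measure area E \<le> vol (thicken E \<epsilon>)"
proof -
  have Eb: "E \<in> sets borel" "bounded E" using E by (auto simp: compact_imp_closed compact_imp_bounded)
  have "layer E 0 \<epsilon> \<subseteq> thicken E \<epsilon>"
  proof
    fix y assume "y \<in> layer E 0 \<epsilon>"
    then show "y \<in> thicken E \<epsilon>" unfolding thicken_def layer_def
      using dist_foot[of y] by (auto intro!: bexI[of _ "foot y"] simp: dist_commute)
  qed
  then have "vol (layer E 0 \<epsilon>) \<le> vol (thicken E \<epsilon>)"
    using layer_borel[OF Eb(1)] by (intro measure_mono_fmeasurable compact_fmeasurable_lborel compact_thicken E) auto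
  then show ?thesis using measure_layer[OF Eb \<epsilon>] by simp
qed

text \<open>A neighbour at distance \<epsilon> has height and displaced foot of size at most
  \<open>s = (1 + \<delta>) * \<epsilon>\<close>, so the neighbourhood lies in a layer over
  \<open>thicken E s\<close>. The areas of shrinking neighbourhoods tend to the area of the compact
  set \<open>E\<close>.\<close>

lemma measure_thicken_le:
  assumes E: "compact E" "E \<subseteq> graph" and \<eta>: "\<eta> > 0"
  shows "\<forall>\<^sub>F \<epsilon> in at_right 0. vol (thicken E \<epsilon>) \<le> 3 * (1 + \<delta>) * \<epsilon> * (measure area E + \<eta>)"
proof -
  have Th: "thicken E r \<in> sets borel" "bounded (thicken E r)" for r
    using compact_thicken[OF E(1)] by (auto simp: compact_imp_closed compact_imp_bounded)
  have "(\<lambda>i. measure area (thicken E (inverse (real (Suc i))))) \<longlonglongrightarrow> measure area (\<Inter>i. thicken E (inverse (real (Suc i))))"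
  proof (rule Lim_measure_decseq)
    show "decseq (\<lambda>i. thicken E (inverse (real (Suc i))))"
      by (intro decseq_SucI thicken_mono) (auto simp: field_simps)
    show "emeasure area (thicken E (inverse (real (Suc i)))) \<noteq> \<infinity>" for i
      using emeasure_area_bounded[OF Th] by (simp add: less_top)
  qed (use Th in auto)
  then have "(\<lambda>i. measure area (thicken E (inverse (real (Suc i))))) \<longlonglongrightarrow> measure area E"
    by (simp only: Inter_thicken[OF compact_imp_closed[OF E(1)]])
  then have "\<forall>\<^sub>F i in sequentially. measure area (thicken E (inverse (real (Suc i)))) < measure area E + \<eta>"
    using \<eta> by (intro order_tendstoD) auto
  then obtain i where i: "measure area (thicken E (inverse (real (Suc i)))) < measure area E + \<eta>"
    by (auto simp: eventually_sequentially)
  define r where "r = inverse (real (Suc i))"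
  have r: "r > 0" by (simp add: r_def)
  show ?thesis
  proof (rule eventually_at_rightI[of 0 "r / (1 + \<delta>)"])
    show "0 < r / (1 + \<delta>)" using r \<delta> by simp
    fix \<epsilon> assume \<epsilon>: "\<epsilon> \<in> {0<..<r / (1 + \<delta>)}"
    define s where "s = (1 + \<delta>) * \<epsilon>"
    have "0 < s" unfolding s_def using \<epsilon> \<delta> by (intro mult_pos_pos) auto
    moreover have "s < r" using \<epsilon> \<delta> by (auto simp: s_def field_simps)
    ultimately have s: "0 < s" "s < r" .
    \<comment> \<open>The upper end \<open>2 * s\<close> includes points of height exactly
      \<open>s\<close> in the half-open layer; the total height is the factor 3 of the
      statement.\<close>
    have sub: "thicken E \<epsilon> \<subseteq> layer (thicken E s) (- s) (2 * s)"
    proof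
      fix y assume "y \<in> thicken E \<epsilon>"
      then obtain e where "e \<in> E" "dist e y \<le> \<epsilon>" unfolding thicken_def by blast
      then show "y \<in> layer (thicken E s) (- s) (2 * s)"
        using near_graph[of e y \<epsilon>] E(2) s by (auto simp: layer_def thicken_def s_def[symmetric] abs_le_iff)
    qed
    have "vol (thicken E \<epsilon>) \<le> vol (layer (thicken E s) (- s) (2 * s))"
      using measure_layer(1)[OF Th, of "- s" "2 * s"] s Th by (intro measure_mono_fmeasurable sub) auto
    also have "\<dots> = 3 * s * measure area (thicken E s)" using measure_layer(2)[OF Th, of "- s" "2 * s"] s by simp
    also have "\<dots> \<le> 3 * s * (measure area E + \<eta>)"
    proof (rule mult_left_mono)
      have "measure area (thicken E s) \<le> measure area (thicken E r)"
        using s Th by (intro measure_mono_fmeasurable fmeasurable_area thicken_mono) auto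
      then show "measure area (thicken E s) \<le> measure area E + \<eta>" using i by (simp add: r_def)
    qed (use s in simp)
    finally show "vol (thicken E \<epsilon>) \<le> 3 * (1 + \<delta>) * \<epsilon> * (measure area E + \<eta>)" by (simp only: s_def mult.assoc)
  qed
qed

text \<open>Points of the slab may move by another half of \<rho> without leaving the region where
  the chart describes \<open>M\<close>.\<close>

lemma near_slab:
  assumes "y \<in> layer E (- (\<rho> / 2)) (\<rho> / 2)" "norm (y - x) < \<rho> / 2"
  shows "\<exists>e\<in>E. dist e x < \<rho>"
proof (rule bexI)
  show "foot y \<in> E" using assms(1) by (simp add: layer_def)
  have "dist (foot y) x \<le> dist (foot y) y + dist y x" by (rule dist_triangle)
  moreover have "dist (foot y) y \<le> \<rho> / 2"
    unfolding dist_commute[of "foot y"] dist_foot using assms(1) by (auto simp: layer_def abs_le_iff)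
  ultimately show "dist (foot y) x < \<rho>" using assms(2) by (simp add: dist_norm)
qed

lemma fmeasurable_Int_layer:
  assumes "compact E" "a \<le> b" "A \<in> sets borel" shows "A \<inter> layer E a b \<in> fmeasurable lborel"
proof -
  have W: "layer E a b \<in> fmeasurable lborel"
    using measure_layer(1)[OF _ _ assms(2)] assms(1) by (simp add: compact_imp_closed compact_imp_bounded)
  show ?thesis by (rule fmeasurableI2[OF W]) (use assms fmeasurableD[OF W] in auto)
qed

text \<open>Near a graph piece of the boundary, \<open>M\<close> is the part below the graph, and \<open>M + \<epsilon>K\<close> reaches at most
  \<open>\<epsilon> (h + \<delta> C)\<close> above it.\<close>

lemma local_upper:
  assumes E: "compact E" and M: "\<And>y. \<exists>e\<in>E. dist e y < \<rho> \<Longrightarrow> y \<in> M \<longleftrightarrow> height y \<le> 0"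
    and Mb: "M \<in> sets borel" and K: "\<And>p. p \<in> K \<Longrightarrow> norm p \<le> C" "\<And>p. p \<in> K \<Longrightarrow> p \<bullet> n \<le> h"
    and C: "C > 0" "\<bar>h\<bar> \<le> C" and \<eta>: "0 < \<eta>" and \<epsilon>: "0 < \<epsilon>" "\<epsilon> * (C + \<delta> * C + \<eta>) < \<rho> / 2"
    and S: "scaled_sum M \<epsilon> K \<in> sets borel"
  defines "W \<equiv> layer E (- (\<rho> / 2)) (\<rho> / 2)"
  shows "vol (scaled_sum M \<epsilon> K \<inter> W) - vol (M \<inter> W)
    \<le> \<epsilon> * (h + \<delta> * C + \<eta>) * measure area E"
proof -
  have Eb: "E \<in> sets borel" "bounded E" using E by (auto simp: compact_imp_closed compact_imp_bounded)
  define b where "b = \<epsilon> * (h + \<delta> * C + \<eta>)"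
  have \<delta>C: "\<delta> * C \<ge> 0" using \<delta> C by simp
  have eC: "\<epsilon> * C < \<rho> / 2"
  proof -
    have "\<epsilon> * C \<le> \<epsilon> * (C + \<delta> * C + \<eta>)" using \<epsilon> \<delta>C \<eta> by (intro mult_left_mono) auto
    then show ?thesis using \<epsilon>(2) by linarith
  qed
  have \<rho>: "\<rho> > 0" using eC(1) mult_pos_pos[OF \<epsilon>(1) C(1)] by linarith
  have b: "- (\<rho> / 2) \<le> b"
  proof -
    have "\<epsilon> * (- C) \<le> b" unfolding b_def using \<epsilon> \<delta>C \<eta> C by (intro mult_left_mono) auto
    then show ?thesis using eC by simp
  qed
  have IW: "A \<inter> W \<in> fmeasurable lborel" if "A \<in> sets borel" for A
    unfolding W_def using fmeasurable_Int_layer[OF E _ that] \<rho> by simp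
  have nearE: "\<exists>e\<in>E. dist e x < \<rho>" if "y \<in> W" "norm (y - x) \<le> \<epsilon> * C" for x y
    using near_slab[of y E \<rho> x] that eC(1) unfolding W_def by linarith
  have sub: "scaled_sum M \<epsilon> K \<inter> W \<subseteq> layer E (- (\<rho> / 2)) b"
  proof
    fix y assume "y \<in> scaled_sum M \<epsilon> K \<inter> W"
    then obtain x p where y: "y = x + \<epsilon> *\<^sub>R p" "x \<in> M" "p \<in> K" "y \<in> W" by blast
    have np: "norm (\<epsilon> *\<^sub>R p) \<le> \<epsilon> * C" using K(1)[OF y(3)] \<epsilon> by simp
    then have "height x \<le> 0" using M[OF nearE[OF y(4)]] y(1,2) by simp
    moreover have "height y = height x + \<epsilon> * (p \<bullet> n) - (\<phi> y - \<phi> x)" by (simp add: height_def y(1) inner_add_left)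
    moreover have "\<bar>\<phi> y - \<phi> x\<bar> \<le> \<epsilon> * (\<delta> * C)"
    proof -
      have "\<bar>\<phi> y - \<phi> x\<bar> \<le> \<delta> * norm (y - x)" by (rule \<phi>_lipschitz')
      also have "\<dots> \<le> \<delta> * (\<epsilon> * C)" using np y(1) \<delta> by (intro mult_left_mono) auto
      finally show ?thesis by (simp add: mult_ac)
    qed
    moreover have "\<epsilon> * (p \<bullet> n) \<le> \<epsilon> * h" using K(2)[OF y(3)] \<epsilon> by (intro mult_left_mono) auto
    moreover have "b = \<epsilon> * h + \<epsilon> * (\<delta> * C) + \<epsilon> * \<eta>" by (simp add: b_def distrib_left)
    \<comment> \<open>The margin \<eta> gives the strict bound that membership in a half-open layer
      requires.\<close>
    moreover have "\<epsilon> * \<eta> > 0" using \<epsilon> \<eta> by simp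
    ultimately have "height y < b" by linarith
    then show "y \<in> layer E (- (\<rho> / 2)) b" using y(4) by (simp add: W_def layer_def)
  qed
  have "vol (scaled_sum M \<epsilon> K \<inter> W) \<le> vol (layer E (- (\<rho> / 2)) b)"
    by (rule measure_mono_fmeasurable[OF sub]) (use fmeasurableD[OF IW[OF S]] measure_layer(1)[OF Eb b] in simp_all)
  also have "\<dots> = (b + \<rho> / 2) * measure area E" using measure_layer(2)[OF Eb b] by simp
  finally have 1: "vol (scaled_sum M \<epsilon> K \<inter> W) \<le> (b + \<rho> / 2) * measure area E" .
  have "layer E (- (\<rho> / 2)) 0 \<subseteq> M \<inter> W"
  proof
    fix y assume y: "y \<in> layer E (- (\<rho> / 2)) 0"
    then have "y \<in> W" using \<rho> by (simp add: W_def layer_def)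
    moreover have "y \<in> M" using M[OF nearE[OF \<open>y \<in> W\<close>, of y]] y \<epsilon> C by (simp add: layer_def)
    ultimately show "y \<in> M \<inter> W" by simp
  qed
  then have "vol (layer E (- (\<rho> / 2)) 0) \<le> vol (M \<inter> W)"
    using layer_borel[OF Eb(1)] IW[OF Mb] by (intro measure_mono_fmeasurable) auto
  then have "\<rho> / 2 * measure area E \<le> vol (M \<inter> W)"
    using measure_layer(2)[OF Eb, of "- (\<rho> / 2)" 0] \<rho> by simp
  moreover have "(b + \<rho> / 2) * measure area E = b * measure area E + \<rho> / 2 * measure area E" by (rule distrib_right)
  ultimately show ?thesis using 1 unfolding b_def[symmetric] by linarith
qed

text \<open>One vector \<open>p\<close> that attains the support value up to \<eta> is enough:
  subtracting its multiple from a point below level \<open>b\<close> gives a point strictly below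
  the graph, hence in the interior of \<open>M\<close>. The second \<eta> in the bound pays for the
  half-open layer that encloses \<open>M\<close> in the slab.\<close>

lemma local_lower:
  assumes E: "compact E" and M: "\<And>y. \<exists>e\<in>E. dist e y < \<rho> \<Longrightarrow> y \<in> M \<longleftrightarrow> height y \<le> 0"
    "\<And>y. \<exists>e\<in>E. dist e y < \<rho> \<Longrightarrow> y \<in> frontier M \<longleftrightarrow> height y = 0"
    and Mb: "M \<in> sets borel" and p: "p \<in> N" "norm p \<le> C" "h - \<eta> \<le> p \<bullet> n"
    and C: "C > 0" "\<bar>h\<bar> \<le> C" and \<eta>: "0 < \<eta>" and \<epsilon>: "0 < \<epsilon>" "\<epsilon> * (C + \<delta> * C + \<eta>) < \<rho> / 2"
    and S: "scaled_sum (interior M) \<epsilon> N \<in> sets borel"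
  defines "W \<equiv> layer E (- (\<rho> / 2)) (\<rho> / 2)"
  shows "vol (M \<inter> W) - vol (scaled_sum (interior M) \<epsilon> N \<inter> W)
    \<le> - \<epsilon> * (h - \<delta> * C - 2 * \<eta>) * measure area E"
proof -
  have Eb: "E \<in> sets borel" "bounded E" using E by (auto simp: compact_imp_closed compact_imp_bounded)
  define b where "b = \<epsilon> * (h - \<delta> * C - \<eta>)"
  have \<delta>C: "\<delta> * C \<ge> 0" using \<delta> C by simp
  have eC: "\<epsilon> * C < \<rho> / 2" "\<epsilon> * \<eta> < \<rho> / 2"
  proof -
    have "\<epsilon> * C \<le> \<epsilon> * (C + \<delta> * C + \<eta>)" "\<epsilon> * \<eta> \<le> \<epsilon> * (C + \<delta> * C + \<eta>)"
      using \<epsilon> \<delta>C \<eta> C by (auto intro!: mult_left_mono)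
    then show "\<epsilon> * C < \<rho> / 2" "\<epsilon> * \<eta> < \<rho> / 2" using \<epsilon>(2) by linarith+
  qed
  have \<rho>: "\<rho> > 0" using eC(1) mult_pos_pos[OF \<epsilon>(1) C(1)] by linarith
  have b: "- (\<rho> / 2) \<le> b" "b \<le> \<rho> / 2"
  proof -
    have "\<epsilon> * (- (C + \<delta> * C + \<eta>)) \<le> b" "b \<le> \<epsilon> * C" unfolding b_def using \<epsilon> \<delta>C \<eta> C by (auto intro!: mult_left_mono)
    then show "- (\<rho> / 2) \<le> b" "b \<le> \<rho> / 2" using eC \<epsilon>(2) by (auto simp: algebra_simps)
  qed
  have IW: "A \<inter> W \<in> fmeasurable lborel" if "A \<in> sets borel" for A
    unfolding W_def using fmeasurable_Int_layer[OF E _ that] \<rho> by simp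
  have nearE: "\<exists>e\<in>E. dist e x < \<rho>" if "y \<in> W" "norm (y - x) \<le> \<epsilon> * C" for x y
    using near_slab[of y E \<rho> x] that eC(1) unfolding W_def by linarith
  have sub: "layer E (- (\<rho> / 2)) b \<subseteq> scaled_sum (interior M) \<epsilon> N \<inter> W"
  proof
    fix y assume y: "y \<in> layer E (- (\<rho> / 2)) b"
    then have yW: "y \<in> W" using b by (auto simp: W_def layer_def)
    define x where "x = y - \<epsilon> *\<^sub>R p"
    have np: "norm (y - x) \<le> \<epsilon> * C" using p(2) \<epsilon> by (simp add: x_def)
    have "height x = height y - \<epsilon> * (p \<bullet> n) + (\<phi> y - \<phi> x)" by (simp add: height_def x_def inner_diff_left)
    moreover have "\<bar>\<phi> y - \<phi> x\<bar> \<le> \<epsilon> * (\<delta> * C)"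
    proof -
      have "\<bar>\<phi> y - \<phi> x\<bar> \<le> \<delta> * norm (y - x)" by (rule \<phi>_lipschitz')
      also have "\<dots> \<le> \<delta> * (\<epsilon> * C)" using np \<delta> by (intro mult_left_mono) auto
      finally show ?thesis by (simp add: mult_ac)
    qed
    moreover have "\<epsilon> * (h - \<eta>) \<le> \<epsilon> * (p \<bullet> n)" using p(3) \<epsilon> by (intro mult_left_mono) auto
    moreover have "b = \<epsilon> * (h - \<eta>) - \<epsilon> * (\<delta> * C)" by (simp add: b_def algebra_simps)
    moreover have "height y < b" using y by (simp add: layer_def)
    ultimately have "height x < 0" by linarith
    moreover have nx: "\<exists>e\<in>E. dist e x < \<rho>" by (rule nearE[OF yW np])
    ultimately have "x \<in> M" "x \<notin> frontier M" using M(1)[OF nx] M(2)[OF nx] by auto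
    then have "x \<in> interior M" using closure_subset[of M] by (auto simp: frontier_def)
    moreover have "y = x + \<epsilon> *\<^sub>R p" by (simp add: x_def)
    ultimately show "y \<in> scaled_sum (interior M) \<epsilon> N \<inter> W" using p(1) yW by blast
  qed
  have "vol (layer E (- (\<rho> / 2)) b) \<le> vol (scaled_sum (interior M) \<epsilon> N \<inter> W)"
    using IW[OF S] layer_borel[OF Eb(1)] by (intro measure_mono_fmeasurable[OF sub]) auto
  moreover have "vol (layer E (- (\<rho> / 2)) b) = (b + \<rho> / 2) * measure area E" using measure_layer(2)[OF Eb b(1)] by simp
  ultimately have 1: "(b + \<rho> / 2) * measure area E \<le> vol (scaled_sum (interior M) \<epsilon> N \<inter> W)" by simp
  have "M \<inter> W \<subseteq> layer E (- (\<rho> / 2)) (\<epsilon> * \<eta>)"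
  proof
    fix y assume y: "y \<in> M \<inter> W"
    then have "height y \<le> 0" using M(1)[OF nearE[of y y]] \<epsilon> C by simp
    also have "0 < \<epsilon> * \<eta>" using \<epsilon> \<eta> by simp
    finally show "y \<in> layer E (- (\<rho> / 2)) (\<epsilon> * \<eta>)" using y by (simp add: W_def layer_def)
  qed
  moreover have le: "- (\<rho> / 2) \<le> \<epsilon> * \<eta>" using \<rho> mult_pos_pos[OF \<epsilon>(1) \<eta>] by linarith
  ultimately have "vol (M \<inter> W) \<le> vol (layer E (- (\<rho> / 2)) (\<epsilon> * \<eta>))"
    using measure_layer(1)[OF Eb le] fmeasurableD[OF IW[OF Mb]] by (intro measure_mono_fmeasurable) auto
  then have "vol (M \<inter> W) \<le> (\<epsilon> * \<eta> + \<rho> / 2) * measure area E" using measure_layer(2)[OF Eb le] by simp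
  then have "vol (M \<inter> W) - vol (scaled_sum (interior M) \<epsilon> N \<inter> W)
      \<le> (\<epsilon> * \<eta> + \<rho> / 2) * measure area E - (b + \<rho> / 2) * measure area E" using 1 by linarith
  also have "\<dots> = - \<epsilon> * (h - \<delta> * C - 2 * \<eta>) * measure area E" by (simp add: b_def algebra_simps)
  finally show ?thesis .
qed

end

section \<open>The boundary of a piecewise $C^1$ domain\<close>

abbreviation surface_measure :: "'a::euclidean_space measure" where
  "surface_measure \<equiv> hausdorff_measure (DIM('a) - 1)"

text \<open>A decomposition of \<open>F\<close> into compact, possibly overlapping pieces of graphs
  of slope 1. Each triple consists of the normal, the graph function and the piece.\<close>

definition graph_pieces :: "('a::euclidean_space \<times> ('a \<Rightarrow> real) \<times> 'a set) set \<Rightarrow> 'a set \<Rightarrow> bool" where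
  "graph_pieces \<Q> F \<longleftrightarrow> finite \<Q> \<and> F = (\<Union>q\<in>\<Q>. snd (snd q)) \<and>
     (\<forall>q\<in>\<Q>. lipschitz_graph (fst q) (fst (snd q)) 1 \<and> compact (snd (snd q)) \<and>
        snd (snd q) \<subseteq> lipschitz_graph.graph (fst q) (fst (snd q)))"

lemma C1_regular_graph_chart_ex:
  fixes f :: "'a::euclidean_space \<Rightarrow> real"
  assumes "open U" "x \<in> U" "C1_regular_on U f g" "f x = 0" "\<delta> > 0"
  shows "\<exists>r \<phi>. r > 0 \<and> ball x r \<subseteq> U \<and> lipschitz_graph (sgn (g x)) \<phi> \<delta> \<and>
    (\<forall>y\<in>ball x r. (f y = 0 \<longleftrightarrow> y \<bullet> sgn (g x) = \<phi> y) \<and> (f y \<le> 0 \<longleftrightarrow> y \<bullet> sgn (g x) \<le> \<phi> y) \<and>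
      norm (sgn (g y) - sgn (g x)) \<le> \<delta>)"
  by (rule C1_regular_graph_chart[OF assms], intro exI conjI ballI) (assumption | blast)+

text \<open>Compactness selects finitely many charts. The pieces are cut out by closed balls,
  smaller than the chart domains, so that they are compact again.\<close>

lemma C1_hypersurface_graph_pieces:
  fixes P S :: "'a::euclidean_space set"
  assumes S: "C1_hypersurface S" and P: "compact P" "P \<subseteq> S"
  shows "\<exists>\<Q>. graph_pieces \<Q> P"
proof -
  have "\<exists>r n \<phi>. r > 0 \<and> lipschitz_graph n \<phi> 1 \<and> P \<inter> cball x r \<subseteq> lipschitz_graph.graph n \<phi>" if x: "x \<in> P" for x
  proof -
    have "x \<in> S" using x P by blast
    with S have "\<exists>U f g. open U \<and> x \<in> U \<and> C1_regular_on U f g \<and> S \<inter> U = {y \<in> U. f y = 0}"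
      unfolding C1_hypersurface_def by (rule bspec)
    then obtain U f g where U: "open U" "x \<in> U" "C1_regular_on U f g" "S \<inter> U = {y \<in> U. f y = 0}"
      by (elim exE conjE)
    have "f x = 0" using U x P by blast
    from C1_regular_graph_chart_ex[OF U(1-3) this zero_less_one]
    obtain r \<phi> where r: "r > 0" "ball x r \<subseteq> U" "lipschitz_graph (sgn (g x)) \<phi> 1"
      "\<forall>y\<in>ball x r. (f y = 0 \<longleftrightarrow> y \<bullet> sgn (g x) = \<phi> y) \<and> (f y \<le> 0 \<longleftrightarrow> y \<bullet> sgn (g x) \<le> \<phi> y) \<and>
        norm (sgn (g y) - sgn (g x)) \<le> 1"
      by (elim exE conjE)
    interpret lipschitz_graph "sgn (g x)" \<phi> 1 by (rule r(3))
    have "P \<inter> cball x (r / 2) \<subseteq> graph"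
    proof
      fix y assume y: "y \<in> P \<inter> cball x (r / 2)"
      then have yb: "y \<in> ball x r" using r(1) by simp
      then have "f y = 0" using U(4) r(2) P y by blast
      then show "y \<in> graph" using bspec[OF r(4) yb] by (simp add: graph_def height_def)
    qed
    then show ?thesis using r by (intro exI[of _ "r / 2"] exI[of _ "sgn (g x)"] exI[of _ \<phi>]) auto
  qed
  then obtain r n \<phi> where r: "\<And>x. x \<in> P \<Longrightarrow> r x > 0 \<and> lipschitz_graph (n x) (\<phi> x) 1 \<and>
      P \<inter> cball x (r x) \<subseteq> lipschitz_graph.graph (n x) (\<phi> x)" by metis
  have cov: "P \<subseteq> (\<Union>x\<in>P. ball x (r x))" using r by force
  obtain D where D: "D \<subseteq> P" "finite D" "P \<subseteq> (\<Union>x\<in>D. ball x (r x))"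
    by (rule compactE_image[OF P(1) _ cov]) auto
  have "graph_pieces ((\<lambda>x. (n x, \<phi> x, P \<inter> cball x (r x))) ` D) P"
    unfolding graph_pieces_def
  proof (intro conjI)
    have "P \<subseteq> (\<Union>x\<in>D. cball x (r x))" using D(3) ball_subset_cball by blast
    then show "P = (\<Union>q\<in>(\<lambda>x. (n x, \<phi> x, P \<inter> cball x (r x))) ` D. snd (snd q))" by auto
    show "\<forall>q\<in>(\<lambda>x. (n x, \<phi> x, P \<inter> cball x (r x))) ` D. lipschitz_graph (fst q) (fst (snd q)) 1 \<and>
        compact (snd (snd q)) \<and> snd (snd q) \<subseteq> lipschitz_graph.graph (fst q) (fst (snd q))"
    proof
      fix q assume "q \<in> (\<lambda>x. (n x, \<phi> x, P \<inter> cball x (r x))) ` D"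
      then obtain x where x: "x \<in> D" "q = (n x, \<phi> x, P \<inter> cball x (r x))" by blast
      show "lipschitz_graph (fst q) (fst (snd q)) 1 \<and> compact (snd (snd q)) \<and>
          snd (snd q) \<subseteq> lipschitz_graph.graph (fst q) (fst (snd q))"
        using r[of x] subsetD[OF D(1) x(1)] P(1) unfolding x(2) by (simp add: compact_Int)
    qed
    show "finite ((\<lambda>x. (n x, \<phi> x, P \<inter> cball x (r x))) ` D)" using D(2) by simp
  qed
  then show ?thesis by blast
qed

lemma graph_pieces_UN:
  assumes "finite \<P>" "\<And>P. P \<in> \<P> \<Longrightarrow> \<exists>\<Q>. graph_pieces \<Q> P"
  shows "\<exists>\<Q>. graph_pieces \<Q> (\<Union>\<P>)"
proof -
  obtain q where q: "\<And>P. P \<in> \<P> \<Longrightarrow> graph_pieces (q P) P" using assms(2) by metis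
  have "graph_pieces (\<Union>P\<in>\<P>. q P) (\<Union>\<P>)"
    unfolding graph_pieces_def
  proof (intro conjI)
    show "finite (\<Union>P\<in>\<P>. q P)" using assms(1) q by (auto simp: graph_pieces_def)
    have "P = (\<Union>q\<in>q P. snd (snd q))" if "P \<in> \<P>" for P using q[OF that] unfolding graph_pieces_def by blast
    then have "\<Union>\<P> = (\<Union>P\<in>\<P>. \<Union>q\<in>q P. snd (snd q))" by (subst SUP_cong[symmetric, OF refl]) auto
    then show "\<Union>\<P> = (\<Union>q\<in>(\<Union>P\<in>\<P>. q P). snd (snd q))" by simp
    show "\<forall>q\<in>(\<Union>P\<in>\<P>. q P). lipschitz_graph (fst q) (fst (snd q)) 1 \<and> compact (snd (snd q)) \<and>
        snd (snd q) \<subseteq> lipschitz_graph.graph (fst q) (fst (snd q))"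
      using q unfolding graph_pieces_def by blast
  qed
  then show ?thesis by blast
qed

lemma graph_piecesD:
  assumes "graph_pieces \<Q> F" "q \<in> \<Q>"
  shows "lipschitz_graph (fst q) (fst (snd q)) 1" "compact (snd (snd q))"
    "snd (snd q) \<subseteq> lipschitz_graph.graph (fst q) (fst (snd q))"
  using assms unfolding graph_pieces_def by blast+

lemma graph_pieces_Un: "graph_pieces \<Q> F \<Longrightarrow> F = (\<Union>q\<in>\<Q>. snd (snd q))"
  unfolding graph_pieces_def by blast

lemma graph_pieces_finite_measure:
  fixes F :: "'a::euclidean_space set"
  assumes F: "graph_pieces \<Q> F" shows "F \<in> fmeasurable surface_measure"
proof -
  have "snd (snd q) \<in> fmeasurable surface_measure" if q: "q \<in> \<Q>" for q :: "'a \<times> ('a \<Rightarrow> real) \<times> 'a set"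
  proof -
    note D = graph_piecesD[OF F q]
    interpret lipschitz_graph "fst q" "fst (snd q)" 1 by (rule D(1))
    show ?thesis using hausdorff_area(1)[OF _ _ D(3)] D(2) by (simp add: compact_imp_closed compact_imp_bounded)
  qed
  then show ?thesis unfolding graph_pieces_Un[OF F]
    using F by (intro fmeasurable.finite_UN) (auto simp: graph_pieces_def)
qed

text \<open>The layer of height \<epsilon> over a compact part of a graph lies in its neighbourhood,
  so zero content forces zero area, and by the comparison zero surface measure.\<close>

lemma graph_pieces_content_null:
  fixes F S :: "'a::euclidean_space set"
  assumes F: "graph_pieces \<Q> F" and S: "compact S" "S \<subseteq> F"
    and lim: "((\<lambda>\<epsilon>. vol (thicken S \<epsilon>) / \<epsilon>) \<longlongrightarrow> 0) (at_right 0)"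
  shows "measure surface_measure S = 0"
proof -
  have null: "measure surface_measure (S \<inter> snd (snd q)) = 0" if q: "q \<in> \<Q>" for q :: "'a \<times> ('a \<Rightarrow> real) \<times> 'a set"
  proof -
    note D = graph_piecesD[OF F q]
    interpret lipschitz_graph "fst q" "fst (snd q)" 1 by (rule D(1))
    let ?E = "S \<inter> snd (snd q)"
    have E: "compact ?E" "?E \<subseteq> graph" using S D by auto
    have "measure area ?E \<le> 0"
    proof (rule tendsto_lowerbound[OF lim])
      show "\<forall>\<^sub>F \<epsilon> in at_right 0. measure area ?E \<le> vol (thicken S \<epsilon>) / \<epsilon>"
      proof (rule eventually_at_rightI[of 0 1])
        fix \<epsilon> :: real assume \<epsilon>: "\<epsilon> \<in> {0<..<1}"
        have "\<epsilon> * measure area ?E \<le> vol (thicken ?E \<epsilon>)" using measure_thicken_ge[OF E(1)] \<epsilon> by simp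
        also have "\<dots> \<le> vol (thicken S \<epsilon>)"
          using compact_thicken[OF S(1), of \<epsilon>] compact_thicken[OF E(1), of \<epsilon>]
          by (intro measure_mono_fmeasurable compact_fmeasurable_lborel thicken_mono) (auto simp: compact_imp_closed)
        finally show "measure area ?E \<le> vol (thicken S \<epsilon>) / \<epsilon>" using \<epsilon> by (simp add: field_simps)
      qed simp
    qed simp
    then have "measure area ?E = 0" using measure_nonneg[of area ?E] by linarith
    then have "measure surface_measure ?E \<le> 0"
      using hausdorff_area(3)[OF _ _ E(2)] E(1) by (simp add: compact_imp_closed compact_imp_bounded)
    then show ?thesis using measure_nonneg[of surface_measure ?E] by linarith
  qed
  have fin: "finite \<Q>" using F by (simp add: graph_pieces_def)
  have SU: "S = (\<Union>q\<in>\<Q>. S \<inter> snd (snd q))" using S(2) graph_pieces_Un[OF F] by blast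
  have "measure surface_measure (\<Union>q\<in>\<Q>. S \<inter> snd (snd q)) \<le> (\<Sum>q\<in>\<Q>. measure surface_measure (S \<inter> snd (snd q)))"
  proof (rule measure_UNION_le[OF fin])
    fix q assume q: "q \<in> \<Q>"
    show "S \<inter> snd (snd q) \<in> sets surface_measure" using S(1) graph_piecesD(2)[OF F q] by (auto simp: compact_imp_closed)
  qed
  then have "measure surface_measure S \<le> 0" using null SU by simp
  then show ?thesis using measure_nonneg[of surface_measure S] by (rule antisym)
qed

text \<open>Small measure does not bound the content of a compact set in general; here the finitely
  many graphs do it. The constant 6 is \<open>3 * (1 + \<delta>)\<close> for slope 1, and overlaps
  are paid for by the number of pieces.\<close>

lemma graph_pieces_content_le:
  fixes F :: "'a::euclidean_space set"
  assumes F: "graph_pieces \<Q> F" and T: "compact T" "T \<subseteq> F" and \<eta>: "\<eta> > 0"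
  shows "\<forall>\<^sub>F \<epsilon> in at_right 0. vol (thicken T \<epsilon>) \<le> 6 * real (card \<Q>) * \<epsilon> * (measure surface_measure T + \<eta>)"
proof -
  have fin: "finite \<Q>" using F by (simp add: graph_pieces_def)
  have Fm: "F \<in> fmeasurable surface_measure" by (rule graph_pieces_finite_measure[OF F])
  have TF: "T \<in> fmeasurable surface_measure" by (rule fmeasurableI2[OF Fm T(2)]) (use T in \<open>simp add: compact_imp_closed\<close>)
  have ev: "\<forall>\<^sub>F \<epsilon> in at_right 0. vol (thicken (T \<inter> snd (snd q)) \<epsilon>) \<le> 6 * \<epsilon> * (measure surface_measure T + \<eta>)" if q: "q \<in> \<Q>" for q
  proof -
    note D = graph_piecesD[OF F q]
    interpret lipschitz_graph "fst q" "fst (snd q)" 1 by (rule D(1))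
    let ?E = "T \<inter> snd (snd q)"
    have E: "compact ?E" "?E \<subseteq> graph" using T D by auto
    have "measure area ?E \<le> measure surface_measure ?E"
      using hausdorff_area(2)[OF _ _ E(2)] E(1) by (simp add: compact_imp_closed compact_imp_bounded)
    also have "\<dots> \<le> measure surface_measure T"
      using E(1) by (intro measure_mono_fmeasurable TF) (auto simp: compact_imp_closed)
    finally have le: "measure area ?E \<le> measure surface_measure T" .
    show ?thesis
      using measure_thicken_le[OF E \<eta>] eventually_at_right_less[of 0]
    proof eventually_elim
      case (elim \<epsilon>)
      have "6 * \<epsilon> * (measure area ?E + \<eta>) \<le> 6 * \<epsilon> * (measure surface_measure T + \<eta>)"
        using elim(2) le by (intro mult_left_mono) auto
      then show ?case using elim(1) by simp
    qed
  qed
  have "\<forall>\<^sub>F \<epsilon> in at_right 0. \<forall>q\<in>\<Q>. vol (thicken (T \<inter> snd (snd q)) \<epsilon>) \<le> 6 * \<epsilon> * (measure surface_measure T + \<eta>)"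
    using ev by (intro eventually_ball_finite fin) auto
  then show ?thesis
  proof eventually_elim
    case (elim \<epsilon>)
    have "T = (\<Union>q\<in>\<Q>. T \<inter> snd (snd q))" using T(2) graph_pieces_Un[OF F] by blast
    then have "thicken T \<epsilon> = (\<Union>q\<in>\<Q>. thicken (T \<inter> snd (snd q)) \<epsilon>)" using thicken_UN[of "\<lambda>q. T \<inter> snd (snd q)" \<Q> \<epsilon>] by simp
    then have "vol (thicken T \<epsilon>) = vol (\<Union>q\<in>\<Q>. thicken (T \<inter> snd (snd q)) \<epsilon>)" by simp
    also have "\<dots> \<le> (\<Sum>q\<in>\<Q>. vol (thicken (T \<inter> snd (snd q)) \<epsilon>))"
    proof (rule measure_UNION_le[OF fin])
      fix q assume q: "q \<in> \<Q>"
      have "compact (thicken (T \<inter> snd (snd q)) \<epsilon>)" using T(1) graph_piecesD(2)[OF F q] by (intro compact_thicken compact_Int)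
      then show "thicken (T \<inter> snd (snd q)) \<epsilon> \<in> sets lborel" by (simp add: compact_imp_closed)
    qed
    also have "\<dots> \<le> (\<Sum>q\<in>\<Q>. 6 * \<epsilon> * (measure surface_measure T + \<eta>))" using elim by (intro sum_mono) auto
    finally show ?case by (simp add: mult_ac)
  qed
qed

text \<open>A single defining function serves for all boundary points near \<open>x\<close>. They
  are therefore smooth as well, with normals given by the same continuous gradient.\<close>

lemma smooth_point_chart:
  fixes M :: "'a::euclidean_space set"
  assumes x: "smooth_boundary_point M x" and \<delta>: "\<delta> > 0"
  shows "\<exists>r \<phi>. r > 0 \<and> lipschitz_graph (outer_unit_normal M x) \<phi> \<delta> \<and>
    (\<forall>y\<in>ball x r. (y \<in> frontier M \<longleftrightarrow> lipschitz_graph.height (outer_unit_normal M x) \<phi> y = 0) \<and>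
       (y \<in> M \<longleftrightarrow> lipschitz_graph.height (outer_unit_normal M x) \<phi> y \<le> 0) \<and>
       (y \<in> frontier M \<longrightarrow> smooth_boundary_point M y \<and> norm (outer_unit_normal M y - outer_unit_normal M x) \<le> \<delta>))"
proof -
  obtain U f g where xF: "x \<in> frontier M" and c: "smooth_boundary_chart M x U f g"
    using x unfolding smooth_boundary_point_def by blast
  have U: "open U" "x \<in> U" "C1_regular_on U f g" and FU: "frontier M \<inter> U = {y \<in> U. f y = 0}" and MU: "M \<inter> U = {y \<in> U. f y \<le> 0}"
    using c unfolding smooth_boundary_chart_def by auto
  have cy: "smooth_boundary_chart M y U f g" if "y \<in> U" for y
    using c that unfolding smooth_boundary_chart_def by blast
  have u: "outer_unit_normal M y = sgn (g y)" if "y \<in> U" "y \<in> frontier M" for y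
    by (rule outer_unit_normal_eq[OF that(2) cy[OF that(1)]])
  have "f x = 0" using FU xF U by blast
  from C1_regular_graph_chart_ex[OF U this \<delta>]
  obtain r \<phi> where r: "r > 0" "ball x r \<subseteq> U" "lipschitz_graph (sgn (g x)) \<phi> \<delta>"
    "\<forall>y\<in>ball x r. (f y = 0 \<longleftrightarrow> y \<bullet> sgn (g x) = \<phi> y) \<and> (f y \<le> 0 \<longleftrightarrow> y \<bullet> sgn (g x) \<le> \<phi> y) \<and>
      norm (sgn (g y) - sgn (g x)) \<le> \<delta>"
    by (elim exE conjE)
  interpret lipschitz_graph "sgn (g x)" \<phi> \<delta> by (rule r(3))
  have "(y \<in> frontier M \<longleftrightarrow> height y = 0) \<and> (y \<in> M \<longleftrightarrow> height y \<le> 0) \<and>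
      (y \<in> frontier M \<longrightarrow> smooth_boundary_point M y \<and> norm (outer_unit_normal M y - outer_unit_normal M x) \<le> \<delta>)"
    if y: "y \<in> ball x r" for y
  proof -
    have yU: "y \<in> U" using r(2) y by blast
    have 1: "y \<in> frontier M \<longleftrightarrow> height y = 0" using FU yU bspec[OF r(4) y] by (auto simp: height_def)
    have 2: "y \<in> M \<longleftrightarrow> height y \<le> 0" using MU yU bspec[OF r(4) y] by (auto simp: height_def)
    have 3: "smooth_boundary_point M y \<and> norm (outer_unit_normal M y - outer_unit_normal M x) \<le> \<delta>" if "y \<in> frontier M"
      using that cy[OF yU] bspec[OF r(4) y] u[OF yU that] u[OF U(2) xF] unfolding smooth_boundary_point_def by metis
    show ?thesis using 1 2 3 by blast
  qed
  then show ?thesis using r(1,3) u[OF U(2) xF] by metis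
qed

lemma closed_Sing: "closed (Sing (M :: 'a::euclidean_space set))"
proof -
  have "\<exists>r>0. \<forall>y\<in>ball x r. y \<notin> Sing M" if x: "x \<notin> Sing M" for x
  proof (cases "x \<in> frontier M")
    case True
    then have "smooth_boundary_point M x" using x by (simp add: Sing_def)
    from smooth_point_chart[OF this zero_less_one] show ?thesis by (auto simp: Sing_def)
  next
    case False
    then obtain r where "r > 0" "ball x r \<subseteq> - frontier M" using open_contains_ball[of "- frontier M"] by (auto simp: open_Compl)
    then show ?thesis by (auto simp: Sing_def)
  qed
  then have "open (- Sing M)" unfolding open_contains_ball by blast
  then show ?thesis by (simp add: closed_def)
qed

text \<open>\<open>H\<close> itself may be infinite, so it is first restricted to \<open>A\<close>
  by a density, and inner regularity of finite Borel measures applies. If the measure of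
  \<open>A\<close> is below \<open>e\<close>, the empty set serves.\<close>

lemma inner_regular_fmeasurable:
  fixes H :: "'a::euclidean_space measure"
  assumes H: "sets H = sets borel" and A: "A \<in> fmeasurable H" and e: "e > 0"
  obtains K where "compact K" "K \<subseteq> A" "measure H A - e < measure H K"
proof (cases "measure H A < e")
  case True
  show thesis by (rule that[of "{}"]) (use True in auto)
next
  case False
  define H' where "H' = density H (indicator A)"
  have Ab: "A \<in> sets H" using A by (rule fmeasurableD)
  have H': "emeasure H' B = emeasure H (B \<inter> A)" if "B \<in> sets H" for B
  proof -
    have "emeasure H' B = (\<integral>\<^sup>+x. indicator A x * indicator B x \<partial>H)"
      unfolding H'_def using that Ab by (intro emeasure_density borel_measurable_indicator) auto
    also have "\<dots> = (\<integral>\<^sup>+x. indicator (B \<inter> A) x \<partial>H)" by (intro nn_integral_cong) (auto simp: indicator_def)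
    also have "\<dots> = emeasure H (B \<inter> A)" using that Ab by (intro nn_integral_indicator) auto
    finally show ?thesis .
  qed
  have AA: "emeasure H A = ennreal (measure H A)" using A by (intro emeasure_eq_ennreal_measure) (auto simp: fmeasurable_def)
  have sH': "sets H' = sets borel" "space H' = space H" using H by (simp_all add: H'_def)
  have "emeasure H' (space H') \<noteq> \<infinity>"
    using H'[of "space H"] A sets.sets_into_space[OF Ab] by (simp add: sH' Int_absorb1 fmeasurable_def less_top)
  then have sup: "emeasure H' A = (SUP K \<in> {K. K \<subseteq> A \<and> compact K}. emeasure H' K)"
    using Ab H by (intro inner_regular) (simp_all add: sH')
  have "ennreal (measure H A - e) < emeasure H' A"
    unfolding H'[OF Ab] using AA False e by (simp add: ennreal_less_iff)
  then have "\<exists>K\<in>{K. K \<subseteq> A \<and> compact K}. ennreal (measure H A - e) < emeasure H' K"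
    unfolding sup less_SUP_iff .
  then obtain K where K: "K \<subseteq> A" "compact K" "ennreal (measure H A - e) < emeasure H' K"
    by blast
  have Kb: "K \<in> sets H" using K(2) H by (simp add: compact_imp_closed)
  have KK: "emeasure H K = ennreal (measure H K)"
    using fmeasurableI2[OF A K(1) Kb] by (intro emeasure_eq_ennreal_measure) (auto simp: fmeasurable_def)
  have "ennreal (measure H A - e) < ennreal (measure H K)"
    using K(3) H'[OF Kb] K(1) KK by (simp add: Int_absorb2)
  then have "measure H A - e < measure H K" using False by (simp add: ennreal_less_iff)
  then show thesis by (rule that[OF K(2,1)])
qed

section \<open>Cutting the smooth boundary into separated compact pieces\<close>

lemma eventually_separated_compact_closed:
  fixes S T :: "'a::euclidean_space set"
  assumes "compact S" "closed T" "S \<inter> T = {}"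
  shows "\<forall>\<^sub>F \<rho> in at_right 0. \<forall>x\<in>S. \<forall>y\<in>T. \<rho> \<le> dist x y"
proof -
  obtain d where d: "d > 0" "\<forall>x\<in>S. \<forall>y\<in>T. d \<le> dist x y"
    using separate_compact_closed[OF assms] by blast
  show ?thesis by (rule eventually_at_rightI[of 0 d]) (use d in force)+
qed

text \<open>The chart must be valid on the full \<rho>-neighbourhood of \<open>E\<close>, since sums
  with small vectors are compared there. \<open>n\<close> is one fixed vector close to all normals
  along the piece.\<close>

definition chart_piece :: "'a::euclidean_space set \<Rightarrow> real \<Rightarrow> real \<Rightarrow> 'a \<Rightarrow> ('a \<Rightarrow> real) \<Rightarrow> 'a set \<Rightarrow> bool" where
  "chart_piece M \<delta> \<rho> n \<phi> E \<longleftrightarrow> lipschitz_graph n \<phi> \<delta> \<and> compact E \<and> E \<subseteq> frontier M \<and>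
     (\<forall>y. (\<exists>e\<in>E. dist e y < \<rho>) \<longrightarrow> (y \<in> frontier M \<longleftrightarrow> lipschitz_graph.height n \<phi> y = 0) \<and>
        (y \<in> M \<longleftrightarrow> lipschitz_graph.height n \<phi> y \<le> 0)) \<and>
     (\<forall>y\<in>E. smooth_boundary_point M y \<and> norm (outer_unit_normal M y - n) \<le> \<delta>)"

abbreviation slab :: "'a::euclidean_space \<Rightarrow> ('a \<Rightarrow> real) \<Rightarrow> 'a set \<Rightarrow> real \<Rightarrow> 'a set" where
  "slab n \<phi> E \<rho> \<equiv> lipschitz_graph.layer n \<phi> E (- (\<rho> / 2)) (\<rho> / 2)"

text \<open>Countably many chart balls cover the smooth part, by Lindelof. Making them disjoint,
  keeping finitely many and passing to compact subsets loses little measure, and disjoint compact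
  sets are a positive distance apart.\<close>

lemma boundary_partition:
  fixes M :: "'a::euclidean_space set"
  assumes M: "compact M" and F: "frontier M \<in> fmeasurable surface_measure"
    and null: "measure surface_measure (Sing M) = 0" and \<delta>: "\<delta> > 0" and \<eta>: "\<eta> > 0"
  shows "\<exists>m::nat. \<exists>n \<phi> E \<rho> T. \<rho> > 0 \<and> (\<forall>i<m. chart_piece M \<delta> \<rho> (n i) (\<phi> i) (E i)) \<and>
    (\<forall>i<m. \<forall>j<m. i \<noteq> j \<longrightarrow> (\<forall>a\<in>E i. \<forall>b\<in>E j. 2 * \<rho> \<le> dist a b)) \<and>
    compact T \<and> T \<subseteq> frontier M \<and> frontier M - (\<Union>i<m. E i) \<subseteq> T \<and> measure surface_measure T \<le> \<eta>"
proof -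
  let ?H = "surface_measure :: 'a measure"
  define u where "u = outer_unit_normal M"
  define R where "R = frontier M - Sing M"
  have cF: "compact (frontier M)" using M by (rule compact_frontier)
  have Rsm: "smooth_boundary_point M x" if "x \<in> R" for x using that by (simp add: R_def Sing_def)
  have Sb: "Sing M \<in> sets ?H" by (simp add: closed_Sing borel_closed)
  have Rf: "R \<in> fmeasurable ?H" unfolding R_def by (intro fmeasurable.Diff F fmeasurableI2[OF F _ Sb]) (auto simp: Sing_def)
  have "\<forall>x\<in>R. \<exists>r \<phi>. r > 0 \<and> lipschitz_graph (u x) \<phi> \<delta> \<and>
    (\<forall>y\<in>ball x r. (y \<in> frontier M \<longleftrightarrow> lipschitz_graph.height (u x) \<phi> y = 0) \<and>
       (y \<in> M \<longleftrightarrow> lipschitz_graph.height (u x) \<phi> y \<le> 0) \<and>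
       (y \<in> frontier M \<longrightarrow> smooth_boundary_point M y \<and> norm (u y - u x) \<le> \<delta>))"
    using smooth_point_chart[OF Rsm \<delta>] unfolding u_def by blast
  then obtain r \<phi>0 where ch: "\<forall>x\<in>R. r x > 0 \<and> lipschitz_graph (u x) (\<phi>0 x) \<delta> \<and>
    (\<forall>y\<in>ball x (r x). (y \<in> frontier M \<longleftrightarrow> lipschitz_graph.height (u x) (\<phi>0 x) y = 0) \<and>
       (y \<in> M \<longleftrightarrow> lipschitz_graph.height (u x) (\<phi>0 x) y \<le> 0) \<and>
       (y \<in> frontier M \<longrightarrow> smooth_boundary_point M y \<and> norm (u y - u x) \<le> \<delta>))"
    unfolding bchoice_iff by (elim exE)
  have "\<exists>D\<subseteq>R. countable D \<and> R \<subseteq> (\<Union>x\<in>D. ball x (r x))"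
  proof -
    obtain \<F>' where \<F>': "\<F>' \<subseteq> (\<lambda>x. ball x (r x)) ` R" "countable \<F>'" "\<Union>\<F>' = \<Union>((\<lambda>x. ball x (r x)) ` R)"
      by (rule Lindelof[of "(\<lambda>x. ball x (r x)) ` R"]) auto
    have "countable \<F>' \<and> \<F>' \<subseteq> (\<lambda>x. ball x (r x)) ` R" using \<F>' by blast
    then have "\<exists>D. countable D \<and> D \<subseteq> R \<and> \<F>' = (\<lambda>x. ball x (r x)) ` D" by (simp only: countable_subset_image)
    then obtain D where D: "countable D" "D \<subseteq> R" "\<F>' = (\<lambda>x. ball x (r x)) ` D" by blast
    have "R \<subseteq> \<Union>((\<lambda>x. ball x (r x)) ` R)" using ch by force
    then have "R \<subseteq> \<Union>((\<lambda>x. ball x (r x)) ` D)" unfolding \<F>'(3)[symmetric] D(3) .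
    then show ?thesis using D(1,2) by (intro exI[of _ D] conjI)
  qed
  then obtain D where D: "D \<subseteq> R" "countable D" "R \<subseteq> (\<Union>x\<in>D. ball x (r x))" by blast
  show ?thesis
  proof (cases "R = {}")
    \<comment> \<open>Without smooth points there are no pieces, and the remainder is the whole
      boundary, which is null.\<close>
    case True
    then have "frontier M = Sing M" by (auto simp: R_def Sing_def)
    then have "measure ?H (frontier M) \<le> \<eta>" using null \<eta> by simp
    then show ?thesis using cF by (intro exI[of _ 0] exI[of _ 1] exI[of _ "frontier M"] exI[of _ "\<lambda>_. {}"] exI) auto
  next
    case False
    then have Dne: "D \<noteq> {}" using D(3) by auto
    define x where "x i = from_nat_into D i" for i
    have xR: "x i \<in> R" for i using from_nat_into[OF Dne] D(1) unfolding x_def by blast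
    have rx: "range x = D" unfolding x_def using Dne D(2) by simp
    define B where "B i = ball (x i) (r (x i))" for i
    have RB: "R \<subseteq> (\<Union>i. B i)" using D(3) rx unfolding B_def by blast
    define A where "A i = R \<inter> disjointed B i" for i
    have "range B \<subseteq> sets ?H" by (auto simp: B_def)
    then have "range (disjointed B) \<subseteq> sets ?H" by (rule sets.range_disjointed_sets)
    then have Ab: "A i \<in> sets ?H" for i
      unfolding A_def by (intro sets.Int fmeasurableD[OF Rf]) blast
    have Af: "A i \<in> fmeasurable ?H" for i by (rule fmeasurableI2[OF Rf _ Ab]) (simp add: A_def)
    have AB: "A i \<subseteq> R \<inter> B i" for i using disjointed_subset[of B i] by (auto simp: A_def)
    have disjA: "A i \<inter> A j = {}" if "i \<noteq> j" for i j
      using disjoint_family_disjointed[of B] that unfolding A_def disjoint_family_on_def by blast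
    have UA: "(\<Union>i. A i) = R" using RB UN_disjointed_eq[of B] unfolding A_def by blast
    have "(\<lambda>m. measure ?H (\<Union>i<m. A i)) \<longlonglongrightarrow> measure ?H (\<Union>m. \<Union>i<m. A i)"
    proof (rule Lim_measure_incseq)
      show "incseq (\<lambda>m. \<Union>i<m. A i)" by (intro incseq_SucI) (auto simp: lessThan_Suc)
      have "(\<Union>m. \<Union>i<m. A i) \<subseteq> R" using AB by blast
      then have "emeasure ?H (\<Union>m. \<Union>i<m. A i) \<le> emeasure ?H R" using fmeasurableD[OF Rf] by (intro emeasure_mono) auto
      then show "emeasure ?H (\<Union>m. \<Union>i<m. A i) \<noteq> \<infinity>" using Rf by (auto simp: fmeasurable_def top_unique)
    qed (use Ab in auto)
    also have "(\<Union>m. \<Union>i<m. A i) = R" unfolding UA[symmetric] by blast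
    finally have "\<forall>\<^sub>F m in sequentially. measure ?H R - \<eta> / 2 < measure ?H (\<Union>i<m. A i)"
      using \<eta> by (intro order_tendstoD) auto
    then obtain m where m: "measure ?H R - \<eta> / 2 < measure ?H (\<Union>i<m. A i)" by (auto simp: eventually_sequentially)
    \<comment> \<open>Half of \<eta> was spent on truncating the sequence; the \<open>m\<close>
      losses here add up to at most the other half.\<close>
    have "\<forall>i. \<exists>K. compact K \<and> K \<subseteq> A i \<and> measure ?H (A i) - \<eta> / (2 * real (Suc m)) < measure ?H K"
    proof
      fix i
      have "\<eta> / (2 * real (Suc m)) > 0" using \<eta> by simp
      then show "\<exists>K. compact K \<and> K \<subseteq> A i \<and> measure ?H (A i) - \<eta> / (2 * real (Suc m)) < measure ?H K"
        using inner_regular_fmeasurable[OF sets_hausdorff_measure Af[of i]] by metis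
    qed
    then obtain K where K: "\<And>i. compact (K i)" "\<And>i. K i \<subseteq> A i"
      "\<And>i. measure ?H (A i) - \<eta> / (2 * real (Suc m)) < measure ?H (K i)" by metis
    have Kb: "K i \<in> sets ?H" for i using K(1) by (simp add: compact_imp_closed)
    have rest: "measure ?H (frontier M - (\<Union>i<m. K i)) \<le> \<eta>"
    proof -
      have sub: "frontier M - (\<Union>i<m. K i) \<subseteq> Sing M \<union> ((R - (\<Union>i<m. A i)) \<union> (\<Union>i<m. A i - K i))"
        by (auto simp: R_def)
      have meas: "Sing M \<in> sets ?H" "R - (\<Union>i<m. A i) \<in> sets ?H" "(\<Union>i<m. A i - K i) \<in> sets ?H"
        using Sb Ab Kb fmeasurableD[OF Rf] by (auto intro!: sets.Diff sets.finite_UN)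
      have "measure ?H (frontier M - (\<Union>i<m. K i)) \<le> measure ?H (Sing M \<union> ((R - (\<Union>i<m. A i)) \<union> (\<Union>i<m. A i - K i)))"
      proof (rule measure_mono_fmeasurable[OF sub])
        show "frontier M - (\<Union>i<m. K i) \<in> sets ?H" using fmeasurableD[OF F] Kb by auto
        show "Sing M \<union> ((R - (\<Union>i<m. A i)) \<union> (\<Union>i<m. A i - K i)) \<in> fmeasurable ?H"
          by (rule fmeasurableI2[OF F]) (use meas AB in \<open>auto simp: R_def Sing_def\<close>)
      qed
      also have "\<dots> \<le> measure ?H (Sing M) + measure ?H ((R - (\<Union>i<m. A i)) \<union> (\<Union>i<m. A i - K i))"
        using meas by (intro measure_Un_le) auto
      also have "\<dots> \<le> measure ?H (Sing M) + (measure ?H (R - (\<Union>i<m. A i)) + measure ?H (\<Union>i<m. A i - K i))"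
        using meas by (intro add_left_mono measure_Un_le) auto
      also have "measure ?H (R - (\<Union>i<m. A i)) = measure ?H R - measure ?H (\<Union>i<m. A i)"
        using AB Ab Af Rf by (intro measurable_measure_Diff) (auto intro!: fmeasurable.finite_UN sets.finite_UN)
      also have "measure ?H (\<Union>i<m. A i - K i) \<le> (\<Sum>i<m. measure ?H (A i - K i))"
        using Ab Kb by (intro measure_UNION_le) auto
      also have "\<dots> \<le> (\<Sum>i<m. \<eta> / (2 * real (Suc m)))"
      proof (rule sum_mono)
        fix i
        have "measure ?H (A i - K i) = measure ?H (A i) - measure ?H (K i)"
          using K(2) Kb Af by (intro measurable_measure_Diff) auto
        then show "measure ?H (A i - K i) \<le> \<eta> / (2 * real (Suc m))" using K(3)[of i] by simp
      qed
      also have "\<dots> \<le> \<eta> / 2" using \<eta> by (simp add: field_simps)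
      finally show ?thesis using m null by simp
    qed
    have KB: "K i \<subseteq> B i" for i using K(2)[of i] AB[of i] by blast
    have "\<forall>\<^sub>F \<rho> in at_right 0. \<forall>i<m. \<forall>a\<in>K i. \<forall>y\<in>- B i. \<rho> \<le> dist a y"
    proof -
      have "\<forall>\<^sub>F \<rho> in at_right 0. \<forall>i\<in>{..<m}. \<forall>a\<in>K i. \<forall>y\<in>- B i. \<rho> \<le> dist a y"
        using KB by (intro eventually_ball_finite ballI eventually_separated_compact_closed K) (auto simp: B_def)
      then show ?thesis by (rule eventually_mono) auto
    qed
    moreover have "\<forall>\<^sub>F \<rho> in at_right 0. \<forall>i<m. \<forall>j<m. i \<noteq> j \<longrightarrow> (\<forall>a\<in>K i. \<forall>b\<in>K j. \<rho> \<le> dist a b)"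
    proof -
      have "\<forall>\<^sub>F \<rho> in at_right 0. i \<noteq> j \<longrightarrow> (\<forall>a\<in>K i. \<forall>b\<in>K j. \<rho> \<le> dist a b)" for i j
      proof (cases "i = j")
        case False
        then have "K i \<inter> K j = {}" using disjA[OF False] K(2)[of i] K(2)[of j] by blast
        then have "\<forall>\<^sub>F \<rho> in at_right 0. (\<forall>a\<in>K i. \<forall>b\<in>K j. \<rho> \<le> dist a b)"
          by (intro eventually_separated_compact_closed K compact_imp_closed)
        then show ?thesis by eventually_elim simp
      qed simp
      then have "\<forall>\<^sub>F \<rho> in at_right 0. \<forall>i\<in>{..<m}. \<forall>j\<in>{..<m}. i \<noteq> j \<longrightarrow> (\<forall>a\<in>K i. \<forall>b\<in>K j. \<rho> \<le> dist a b)"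
        by (intro eventually_ball_finite ballI) auto
      then show ?thesis by (rule eventually_mono) auto
    qed
    moreover have "\<forall>\<^sub>F \<rho>::real in at_right 0. 0 < \<rho>" by (rule eventually_at_right_less)
    ultimately have "\<forall>\<^sub>F \<rho> in at_right 0. (\<forall>i<m. \<forall>a\<in>K i. \<forall>y\<in>- B i. \<rho> \<le> dist a y) \<and>
      (\<forall>i<m. \<forall>j<m. i \<noteq> j \<longrightarrow> (\<forall>a\<in>K i. \<forall>b\<in>K j. \<rho> \<le> dist a b)) \<and> 0 < \<rho>"
      by eventually_elim blast
    then obtain \<rho>0 where \<rho>0: "\<forall>i<m. \<forall>a\<in>K i. \<forall>y\<in>- B i. \<rho>0 \<le> dist a y"
      "\<forall>i<m. \<forall>j<m. i \<noteq> j \<longrightarrow> (\<forall>a\<in>K i. \<forall>b\<in>K j. \<rho>0 \<le> dist a b)" "0 < \<rho>0"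
      using eventually_happens'[OF trivial_limit_at_right_real] by blast
    \<comment> \<open>Points within \<rho> of a thickened piece stay within
      \<open>2 * \<rho>\<close> of the original one, inside its chart ball. Thickening two pieces by
      \<rho> leaves a distance of at least \<open>6 * \<rho>\<close>.\<close>
    define \<rho> where "\<rho> = \<rho>0 / 8"
    have \<rho>: "\<rho> > 0" using \<rho>0 by (simp add: \<rho>_def)
    \<comment> \<open>What the compact sets \<open>K i\<close> leave over need not be closed. The
      pieces are thickened so that removing open balls around the \<open>K i\<close> gives a compact
      remainder \<open>T\<close>, still disjoint from them and hence of small measure.\<close>
    define E where "E i = frontier M \<inter> thicken (K i) \<rho>" for i
    define T where "T = frontier M - (\<Union>i<m. \<Union>a\<in>K i. ball a \<rho>)"
    have piece: "chart_piece M \<delta> \<rho> (u (x i)) (\<phi>0 (x i)) (E i)" if i: "i < m" for i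
    proof -
      have inB: "y \<in> B i" if a: "a \<in> K i" "dist a y < \<rho>0" for a y
        using \<rho>0(1) i a by (meson ComplI not_le)
      have EB: "y \<in> B i" if e: "e \<in> E i" "dist e y < \<rho>" for e y
      proof -
        obtain a where a: "a \<in> K i" "dist a e \<le> \<rho>" using e(1) unfolding E_def thicken_def by blast
        have "dist a y \<le> dist a e + dist e y" by (rule dist_triangle)
        then have "dist a y < \<rho>0" using a(2) e(2) \<rho> \<rho>_def by linarith
        then show ?thesis by (rule inB[OF a(1)])
      qed
      have cx: "lipschitz_graph (u (x i)) (\<phi>0 (x i)) \<delta>"
        "\<forall>y\<in>B i. (y \<in> frontier M \<longleftrightarrow> lipschitz_graph.height (u (x i)) (\<phi>0 (x i)) y = 0) \<and>
       (y \<in> M \<longleftrightarrow> lipschitz_graph.height (u (x i)) (\<phi>0 (x i)) y \<le> 0) \<and>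
       (y \<in> frontier M \<longrightarrow> smooth_boundary_point M y \<and> norm (u y - u (x i)) \<le> \<delta>)"
        using bspec[OF ch xR[of i]] unfolding B_def by blast+
      have "compact (E i)" unfolding E_def by (intro compact_Int cF compact_thicken K)
      moreover have "E i \<subseteq> frontier M" by (simp add: E_def)
      moreover have "\<forall>y. (\<exists>e\<in>E i. dist e y < \<rho>) \<longrightarrow> (y \<in> frontier M \<longleftrightarrow> lipschitz_graph.height (u (x i)) (\<phi>0 (x i)) y = 0) \<and>
          (y \<in> M \<longleftrightarrow> lipschitz_graph.height (u (x i)) (\<phi>0 (x i)) y \<le> 0)"
        using EB cx(2) by blast
      moreover have "\<forall>y\<in>E i. smooth_boundary_point M y \<and> norm (outer_unit_normal M y - u (x i)) \<le> \<delta>"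
      proof
        fix y assume y: "y \<in> E i"
        have "y \<in> B i" using EB[OF y, of y] \<rho> by simp
        moreover have "y \<in> frontier M" using y by (simp add: E_def)
        ultimately show "smooth_boundary_point M y \<and> norm (outer_unit_normal M y - u (x i)) \<le> \<delta>"
          using cx(2) unfolding u_def by blast
      qed
      ultimately show ?thesis unfolding chart_piece_def using cx(1) by blast
    qed
    have sep: "2 * \<rho> \<le> dist a b" if ij: "i < m" "j < m" "i \<noteq> j" and ab: "a \<in> E i" "b \<in> E j" for i j a b
    proof -
      obtain a' where a': "a' \<in> K i" "dist a' a \<le> \<rho>" using ab(1) unfolding E_def thicken_def by blast
      obtain b' where b': "b' \<in> K j" "dist b' b \<le> \<rho>" using ab(2) unfolding E_def thicken_def by blast
      have "\<rho>0 \<le> dist a' b'" using \<rho>0(2) ij a'(1) b'(1) by blast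
      moreover have "dist a' b' \<le> dist a' a + dist a b + dist b' b"
        using dist_triangle[of a' b' a] dist_triangle[of a b' b] by (simp add: dist_commute)
      ultimately show ?thesis using a'(2) b'(2) \<rho> \<rho>_def by linarith
    qed
    have cT: "compact T" unfolding T_def by (intro compact_diff cF open_UN ballI) auto
    have TF: "T \<subseteq> frontier M" by (auto simp: T_def)
    have FT: "frontier M - (\<Union>i<m. E i) \<subseteq> T"
    proof
      fix y assume y: "y \<in> frontier M - (\<Union>i<m. E i)"
      have "y \<notin> ball a \<rho>" if i: "i < m" and a: "a \<in> K i" for i a
      proof
        assume "y \<in> ball a \<rho>"
        then have "y \<in> E i" using y a unfolding E_def thicken_def by force
        then show False using y i by blast
      qed
      then show "y \<in> T" using y unfolding T_def by blast
    qed
    have "measure ?H T \<le> measure ?H (frontier M - (\<Union>i<m. K i))"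
    proof (rule measure_mono_fmeasurable)
      show "T \<subseteq> frontier M - (\<Union>i<m. K i)" unfolding T_def using \<rho> by force
      show "T \<in> sets ?H" using cT by (simp add: compact_imp_closed)
      show "frontier M - (\<Union>i<m. K i) \<in> fmeasurable ?H"
        by (rule fmeasurableI2[OF F]) (use fmeasurableD[OF F] Kb in auto)
    qed
    then have "measure ?H T \<le> \<eta>" using rest by linarith
    then show ?thesis using \<rho> piece sep cT TF FT
      by (intro exI[of _ m] exI[of _ "\<lambda>i. u (x i)"] exI[of _ "\<lambda>i. \<phi>0 (x i)"] exI[of _ E] exI[of _ \<rho>] exI[of _ T]) blast
  qed
qed

section \<open>The derivative of the volume\<close>

text \<open>Localises a difference of volumes to disjoint sets \<open>W i\<close>, with the
  discrepancy elsewhere confined to \<open>Nb\<close>. It serves for \<open>A \<epsilon>\<close>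
  against \<open>M\<close> and for \<open>M\<close> against \<open>B \<epsilon>\<close>.\<close>

lemma measure_diff_partition:
  fixes A M' :: "'a::euclidean_space set" and m :: nat
  assumes A: "A \<in> fmeasurable lborel" and M: "M' \<in> fmeasurable lborel" and Nb: "Nb \<in> fmeasurable lborel"
    and W: "\<And>i. i < m \<Longrightarrow> W i \<in> sets borel" and disj: "\<And>i j. i < m \<Longrightarrow> j < m \<Longrightarrow> i \<noteq> j \<Longrightarrow> W i \<inter> W j = {}"
    and sub: "A - (\<Union>i<m. W i) \<subseteq> M' \<union> Nb"
  shows "vol A - vol M' \<le> (\<Sum>i<m. vol (A \<inter> W i) - vol (M' \<inter> W i)) + vol Nb"
proof -
  let ?W = "\<Union>i<m. W i"
  have Wb: "?W \<in> sets lborel" using W by auto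
  have split: "vol X = (\<Sum>i<m. vol (X \<inter> W i)) + vol (X - ?W)"
    if X: "X \<in> fmeasurable lborel" for X :: "'a set"
  proof -
    have XW: "X \<inter> W i \<in> fmeasurable lborel" if "i < m" for i
      by (rule fmeasurableI2[OF X]) (use W[OF that] fmeasurableD[OF X] in auto)
    have XWW: "X \<inter> ?W \<in> fmeasurable lborel" "X - ?W \<in> fmeasurable lborel"
      using Wb fmeasurableD[OF X] by (auto intro!: fmeasurableI2[OF X])
    have "vol ((X \<inter> ?W) \<union> (X - ?W)) = vol (X \<inter> ?W) + vol (X - ?W)"
      by (intro measure_Un_AE XWW AE_I2) auto
    moreover have "(X \<inter> ?W) \<union> (X - ?W) = X" by blast
    moreover have "vol (\<Union>i<m. X \<inter> W i) = (\<Sum>i<m. vol (X \<inter> W i))"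
    proof (rule measure_finite_Union)
      show "disjoint_family_on (\<lambda>i. X \<inter> W i) {..<m}" using disj unfolding disjoint_family_on_def by blast
      show "(\<lambda>i. X \<inter> W i) ` {..<m} \<subseteq> sets lborel" using XW fmeasurableD by blast
      show "emeasure lborel (X \<inter> W i) \<noteq> \<infinity>" if "i \<in> {..<m}" for i
        using XW[of i] that by (auto simp: fmeasurable_def)
    qed simp
    moreover have "(\<Union>i<m. X \<inter> W i) = X \<inter> ?W" by blast
    ultimately show ?thesis by simp
  qed
  have "vol (A - ?W) \<le> vol ((M' - ?W) \<union> Nb)"
    using fmeasurableD[OF A] fmeasurableD[OF M] Wb Nb sub
    by (intro measure_mono_fmeasurable fmeasurable.Un Nb fmeasurableI2[OF M]) auto
  also have "\<dots> \<le> vol (M' - ?W) + vol Nb"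
    using fmeasurableD[OF M] fmeasurableD[OF Nb] Wb by (intro measure_Un_le) auto
  finally show ?thesis using split[OF A] split[OF M] by (simp add: sum_subtractf)
qed

lemma segment_meets_frontier:
  fixes M :: "'a::euclidean_space set"
  assumes "x \<in> M" "y \<notin> M" obtains z where "z \<in> frontier M" "dist z y \<le> dist x y" "dist z x \<le> dist x y"
proof -
  have "closed_segment x y \<inter> frontier M \<noteq> {}"
    by (rule connected_Int_frontier) (use assms in auto)
  then obtain z where z: "z \<in> closed_segment x y" "z \<in> frontier M" by blast
  have "dist z y \<le> dist x y" "dist z x \<le> dist x y"
    using dist_in_closed_segment[OF z(1)] by (auto simp: dist_commute)
  then show thesis using that z(2) by blast
qed

lemma set_plus_scaleR: "M + (*\<^sub>R) \<epsilon> ` K = scaled_sum M \<epsilon> K"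
  by (auto simp: set_plus_def)

lemma volume_between:
  fixes S :: "'a::euclidean_space set"
  assumes "open B" "compact A" "B \<subseteq> S" "S \<subseteq> A"
  shows "vol B \<le> volume S" "volume S \<le> vol A"
proof -
  have vb: "volume B = vol B" "volume A = vol A"
    using assms by (auto simp: volume_eq_measure compact_imp_closed)
  have A: "outer_measure_of lebesgue A = emeasure lborel A"
    using assms(2) by (simp add: compact_imp_closed)
  have fin: "outer_measure_of lebesgue A < top"
    unfolding A using compact_fmeasurable_lborel[OF assms(2)] by (auto simp: fmeasurable_def)
  have "outer_measure_of lebesgue S \<le> outer_measure_of lebesgue A" by (rule outer_measure_of_mono[OF assms(4)])
  then show "volume S \<le> vol A"
    unfolding vb(2)[symmetric] volume_def using fin by (rule enn2real_mono)
  have "outer_measure_of lebesgue S < top" using fin outer_measure_of_mono[OF assms(4)] by (rule le_less_trans[rotated])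
  then show "vol B \<le> volume S"
    unfolding vb(1)[symmetric] volume_def by (intro enn2real_mono outer_measure_of_mono[OF assms(3)])
qed

section \<open>The compact outer sum, the open inner sum, and their volume estimates\<close>

locale piecewise_C1_sum =
  fixes M N :: "'a::euclidean_space set" and \<Q> :: "('a \<times> ('a \<Rightarrow> real) \<times> 'a set) set" and C :: real
  assumes M: "compact M" and pieces: "graph_pieces \<Q> (frontier M)"
    and Sing0: "measure surface_measure (Sing M) = 0"
    and N: "N \<noteq> {}" "\<And>p. p \<in> N \<Longrightarrow> norm p \<le> C" and C: "C > 0"
begin

definition K :: "'a set" where "K = closure (convex hull N)"
definition h :: "'a \<Rightarrow> real" where "h = support_function N"
definition A :: "real \<Rightarrow> 'a set" where "A \<epsilon> = scaled_sum M \<epsilon> K"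
definition B :: "real \<Rightarrow> 'a set" where "B \<epsilon> = scaled_sum (interior M) \<epsilon> N"

lemma N_inner_le: "p \<in> N \<Longrightarrow> \<bar>p \<bullet> u\<bar> \<le> C * norm u"
  using Cauchy_Schwarz_ineq2[of p u] mult_right_mono[OF N(2) norm_ge_zero] by (rule order.trans)

lemma bdd_above_inner: "bdd_above ((\<lambda>p. p \<bullet> u) ` N)"
  by (rule bdd_aboveI2[where M="C * norm u"]) (use N_inner_le in \<open>auto simp: abs_le_iff\<close>)

lemma h_upper: "p \<in> N \<Longrightarrow> p \<bullet> u \<le> h u"
  unfolding h_def support_function_def by (rule cSUP_upper[OF _ bdd_above_inner])

lemma h_least: "(\<And>p. p \<in> N \<Longrightarrow> p \<bullet> u \<le> c) \<Longrightarrow> h u \<le> c"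
  unfolding h_def support_function_def by (rule cSUP_least[OF N(1)])

lemma h_abs_le: "\<bar>h u\<bar> \<le> C * norm u"
proof -
  obtain p where p: "p \<in> N" using N by blast
  have "- (C * norm u) \<le> h u" using N_inner_le[OF p, of u] h_upper[OF p, of u] by linarith
  moreover have "h u \<le> C * norm u" by (rule h_least) (use N_inner_le in \<open>auto simp: abs_le_iff\<close>)
  ultimately show ?thesis by linarith
qed

text \<open>A supremum of linear functions of norm at most \<open>C\<close>. It controls the error
  of replacing normals by the fixed normal of a chart.\<close>

lemma h_lipschitz: "\<bar>h u - h v\<bar> \<le> C * norm (u - v)"
proof -
  have le: "h u \<le> h v + C * norm (u - v)" for u v
  proof (rule h_least)
    fix p assume p: "p \<in> N"
    have "p \<bullet> u = p \<bullet> v + p \<bullet> (u - v)" by (simp add: inner_diff_right)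
    then show "p \<bullet> u \<le> h v + C * norm (u - v)" using N_inner_le[OF p, of "u - v"] h_upper[OF p, of v] by linarith
  qed
  show ?thesis using le[of u v] le[of v u] by (simp add: norm_minus_commute abs_le_iff)
qed

lemma h_near: "\<eta> > 0 \<Longrightarrow> \<exists>p\<in>N. h u - \<eta> \<le> p \<bullet> u"
  using less_cSUP_iff[OF N(1) bdd_above_inner, of "h u - \<eta>" u] unfolding h_def support_function_def
  by (auto intro: less_imp_le)

lemma K_subset_closed_convex: "closed X \<Longrightarrow> convex X \<Longrightarrow> N \<subseteq> X \<Longrightarrow> K \<subseteq> X"
  unfolding K_def by (intro closure_minimal hull_minimal) auto

lemma K_norm: "p \<in> K \<Longrightarrow> norm p \<le> C"
  using K_subset_closed_convex[of "cball 0 C"] N(2) by (auto simp: subset_iff)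

lemma K_inner: "p \<in> K \<Longrightarrow> p \<bullet> u \<le> h u"
proof -
  assume p: "p \<in> K"
  have "N \<subseteq> {x. u \<bullet> x \<le> h u}" using h_upper[of _ u] by (auto simp: inner_commute)
  then have "K \<subseteq> {x. u \<bullet> x \<le> h u}" by (rule K_subset_closed_convex[OF closed_halfspace_le convex_halfspace_le])
  then show ?thesis using p by (auto simp: inner_commute)
qed

lemma N_subset_K: "N \<subseteq> convex hull N" "convex hull N \<subseteq> K"
  unfolding K_def by (auto simp: hull_subset closure_subset)

lemma compact_K: "compact K"
proof -
  have "K \<subseteq> cball 0 C" using K_norm by auto
  then have "bounded K" using bounded_cball bounded_subset by blast
  then show ?thesis unfolding compact_eq_bounded_closed by (simp add: K_def)
qed

lemma compact_A: "compact (A \<epsilon>)"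
proof -
  have "A \<epsilon> = {x + y | x y. x \<in> M \<and> y \<in> (*\<^sub>R) \<epsilon> ` K}" unfolding A_def by auto
  then show ?thesis using compact_sums[OF M compact_scaling[OF compact_K]] by simp
qed

lemma open_B: "open (B \<epsilon>)"
proof -
  have "B \<epsilon> = (\<Union>p\<in>N. (+) (\<epsilon> *\<^sub>R p) ` interior M)" unfolding B_def by (auto simp: add.commute image_def)
  then show ?thesis by (simp add: open_UN open_translation)
qed

lemma B_subset_A: "B \<epsilon> \<subseteq> A \<epsilon>"
  unfolding A_def B_def using interior_subset N_subset_K by blast

lemma fm: "A \<epsilon> \<in> fmeasurable lborel" "B \<epsilon> \<in> fmeasurable lborel" "M \<in> fmeasurable lborel"
  using compact_fmeasurable_lborel[OF compact_A] compact_fmeasurable_lborel[OF M] open_B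
  by (auto intro!: fmeasurableI2[OF compact_fmeasurable_lborel[OF compact_A] B_subset_A])

lemma near_frontier_A:
  assumes "y \<in> A \<epsilon>" "y \<notin> M" "\<epsilon> > 0" shows "\<exists>z\<in>frontier M. dist z y \<le> C * \<epsilon>"
proof -
  obtain x p where x: "x \<in> M" "p \<in> K" "y = x + \<epsilon> *\<^sub>R p" using assms(1) unfolding A_def by blast
  obtain z where z: "z \<in> frontier M" "dist z y \<le> dist x y" by (rule segment_meets_frontier[OF x(1) assms(2)])
  have "dist x y \<le> C * \<epsilon>" using K_norm[OF x(2)] assms(3) by (simp add: x(3) dist_norm mult.commute[of C])
  then show ?thesis using z by (meson order.trans)
qed

text \<open>Subtracting a multiple of any vector of \<open>N\<close> from \<open>y\<close> gives a
  point outside the interior of \<open>M\<close>; the segment to it reaches the boundary within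
  \<open>C * \<epsilon>\<close>.\<close>

lemma near_frontier_B:
  assumes "y \<in> M" "y \<notin> B \<epsilon>" "\<epsilon> > 0" shows "\<exists>z\<in>frontier M. dist z y \<le> C * \<epsilon>"
proof -
  obtain p where p: "p \<in> N" using N by blast
  define x where "x = y - \<epsilon> *\<^sub>R p"
  have xi: "x \<notin> interior M" using assms(2) p unfolding B_def x_def by force
  have d: "dist y x \<le> C * \<epsilon>" using N(2)[OF p] assms(3) by (simp add: x_def dist_norm mult.commute[of C])
  show ?thesis
  proof (cases "x \<in> M")
    case True
    then have "x \<in> frontier M" using xi closure_subset by (auto simp: frontier_def)
    then show ?thesis using d by (auto simp: dist_commute)
  next
    case False
    obtain z where z: "z \<in> frontier M" "dist z y \<le> dist y x" by (rule segment_meets_frontier[OF assms(1) False])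
    then show ?thesis using d by (meson order.trans)
  qed
qed

text \<open>If the near boundary point \<open>z\<close> lies in a piece \<open>E i\<close>, the
  chart puts the foot of \<open>y\<close> on the boundary. The foot is not in \<open>E i\<close>, as
  \<open>y\<close> is outside the slab, and not in another piece by separation, so it lies in
  \<open>T\<close>. The factor 2 bounds \<open>1 + \<delta>\<close>.\<close>

lemma outside_layers:
  fixes m :: nat
  assumes \<rho>: "\<rho> > 0" and E: "\<forall>i<m. chart_piece M \<delta> \<rho> (n i) (\<phi> i) (E i)"
    and sep: "\<forall>i<m. \<forall>j<m. i \<noteq> j \<longrightarrow> (\<forall>a\<in>E i. \<forall>b\<in>E j. 2 * \<rho> \<le> dist a b)"
    and T: "frontier M - (\<Union>i<m. E i) \<subseteq> T" and \<delta>1: "\<delta> \<le> 1"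
    and z: "z \<in> frontier M" "dist z y \<le> s" and s: "4 * s < \<rho>"
    and y: "\<forall>i<m. y \<notin> slab (n i) (\<phi> i) (E i) \<rho>"
  shows "y \<in> thicken T (2 * s)"
proof (cases "z \<in> T")
  case True
  have "0 \<le> s" using z(2) zero_le_dist[of z y] by linarith
  then show ?thesis using True z(2) unfolding thicken_def by force
next
  case False
  then obtain i where i: "i < m" "z \<in> E i" using T z(1) by blast
  have cp: "chart_piece M \<delta> \<rho> (n i) (\<phi> i) (E i)" using E i by blast
  interpret lipschitz_graph "n i" "\<phi> i" \<delta> using cp unfolding chart_piece_def by blast
  have loc: "y \<in> frontier M \<longleftrightarrow> height y = 0" if "dist e y < \<rho>" "e \<in> E i" for y e
    using cp that unfolding chart_piece_def by blast
  have s0: "0 \<le> s" using z(2) zero_le_dist[of z y] by linarith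
  have zg: "z \<in> graph" using loc[of z z] i(2) \<rho> z(1) by (simp add: graph_def)
  have "(1 + \<delta>) * s \<le> 2 * s" using \<delta>1 s0 by (intro mult_right_mono) auto
  then have near: "\<bar>height y\<bar> \<le> 2 * s" "dist z (foot y) \<le> 2 * s" using near_graph[OF zg z(2)] by linarith+
  have fF: "foot y \<in> frontier M" using loc[of z "foot y"] near(2) i(2) s s0 by simp
  have "foot y \<notin> E i" using y i(1) near(1) s s0 by (auto simp: layer_def abs_le_iff)
  moreover have "foot y \<notin> E j" if j: "j < m" "j \<noteq> i" for j
  proof
    assume "foot y \<in> E j"
    then have "2 * \<rho> \<le> dist z (foot y)" using sep i j by blast
    then show False using near(2) s s0 \<rho> by linarith
  qed
  ultimately have "foot y \<in> T" using T fF by blast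
  moreover have "dist (foot y) y \<le> 2 * s" using dist_foot[of y] near(1) by (simp add: dist_commute)
  ultimately show ?thesis unfolding thicken_def by blast
qed

lemma layers_disjoint:
  fixes m :: nat
  assumes \<rho>: "\<rho> > 0" and E: "\<forall>i<m. chart_piece M \<delta> \<rho> (n i) (\<phi> i) (E i)"
    and sep: "\<forall>i<m. \<forall>j<m. i \<noteq> j \<longrightarrow> (\<forall>a\<in>E i. \<forall>b\<in>E j. 2 * \<rho> \<le> dist a b)"
    and ij: "i < m" "j < m" "i \<noteq> j"
  shows "slab (n i) (\<phi> i) (E i) \<rho> \<inter>
    slab (n j) (\<phi> j) (E j) \<rho> = {}"
proof -
  have foot: "\<exists>e\<in>E i. dist y e \<le> \<rho> / 2" if i: "i < m" and y: "y \<in> slab (n i) (\<phi> i) (E i) \<rho>" for i y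
  proof -
    interpret lipschitz_graph "n i" "\<phi> i" \<delta> using E i unfolding chart_piece_def by blast
    show ?thesis using y dist_foot[of y] by (intro bexI[of _ "foot y"]) (auto simp: layer_def abs_le_iff)
  qed
  have False if y: "y \<in> slab (n i) (\<phi> i) (E i) \<rho>"
    "y \<in> slab (n j) (\<phi> j) (E j) \<rho>" for y
  proof -
    obtain a where a: "a \<in> E i" "dist y a \<le> \<rho> / 2" using foot[OF ij(1) y(1)] by blast
    obtain b where b: "b \<in> E j" "dist y b \<le> \<rho> / 2" using foot[OF ij(2) y(2)] by blast
    have "2 * \<rho> \<le> dist a b" using sep ij a b by blast
    then show False using a(2) b(2) dist_triangle3[of a b y] \<rho> by linarith
  qed
  then show ?thesis by blast
qed

lemma F_fmeasurable: "frontier M \<in> fmeasurable surface_measure"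
  by (rule graph_pieces_finite_measure[OF pieces])

lemma eventually_small: "c > 0 \<Longrightarrow> \<forall>\<^sub>F \<epsilon> in at_right 0. \<epsilon> * b < (c :: real)"
proof -
  assume c: "c > 0"
  have "((\<lambda>\<epsilon>. \<epsilon> * b) \<longlongrightarrow> 0 * b) (at_right 0)" by (intro tendsto_intros)
  then show ?thesis using c by (intro order_tendstoD) auto
qed

text \<open>Inside the slabs the local bounds apply. Outside them, \<open>M\<close> and both sums
  differ only near the boundary, hence near \<open>T\<close>, whose neighbourhood has volume of
  order \<epsilon> \<eta>.\<close>

lemma estimate:
  fixes m :: nat
  assumes \<rho>: "\<rho> > 0" and E: "\<forall>i<m. chart_piece M \<delta> \<rho> (n i) (\<phi> i) (E i)"
    and sep: "\<forall>i<m. \<forall>j<m. i \<noteq> j \<longrightarrow> (\<forall>a\<in>E i. \<forall>b\<in>E j. 2 * \<rho> \<le> dist a b)"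
    and T: "compact T" "T \<subseteq> frontier M" "frontier M - (\<Union>i<m. E i) \<subseteq> T" "measure surface_measure T \<le> \<eta>"
    and \<delta>1: "0 < \<delta>" "\<delta> \<le> 1" and \<eta>: "0 < \<eta>"
  defines "a \<equiv> \<lambda>i. measure (lipschitz_graph.area (n i) (\<phi> i)) (E i)"
  shows "\<forall>\<^sub>F \<epsilon> in at_right 0.
    (vol (A \<epsilon>) - vol M) / \<epsilon> \<le> (\<Sum>i<m. (h (n i) + \<delta> * C + 2 * \<eta>) * a i) + 24 * real (card \<Q>) * C * \<eta> \<and>
    (\<Sum>i<m. (h (n i) - \<delta> * C - 2 * \<eta>) * a i) - 24 * real (card \<Q>) * C * \<eta> \<le> (vol (B \<epsilon>) - vol M) / \<epsilon>"
proof -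
  have ev1: "\<forall>\<^sub>F \<epsilon> in at_right 0. \<epsilon> * (C + \<delta> * C + \<eta>) < \<rho> / 2" using \<rho> by (intro eventually_small) simp
  have ev2: "\<forall>\<^sub>F \<epsilon> in at_right 0. \<epsilon> * (4 * C) < \<rho>" using \<rho> by (rule eventually_small)
  have ev3: "\<forall>\<^sub>F \<epsilon> in at_right 0. vol (thicken T (2 * C * \<epsilon>)) \<le> 6 * real (card \<Q>) * (2 * C * \<epsilon>) * (measure surface_measure T + \<eta>)"
  proof -
    obtain b where b: "b > 0" "\<And>\<epsilon>. 0 < \<epsilon> \<Longrightarrow> \<epsilon> < b \<Longrightarrow>
        vol (thicken T \<epsilon>) \<le> 6 * real (card \<Q>) * \<epsilon> * (measure surface_measure T + \<eta>)"
      using graph_pieces_content_le[OF pieces T(1,2) \<eta>] unfolding eventually_at_right_field by blast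
    show ?thesis
    proof (rule eventually_at_rightI[of 0 "b / (2 * C)"])
      fix \<epsilon> assume "\<epsilon> \<in> {0<..<b / (2 * C)}"
      then have "0 < 2 * C * \<epsilon>" "2 * C * \<epsilon> < b" using C by (auto simp: field_simps)
      then show "vol (thicken T (2 * C * \<epsilon>)) \<le> 6 * real (card \<Q>) * (2 * C * \<epsilon>) * (measure surface_measure T + \<eta>)"
        by (rule b(2))
    qed (use b C in simp)
  qed
  show ?thesis
    using ev1 ev2 ev3 eventually_at_right_less[of "0::real"]
  proof eventually_elim
    case (elim \<epsilon>)
    note \<epsilon> = elim(4)
    define W where "W i = slab (n i) (\<phi> i) (E i) \<rho>" for i
    define Nb where "Nb = thicken T (2 * (C * \<epsilon>))"
    have Nb: "Nb \<in> fmeasurable lborel" unfolding Nb_def by (intro compact_fmeasurable_lborel compact_thicken T)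
    have Wb: "W i \<in> sets borel" if "i < m" for i
    proof -
      have cp: "chart_piece M \<delta> \<rho> (n i) (\<phi> i) (E i)" using E that by blast
      interpret lipschitz_graph "n i" "\<phi> i" \<delta> using cp unfolding chart_piece_def by blast
      show ?thesis unfolding W_def using cp by (intro layer_borel) (simp add: chart_piece_def compact_imp_closed)
    qed
    have Wd: "W i \<inter> W j = {}" if "i < m" "j < m" "i \<noteq> j" for i j
      unfolding W_def by (rule layers_disjoint[OF \<rho> E sep that])
    have out: "y \<in> Nb" if "z \<in> frontier M" "dist z y \<le> C * \<epsilon>" "y \<notin> (\<Union>i<m. W i)" for y z
      unfolding Nb_def
    proof (rule outside_layers[OF \<rho> E sep T(3) \<delta>1(2) that(1,2)])
      show "4 * (C * \<epsilon>) < \<rho>" using elim(2) by (simp add: mult_ac)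
    qed (use that(3) in \<open>auto simp: W_def\<close>)
    \<comment> \<open>The constant 24 is the content constant 6, times 2 from the radius
      \<open>2 * C * \<epsilon>\<close>, times 2 from the bound of measure plus \<eta> by
      \<open>2 * \<eta>\<close>.\<close>
    have NbC: "vol Nb \<le> \<epsilon> * (24 * real (card \<Q>) * C * \<eta>)"
    proof -
      have "vol Nb \<le> 6 * real (card \<Q>) * (2 * C * \<epsilon>) * (measure surface_measure T + \<eta>)"
        using elim(3) by (simp add: Nb_def mult.assoc)
      also have "\<dots> \<le> 6 * real (card \<Q>) * (2 * C * \<epsilon>) * (2 * \<eta>)"
        using T(4) C \<epsilon> by (intro mult_left_mono) auto
      finally show ?thesis by (simp add: mult_ac)
    qed
    have subA: "A \<epsilon> - (\<Union>i<m. W i) \<subseteq> M \<union> Nb" using near_frontier_A \<epsilon> out by blast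
    have subB: "M - (\<Union>i<m. W i) \<subseteq> B \<epsilon> \<union> Nb" using near_frontier_B \<epsilon> out by blast
    have up: "vol (A \<epsilon> \<inter> W i) - vol (M \<inter> W i) \<le> \<epsilon> * ((h (n i) + \<delta> * C + 2 * \<eta>) * a i)"
      and lo: "vol (M \<inter> W i) - vol (B \<epsilon> \<inter> W i) \<le> - \<epsilon> * ((h (n i) - \<delta> * C - 2 * \<eta>) * a i)"
      if i: "i < m" for i
    proof -
      have cp: "chart_piece M \<delta> \<rho> (n i) (\<phi> i) (E i)" using E i by blast
      interpret lipschitz_graph "n i" "\<phi> i" \<delta> using cp unfolding chart_piece_def by blast
      have cE: "compact (E i)" using cp unfolding chart_piece_def by blast
      have loc: "y \<in> M \<longleftrightarrow> height y \<le> 0" "y \<in> frontier M \<longleftrightarrow> height y = 0" if "\<exists>e\<in>E i. dist e y < \<rho>" for y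
        using cp that unfolding chart_piece_def by blast+
      have hC: "\<bar>h (n i)\<bar> \<le> C" using h_abs_le[of "n i"] n by simp
      have Mb: "M \<in> sets borel" using M by (simp add: compact_imp_closed)
      have a: "measure area (E i) = a i" by (simp add: a_def)
      have "vol (A \<epsilon> \<inter> W i) - vol (M \<inter> W i) \<le> \<epsilon> * (h (n i) + \<delta> * C + \<eta>) * measure area (E i)"
        unfolding A_def W_def
      proof (rule local_upper[OF cE loc(1) Mb])
        show "scaled_sum M \<epsilon> K \<in> sets borel"
          using compact_A[of \<epsilon>] unfolding A_def by (simp add: compact_imp_closed)
      qed (use K_norm K_inner C hC \<eta> \<epsilon> elim(1) \<delta>1 in auto)
      \<comment> \<open>The upper bound is relaxed to the margin of the lower one, so that both
        share one error term.\<close>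
      also have "\<dots> \<le> \<epsilon> * ((h (n i) + \<delta> * C + 2 * \<eta>) * a i)"
        unfolding a mult.assoc using \<epsilon> \<eta> by (intro mult_left_mono mult_right_mono) (auto simp: a_def)
      finally show "vol (A \<epsilon> \<inter> W i) - vol (M \<inter> W i) \<le> \<epsilon> * ((h (n i) + \<delta> * C + 2 * \<eta>) * a i)" .
      obtain p where p: "p \<in> N" "h (n i) - \<eta> \<le> p \<bullet> n i" using h_near[OF \<eta>] by blast
      have "vol (M \<inter> W i) - vol (B \<epsilon> \<inter> W i) \<le> - \<epsilon> * (h (n i) - \<delta> * C - 2 * \<eta>) * measure area (E i)"
        unfolding B_def W_def
      proof (rule local_lower[OF cE loc Mb p(1) N(2)[OF p(1)] p(2)])
        show "scaled_sum (interior M) \<epsilon> N \<in> sets borel"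
          using open_B[of \<epsilon>] unfolding B_def by simp
      qed (use C hC \<eta> \<epsilon> elim(1) \<delta>1 in auto)
      then show "vol (M \<inter> W i) - vol (B \<epsilon> \<inter> W i) \<le> - \<epsilon> * ((h (n i) - \<delta> * C - 2 * \<eta>) * a i)"
        unfolding a by (simp only: mult.assoc)
    qed
    have "vol (A \<epsilon>) - vol M \<le> (\<Sum>i<m. vol (A \<epsilon> \<inter> W i) - vol (M \<inter> W i)) + vol Nb"
      by (rule measure_diff_partition[OF fm(1,3) Nb Wb Wd subA])
    also have "\<dots> \<le> (\<Sum>i<m. \<epsilon> * ((h (n i) + \<delta> * C + 2 * \<eta>) * a i)) + \<epsilon> * (24 * real (card \<Q>) * C * \<eta>)"
      using up NbC by (intro add_mono sum_mono) auto
    also have "\<dots> = \<epsilon> * ((\<Sum>i<m. (h (n i) + \<delta> * C + 2 * \<eta>) * a i) + 24 * real (card \<Q>) * C * \<eta>)"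
      by (simp only: sum_distrib_left distrib_left)
    finally have 1: "vol (A \<epsilon>) - vol M \<le> \<epsilon> * ((\<Sum>i<m. (h (n i) + \<delta> * C + 2 * \<eta>) * a i) + 24 * real (card \<Q>) * C * \<eta>)" .
    have "vol M - vol (B \<epsilon>) \<le> (\<Sum>i<m. vol (M \<inter> W i) - vol (B \<epsilon> \<inter> W i)) + vol Nb"
      by (rule measure_diff_partition[OF fm(3,2) Nb Wb Wd subB])
    also have "\<dots> \<le> (\<Sum>i<m. - \<epsilon> * ((h (n i) - \<delta> * C - 2 * \<eta>) * a i)) + \<epsilon> * (24 * real (card \<Q>) * C * \<eta>)"
      using lo NbC by (intro add_mono sum_mono) auto
    also have "\<dots> = - (\<epsilon> * ((\<Sum>i<m. (h (n i) - \<delta> * C - 2 * \<eta>) * a i) - 24 * real (card \<Q>) * C * \<eta>))"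
      unfolding sum_distrib_left[symmetric] by (simp add: right_diff_distrib)
    finally have 2: "\<epsilon> * ((\<Sum>i<m. (h (n i) - \<delta> * C - 2 * \<eta>) * a i) - 24 * real (card \<Q>) * C * \<eta>) \<le> vol (B \<epsilon>) - vol M"
      by linarith
    show ?case using 1 2 \<epsilon> by (simp only: pos_divide_le_eq pos_le_divide_eq mult.commute[of \<epsilon>])
  qed
qed

end

text \<open>The unspecified normal is the same vector at all singular points, since the predicate under \<^const>\<open>The\<close> is
  the constant \<^const>\<open>False\<close>.\<close>

lemma outer_unit_normal_Sing:
  assumes "x \<in> Sing M" shows "outer_unit_normal M x = (THE u. False)"
proof -
  have "\<not> (\<exists>U f g. smooth_boundary_chart M x U f g)"
    using assms unfolding Sing_def smooth_boundary_point_def by blast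
  then have "(\<lambda>u. \<exists>U f g. smooth_boundary_chart M x U f g \<and> u = sgn (g x)) = (\<lambda>u. False)" by blast
  then show ?thesis unfolding outer_unit_normal_def by simp
qed

section \<open>The boundary integral and its approximation by pieces\<close>

lemma continuous_on_outer_unit_normal: "continuous_on (frontier M - Sing M) (outer_unit_normal M)"
  unfolding continuous_on_iff
proof (intro ballI allI impI)
  fix x and e :: real assume x: "x \<in> frontier M - Sing M" and e: "0 < e"
  then have sx: "smooth_boundary_point M x" by (simp add: Sing_def)
  have e2: "e / 2 > 0" using e by simp
  obtain r where r: "r > 0" "\<And>y. y \<in> ball x r \<Longrightarrow> y \<in> frontier M \<Longrightarrow> norm (outer_unit_normal M y - outer_unit_normal M x) \<le> e / 2"
    using smooth_point_chart[OF sx e2] by blast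
  show "\<exists>d>0. \<forall>x'\<in>frontier M - Sing M. dist x' x < d \<longrightarrow> dist (outer_unit_normal M x') (outer_unit_normal M x) < e"
  proof (intro exI conjI ballI impI)
    fix y assume "y \<in> frontier M - Sing M" "dist y x < r"
    then have "norm (outer_unit_normal M y - outer_unit_normal M x) \<le> e / 2" by (intro r(2)) (auto simp: dist_commute)
    then show "dist (outer_unit_normal M y) (outer_unit_normal M x) < e" using e by (simp add: dist_norm)
  qed (rule r(1))
qed

lemma norm_outer_unit_normal:
  assumes "smooth_boundary_point M x" shows "norm (outer_unit_normal M x) = 1"
proof -
  obtain \<phi> where "lipschitz_graph (outer_unit_normal M x) \<phi> 1" using smooth_point_chart[OF assms zero_less_one] by blast
  then show ?thesis by (rule lipschitz_graph.n)
qed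

text \<open>Used on a piece with the support value at its fixed normal as \<open>c\<close>, and on
  the remainder with \<open>c = 0\<close>.\<close>

lemma set_integral_near_const:
  fixes f :: "'a \<Rightarrow> real"
  assumes f: "set_integrable H E f" and E: "E \<in> fmeasurable H" and b: "\<And>x. x \<in> E \<Longrightarrow> \<bar>f x - c\<bar> \<le> b"
  shows "\<bar>(LINT x:E|H. f x) - c * measure H E\<bar> \<le> b * measure H E"
proof -
  have const: "set_integrable H E (\<lambda>_. d)" "(LINT x:E|H. d) = d * measure H E" for d :: real
  proof -
    show "set_integrable H E (\<lambda>_. d)" unfolding set_integrable_def
      using E by (intro integrable_scaleR_left integrable_real_indicator) (auto simp: fmeasurable_def)
    show "(LINT x:E|H. d) = d * measure H E"
      using E by (subst set_integral_const) (auto simp: fmeasurable_def less_top)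
  qed
  have "(LINT x:E|H. f x) \<le> (LINT x:E|H. c + b)"
    by (rule set_integral_mono[OF f const(1)]) (use b in \<open>force simp: abs_le_iff\<close>)
  moreover have "(LINT x:E|H. c - b) \<le> (LINT x:E|H. f x)"
    by (rule set_integral_mono[OF const(1) f]) (use b in \<open>force simp: abs_le_iff\<close>)
  ultimately show ?thesis unfolding const(2) by (simp add: abs_le_iff algebra_simps)
qed

context piecewise_C1_sum begin

abbreviation u :: "'a \<Rightarrow> 'a" where "u \<equiv> outer_unit_normal M"
text \<open>A bound for the integrand on the whole boundary, including the singular points, where
  the normal is one unspecified vector and may have any norm.\<close>

definition b0 :: real where "b0 = C * (1 + norm (THE u::'a. False))"
definition I :: real where "I = (LINT x:frontier M|surface_measure. h (u x))"

lemma hu_bound: "x \<in> frontier M \<Longrightarrow> \<bar>h (u x)\<bar> \<le> b0"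
proof -
  assume x: "x \<in> frontier M"
  have "norm (u x) \<le> 1 + norm (THE u::'a. False)"
  proof (cases "x \<in> Sing M")
    case True then show ?thesis by (simp add: outer_unit_normal_Sing)
  next
    case False
    then have "smooth_boundary_point M x" using x by (simp add: Sing_def)
    then show ?thesis by (simp add: norm_outer_unit_normal)
  qed
  then have "C * norm (u x) \<le> b0" unfolding b0_def using C by (intro mult_left_mono) auto
  then show ?thesis using h_abs_le[of "u x"] by linarith
qed

lemma continuous_h: "continuous_on UNIV h"
  by (rule lipschitz_on_continuous_on[where L=C], rule lipschitz_onI)
    (use h_lipschitz C in \<open>auto simp: dist_norm dist_real_def\<close>)

lemma borel_frontier: "frontier M \<in> sets borel" "frontier M - Sing M \<in> sets borel" "Sing M \<in> sets borel"
  by (auto simp: closed_Sing borel_closed)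

text \<open>The integrand is continuous on the smooth part and constant on the closed singular
  part.\<close>

lemma hu_measurable: "(\<lambda>x. indicator (frontier M) x *\<^sub>R h (u x)) \<in> borel_measurable borel"
proof -
  have "continuous_on (frontier M - Sing M) (\<lambda>x. h (u x))"
    by (rule continuous_on_compose2[OF continuous_h continuous_on_outer_unit_normal]) auto
  then have 1: "(\<lambda>x. indicator (frontier M - Sing M) x *\<^sub>R h (u x)) \<in> borel_measurable borel"
    by (rule borel_measurable_continuous_on_indicator[OF borel_frontier(2)])
  have 2: "(\<lambda>x. indicator (Sing M) x *\<^sub>R h (THE u. False)) \<in> borel_measurable borel"
    using borel_frontier(3) by (intro borel_measurable_scaleR borel_measurable_indicator) auto
  have "(\<lambda>x. indicator (frontier M) x *\<^sub>R h (u x)) =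
      (\<lambda>x. indicator (frontier M - Sing M) x *\<^sub>R h (u x) + indicator (Sing M) x *\<^sub>R h (THE u. False))"
  proof
    fix x
    have "x \<in> frontier M" if "x \<in> Sing M" using that by (simp add: Sing_def)
    then show "indicator (frontier M) x *\<^sub>R h (u x) =
        indicator (frontier M - Sing M) x *\<^sub>R h (u x) + indicator (Sing M) x *\<^sub>R h (THE u. False)"
      by (cases "x \<in> Sing M") (auto simp: outer_unit_normal_Sing indicator_def)
  qed
  then show ?thesis using borel_measurable_add[OF 1 2] by simp
qed

lemma hu_integrable: "set_integrable surface_measure (frontier M) (\<lambda>x. h (u x))"
proof -
  \<comment> \<open>The indicator is doubled because measurability of the integrand is established
    only with the indicator as a factor.\<close>
  have "integrable surface_measure (\<lambda>x. indicator (frontier M) x *\<^sub>R (indicator (frontier M) x *\<^sub>R h (u x)))"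
  proof (rule integrableI_bounded_set_indicator[where B=b0])
    show "frontier M \<in> sets surface_measure" using borel_frontier(1) by simp
    show "(\<lambda>x. indicator (frontier M) x *\<^sub>R h (u x)) \<in> borel_measurable surface_measure"
      using hu_measurable by (simp cong: measurable_cong_sets)
    show "emeasure surface_measure (frontier M) < \<infinity>" using F_fmeasurable by (simp add: fmeasurable_def)
    show "AE x in surface_measure. x \<in> frontier M \<longrightarrow> norm (indicator (frontier M) x *\<^sub>R h (u x)) \<le> b0"
      using hu_bound by (intro AE_I2) auto
  qed
  moreover have "(\<lambda>x. indicator (frontier M) x *\<^sub>R (indicator (frontier M) x *\<^sub>R h (u x))) = (\<lambda>x. indicator (frontier M) x *\<^sub>R h (u x))"
    by (auto simp: indicator_def)
  ultimately show ?thesis unfolding set_integrable_def by simp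
qed

text \<open>Three errors: the factor between area and Hausdorff measure, the variation of the normal
  by \<delta> on each piece, and the remainder of measure at most \<eta>, where the integrand is at
  most \<open>b0\<close>.\<close>

lemma integral_approx:
  fixes m :: nat
  assumes \<rho>: "\<rho> > 0" and E: "\<forall>i<m. chart_piece M \<delta> \<rho> (n i) (\<phi> i) (E i)"
    and sep: "\<forall>i<m. \<forall>j<m. i \<noteq> j \<longrightarrow> (\<forall>a\<in>E i. \<forall>b\<in>E j. 2 * \<rho> \<le> dist a b)"
    and T: "compact T" "T \<subseteq> frontier M" "frontier M - (\<Union>i<m. E i) \<subseteq> T" "measure surface_measure T \<le> \<eta>"
    and \<delta>0: "0 < \<delta>"
  defines "a \<equiv> \<lambda>i. measure (lipschitz_graph.area (n i) (\<phi> i)) (E i)"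
  shows "\<bar>(\<Sum>i<m. h (n i) * a i) - I\<bar> \<le>
      C * ((sqrt (1 + \<delta>\<^sup>2) ^ (DIM('a) - 1) - 1) + \<delta>) * measure surface_measure (frontier M) + b0 * \<eta>"
    and "(\<Sum>i<m. a i) \<le> measure surface_measure (frontier M)"
proof -
  let ?H = "surface_measure :: 'a measure"
  let ?f = "\<lambda>x. h (u x)"
  define k where "k = sqrt (1 + \<delta>\<^sup>2) ^ (DIM('a) - 1)"
  have Ec: "compact (E i)" "E i \<subseteq> frontier M" if "i < m" for i using E that unfolding chart_piece_def by blast+
  have Eb: "E i \<in> sets ?H" if "i < m" for i using Ec[OF that] by (simp add: compact_imp_closed)
  have Ef: "E i \<in> fmeasurable ?H" if "i < m" for i by (rule fmeasurableI2[OF F_fmeasurable Ec(2)[OF that] Eb[OF that]])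
  have disj: "E i \<inter> E j = {}" if ij: "i < m" "j < m" "i \<noteq> j" for i j
  proof -
    have False if y: "y \<in> E i" "y \<in> E j" for y
    proof -
      have "2 * \<rho> \<le> dist y y" using sep ij y by blast
      then show False using \<rho> by simp
    qed
    then show ?thesis by blast
  qed
  have fint: "set_integrable ?H X ?f" if "X \<subseteq> frontier M" "X \<in> sets ?H" for X
    by (rule set_integrable_subset[OF hu_integrable that(2,1)])
  have key: "a i \<le> measure ?H (E i) \<and> \<bar>h (n i) * a i - (LINT x:E i|?H. ?f x)\<bar> \<le> C * ((k - 1) + \<delta>) * measure ?H (E i)"
    if i: "i < m" for i
  proof -
    have cp: "chart_piece M \<delta> \<rho> (n i) (\<phi> i) (E i)" using E i by blast
    interpret lipschitz_graph "n i" "\<phi> i" \<delta> using cp unfolding chart_piece_def by blast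
    have "E i \<subseteq> graph"
    proof
      fix y assume y: "y \<in> E i"
      have "\<exists>e\<in>E i. dist e y < \<rho>" using y \<rho> by (intro bexI[of _ y]) auto
      then show "y \<in> graph" using cp Ec(2)[OF i] y unfolding chart_piece_def graph_def by blast
    qed
    then have H: "a i \<le> measure ?H (E i)" "measure ?H (E i) \<le> k * a i"
      using hausdorff_area(2,3)[of "E i"] Ec(1)[OF i]
      by (simp_all add: a_def k_def \<kappa>_def hyperplane_dim_def compact_imp_closed compact_imp_bounded)
    have k1: "k \<ge> 1" unfolding k_def by (rule one_le_power) simp
    have hC: "\<bar>h (n i)\<bar> \<le> C" using h_abs_le[of "n i"] n by simp
    have "\<bar>(LINT x:E i|?H. ?f x) - h (n i) * measure ?H (E i)\<bar> \<le> (C * \<delta>) * measure ?H (E i)"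
    proof (rule set_integral_near_const[OF fint[OF Ec(2)[OF i] Eb[OF i]] Ef[OF i]])
      fix x assume "x \<in> E i"
      then have "norm (u x - n i) \<le> \<delta>" using cp unfolding chart_piece_def by blast
      then have "C * norm (u x - n i) \<le> C * \<delta>" using C by (intro mult_left_mono) auto
      then show "\<bar>h (u x) - h (n i)\<bar> \<le> C * \<delta>" using h_lipschitz[of "u x" "n i"] by linarith
    qed
    moreover have "\<bar>h (n i) * a i - h (n i) * measure ?H (E i)\<bar> \<le> C * (k - 1) * measure ?H (E i)"
    proof -
      have "\<bar>h (n i) * a i - h (n i) * measure ?H (E i)\<bar> = \<bar>h (n i)\<bar> * (measure ?H (E i) - a i)"
        using H(1) by (simp add: right_diff_distrib[symmetric] abs_mult)
      also have "\<dots> \<le> C * ((k - 1) * measure ?H (E i))"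
      proof (rule mult_mono[OF hC])
        have "(k - 1) * a i \<le> (k - 1) * measure ?H (E i)" using H(1) k1 by (intro mult_left_mono) auto
        then show "measure ?H (E i) - a i \<le> (k - 1) * measure ?H (E i)" using H(2) by (simp add: algebra_simps)
      qed (use H(1) C in auto)
      finally show ?thesis by (simp add: mult.assoc)
    qed
    moreover have "C * ((k - 1) + \<delta>) * measure ?H (E i) = C * (k - 1) * measure ?H (E i) + (C * \<delta>) * measure ?H (E i)"
      by (simp add: algebra_simps)
    ultimately show ?thesis using H(1) by linarith
  qed
  have sumH: "(\<Sum>i<m. measure ?H (E i)) \<le> measure ?H (frontier M)"
  proof -
    have "(\<Sum>i<m. measure ?H (E i)) = measure ?H (\<Union>i<m. E i)"
    proof (rule measure_finite_Union[symmetric])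
      show "disjoint_family_on E {..<m}" using disj unfolding disjoint_family_on_def by blast
      show "E ` {..<m} \<subseteq> sets ?H" using Eb by blast
      show "emeasure ?H (E i) \<noteq> \<infinity>" if "i \<in> {..<m}" for i using Ef[of i] that by (auto simp: fmeasurable_def)
    qed simp
    also have "\<dots> \<le> measure ?H (frontier M)"
      using Ec(2) Eb by (intro measure_mono_fmeasurable F_fmeasurable) auto
    finally show ?thesis .
  qed
  have "(\<Sum>i<m. a i) \<le> (\<Sum>i<m. measure ?H (E i))" using key by (intro sum_mono) auto
  then show "(\<Sum>i<m. a i) \<le> measure ?H (frontier M)" using sumH by linarith
  let ?U = "\<Union>i<m. E i"
  have Ub: "?U \<in> sets ?H" using Eb by auto
  have UF: "?U \<subseteq> frontier M" using Ec(2) by blast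
  have Rb: "frontier M - ?U \<in> sets ?H" using Ub borel_frontier(1) by auto
  have "I = (LINT x:?U \<union> (frontier M - ?U)|?H. ?f x)" unfolding I_def using UF by (simp add: Un_absorb1)
  also have "\<dots> = (LINT x:?U|?H. ?f x) + (LINT x:frontier M - ?U|?H. ?f x)"
    by (rule set_integral_Un) (use fint UF Ub Rb in auto)
  also have "(LINT x:?U|?H. ?f x) = (\<Sum>i<m. LINT x:E i|?H. ?f x)"
  proof (rule set_integral_finite_UN_AE)
    show "AE x in ?H. x \<in> E i \<and> x \<in> E j \<longrightarrow> i = j" if "i \<in> {..<m}" "j \<in> {..<m}" for i j
      using disj[of i j] that by (intro AE_I2) blast
  qed (use Eb Ec fint in auto)
  finally have I: "I = (\<Sum>i<m. LINT x:E i|?H. ?f x) + (LINT x:frontier M - ?U|?H. ?f x)" .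
  have Rf: "frontier M - ?U \<in> fmeasurable ?H" by (rule fmeasurableI2[OF F_fmeasurable _ Rb]) blast
  have b0: "b0 \<ge> 0" unfolding b0_def using C by (intro mult_nonneg_nonneg) auto
  have "\<bar>(LINT x:frontier M - ?U|?H. ?f x) - 0 * measure ?H (frontier M - ?U)\<bar> \<le> b0 * measure ?H (frontier M - ?U)"
    by (rule set_integral_near_const[OF fint[OF _ Rb] Rf]) (use hu_bound in auto)
  also have "\<dots> \<le> b0 * \<eta>"
  proof (rule mult_left_mono[OF _ b0])
    have "measure ?H (frontier M - ?U) \<le> measure ?H T"
    proof (rule measure_mono_fmeasurable[OF T(3) Rb])
      show "T \<in> fmeasurable ?H" by (rule fmeasurableI2[OF F_fmeasurable T(2)]) (use T(1) in \<open>simp add: compact_imp_closed\<close>)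
    qed
    then show "measure ?H (frontier M - ?U) \<le> \<eta>" using T(4) by linarith
  qed
  finally have rest: "\<bar>(LINT x:frontier M - ?U|?H. ?f x)\<bar> \<le> b0 * \<eta>" by simp
  have "\<bar>(\<Sum>i<m. h (n i) * a i) - (\<Sum>i<m. LINT x:E i|?H. ?f x)\<bar> = \<bar>\<Sum>i<m. h (n i) * a i - (LINT x:E i|?H. ?f x)\<bar>"
    by (simp add: sum_subtractf)
  also have "\<dots> \<le> (\<Sum>i<m. C * ((k - 1) + \<delta>) * measure ?H (E i))"
    using key by (intro order.trans[OF sum_abs] sum_mono) auto
  also have "\<dots> = C * ((k - 1) + \<delta>) * (\<Sum>i<m. measure ?H (E i))" by (rule sum_distrib_left[symmetric])
  also have "\<dots> \<le> C * ((k - 1) + \<delta>) * measure ?H (frontier M)"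
  proof (rule mult_left_mono[OF sumH])
    have "k \<ge> 1" unfolding k_def by (rule one_le_power) simp
    then show "0 \<le> C * ((k - 1) + \<delta>)" using C \<delta>0 by (intro mult_nonneg_nonneg) auto
  qed
  finally show "\<bar>(\<Sum>i<m. h (n i) * a i) - I\<bar> \<le> C * ((sqrt (1 + \<delta>\<^sup>2) ^ (DIM('a) - 1) - 1) + \<delta>) * measure ?H (frontier M) + b0 * \<eta>"
    using rest unfolding I k_def[symmetric] by linarith
qed

text \<open>The errors of \<open>integral_approx\<close> and \<open>estimate\<close> with \<eta> set
  equal to \<delta>; the sum of the areas \<open>a i\<close> is replaced by its bound, the surface
  measure of the boundary.\<close>

definition err :: "real \<Rightarrow> real" where
  "err \<delta> = C * ((sqrt (1 + \<delta>\<^sup>2) ^ (DIM('a) - 1) - 1) + \<delta>) * measure surface_measure (frontier M) + b0 * \<delta>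
    + (\<delta> * C + 2 * \<delta>) * measure surface_measure (frontier M) + 24 * real (card \<Q>) * C * \<delta>"

lemma err_tendsto: "(err \<longlongrightarrow> 0) (at_right 0)"
proof -
  have "(err \<longlongrightarrow> C * ((sqrt (1 + 0\<^sup>2) ^ (DIM('a) - 1) - 1) + 0) * measure surface_measure (frontier M) + b0 * 0
    + (0 * C + 2 * 0) * measure surface_measure (frontier M) + 24 * real (card \<Q>) * C * 0) (at_right 0)"
    unfolding err_def by (intro tendsto_intros)
  then show ?thesis by simp
qed

lemma quotient_bounds:
  assumes \<delta>1: "0 < \<delta>" "\<delta> \<le> 1"
  shows "\<forall>\<^sub>F \<epsilon> in at_right 0. (vol (A \<epsilon>) - vol M) / \<epsilon> \<le> I + err \<delta> \<and>
    I - err \<delta> \<le> (vol (B \<epsilon>) - vol M) / \<epsilon>"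
proof -
  obtain m :: nat and n \<phi> E \<rho> T where P: "\<rho> > 0" "\<forall>i<m. chart_piece M \<delta> \<rho> (n i) (\<phi> i) (E i)"
    "\<forall>i<m. \<forall>j<m. i \<noteq> j \<longrightarrow> (\<forall>a\<in>E i. \<forall>b\<in>E j. 2 * \<rho> \<le> dist a b)"
    "compact T" "T \<subseteq> frontier M" "frontier M - (\<Union>i<m. E i) \<subseteq> T" "measure surface_measure T \<le> \<delta>"
    using boundary_partition[OF M F_fmeasurable Sing0 \<delta>1(1) \<delta>1(1)] by (elim exE conjE)
  define a where "a i = measure (lipschitz_graph.area (n i) (\<phi> i)) (E i)" for i
  note ap = integral_approx[OF P \<delta>1(1), folded a_def]
  have sum: "(\<Sum>i<m. (h (n i) + c) * a i) = (\<Sum>i<m. h (n i) * a i) + c * (\<Sum>i<m. a i)" for c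
    by (simp add: distrib_right sum.distrib sum_distrib_left)
  have le: "(\<delta> * C + 2 * \<delta>) * (\<Sum>i<m. a i) \<le> (\<delta> * C + 2 * \<delta>) * measure surface_measure (frontier M)"
    using ap(2) \<delta>1 C by (intro mult_left_mono) auto
  have up: "(\<Sum>i<m. (h (n i) + \<delta> * C + 2 * \<delta>) * a i) + 24 * real (card \<Q>) * C * \<delta> \<le> I + err \<delta>"
    using sum[of "\<delta> * C + 2 * \<delta>"] ap(1) le unfolding err_def add.assoc[symmetric] by linarith
  have lo: "I - err \<delta> \<le> (\<Sum>i<m. (h (n i) - \<delta> * C - 2 * \<delta>) * a i) - 24 * real (card \<Q>) * C * \<delta>"
  proof -
    have e: "(h (n i) - \<delta> * C - 2 * \<delta>) * a i = h (n i) * a i - (\<delta> * C + 2 * \<delta>) * a i" for i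
      by (simp add: algebra_simps)
    have "(\<Sum>i<m. (h (n i) - \<delta> * C - 2 * \<delta>) * a i) = (\<Sum>i<m. h (n i) * a i) - (\<delta> * C + 2 * \<delta>) * (\<Sum>i<m. a i)"
      unfolding e sum_subtractf sum_distrib_left ..
    then show ?thesis using ap(1) le unfolding err_def by linarith
  qed
  show ?thesis
    using estimate[OF P \<delta>1 \<delta>1(1), folded a_def]
  proof eventually_elim
    case (elim \<epsilon>)
    then show ?case using up lo by linarith
  qed
qed

theorem quotient_tendsto:
  assumes S: "\<And>\<epsilon>. \<epsilon> > 0 \<Longrightarrow> B \<epsilon> \<subseteq> S \<epsilon>" "\<And>\<epsilon>. \<epsilon> > 0 \<Longrightarrow> S \<epsilon> \<subseteq> A \<epsilon>"
  shows "((\<lambda>\<epsilon>. (volume (S \<epsilon>) - volume M) / \<epsilon>) \<longlongrightarrow> I) (at_right 0)"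
proof (rule tendstoI)
  fix e :: real assume e: "e > 0"
  have "\<forall>\<^sub>F \<delta> in at_right 0. err \<delta> < e" using err_tendsto e by (rule order_tendstoD(2))
  moreover have "\<forall>\<^sub>F \<delta>::real in at_right 0. \<delta> \<in> {0<..<1}" by (rule eventually_at_rightI[of 0 1]) auto
  ultimately have "\<forall>\<^sub>F \<delta> in at_right 0. err \<delta> < e \<and> \<delta> \<in> {0<..<1}" by eventually_elim blast
  \<comment> \<open>The partition is fixed before \<epsilon> tends to 0; how small \<epsilon> must
    be depends on its \<rho>.\<close>
  then obtain \<delta> where \<delta>: "err \<delta> < e" "0 < \<delta>" "\<delta> \<le> 1"
    using eventually_happens'[OF trivial_limit_at_right_real] by fastforce
  have volM: "volume M = vol M" using M by (simp add: volume_eq_measure compact_imp_closed)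
  show "\<forall>\<^sub>F \<epsilon> in at_right 0. dist ((volume (S \<epsilon>) - volume M) / \<epsilon>) I < e"
    using quotient_bounds[OF \<delta>(2,3)] eventually_at_right_less[of "0::real"]
  proof eventually_elim
    case (elim \<epsilon>)
    have v: "vol (B \<epsilon>) \<le> volume (S \<epsilon>)" "volume (S \<epsilon>) \<le> vol (A \<epsilon>)"
      using volume_between[OF open_B compact_A S(1)[OF elim(2)] S(2)[OF elim(2)]] .
    have "(vol (B \<epsilon>) - vol M) / \<epsilon> \<le> (volume (S \<epsilon>) - volume M) / \<epsilon>"
      "(volume (S \<epsilon>) - volume M) / \<epsilon> \<le> (vol (A \<epsilon>) - vol M) / \<epsilon>"
      unfolding volM using v elim(2) by (auto intro!: divide_right_mono)
    then show ?case using elim(1) \<delta>(1) unfolding dist_real_def by linarith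
  qed
qed

end

theorem theorem3:
  fixes M N :: "'a::euclidean_space set"
  assumes "piecewise_C1_domain M" and "N \<noteq> {}" and "bounded N"
  shows "D_exists N M \<and> D_exists (convex hull N) M \<and>
    D N M = D (convex hull N) M \<and>
    set_integrable (hausdorff_measure (DIM('a) - 1)) (frontier M)
      (\<lambda>x. support_function N (outer_unit_normal M x)) \<and>
    D N M = (LINT x:frontier M|hausdorff_measure (DIM('a) - 1).
      support_function N (outer_unit_normal M x))"
proof -
  have M: "compact M" using assms(1) by (simp add: piecewise_C1_domain_def)
  obtain \<P> where \<P>: "finite \<P>" "frontier M = \<Union>\<P>" "\<forall>P\<in>\<P>. compact P \<and> (\<exists>S. C1_hypersurface S \<and> P \<subseteq> S)"
    using assms(1) unfolding piecewise_C1_domain_def by blast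
  have lim: "((\<lambda>\<epsilon>. volume (Sing M + (*\<^sub>R) \<epsilon> ` cball 0 1) / \<epsilon>) \<longlongrightarrow> 0) (at_right 0)"
    using assms(1) by (simp add: piecewise_C1_domain_def)
  have "\<exists>\<Q>. graph_pieces \<Q> (\<Union>\<P>)"
    using \<P>(1,3) C1_hypersurface_graph_pieces by (intro graph_pieces_UN) blast+
  then obtain \<Q> where \<Q>: "graph_pieces \<Q> (frontier M)" unfolding \<P>(2)[symmetric] by blast
  have SF: "Sing M \<subseteq> frontier M" by (auto simp: Sing_def)
  have cS: "compact (Sing M)"
    using closed_Int_compact[of "Sing M" "frontier M", OF closed_Sing compact_frontier[OF M]] SF by (simp add: Int_absorb2)
  have "((\<lambda>\<epsilon>. vol (thicken (Sing M) \<epsilon>) / \<epsilon>) \<longlongrightarrow> 0) (at_right 0)"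
  proof (rule Lim_transform_eventually[OF lim])
    show "\<forall>\<^sub>F \<epsilon> in at_right 0. volume (Sing M + (*\<^sub>R) \<epsilon> ` cball 0 1) / \<epsilon> = vol (thicken (Sing M) \<epsilon>) / \<epsilon>"
      using eventually_at_right_less[of "0::real"]
    proof eventually_elim
      case (elim \<epsilon>)
      have e: "(*\<^sub>R) \<epsilon> ` cball 0 1 = (cball 0 \<epsilon> :: 'a set)" using elim cball_scale[of \<epsilon> "0::'a" 1] by simp
      have "Sing M + (*\<^sub>R) \<epsilon> ` cball 0 1 = thicken (Sing M) \<epsilon>"
        unfolding e thicken_eq_sum set_plus_def by blast
      then show ?case using compact_thicken[OF cS, of \<epsilon>] by (simp add: volume_eq_measure compact_imp_closed)
    qed
  qed
  then have Sing0: "measure (hausdorff_measure (DIM('a) - 1)) (Sing M) = 0"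
    by (rule graph_pieces_content_null[OF \<Q> cS SF])
  obtain C where C: "C > 0" "\<And>p. p \<in> N \<Longrightarrow> norm p \<le> C" using assms(3) bounded_pos by metis
  interpret piecewise_C1_sum M N \<Q> C
    by unfold_locales (use M \<Q> Sing0 assms(2) C in auto)
  have "(volume_quotient X M \<longlongrightarrow> I) (at_right 0)" if X: "N \<subseteq> X" "X \<subseteq> K" for X
    unfolding volume_quotient_def set_plus_scaleR
  proof (rule quotient_tendsto)
    fix \<epsilon> :: real
    show "B \<epsilon> \<subseteq> scaled_sum M \<epsilon> X" unfolding B_def using X(1) interior_subset by blast
    show "scaled_sum M \<epsilon> X \<subseteq> A \<epsilon>" unfolding A_def using X(2) by blast
  qed
  then have lims: "(volume_quotient N M \<longlongrightarrow> I) (at_right 0)" "(volume_quotient (convex hull N) M \<longlongrightarrow> I) (at_right 0)"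
    using N_subset_K by blast+
  show ?thesis
    using lims D_eqI[OF lims(1)] D_eqI[OF lims(2)] hu_integrable unfolding D_exists_def I_def h_def by auto
qed

end
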